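(* Let $N,M,L\ge 2$ be integers. For $\pi_1,\pi_1'\in\mathrm{Rep}\,\mathcal O_N$, $\pi_2,\pi_2'\in\mathrm{Rep}\,\mathcal O_M$ and $\pi_3\in\mathrm{Rep}\,\mathcal O_L$, the following holds. (i) If $\pi_1\sim\pi_1'$ and $\pi_2\sim\pi_2'$, then $\pi_1\otimes_\varphi\pi_2\sim\pi_1'\otimes_\varphi\pi_2'$. (ii) $\pi_1\otimes_\varphi(\pi_2\oplus\pi_2')=(\pi_1\otimes_\varphi\pi_2)\oplus(\pi_1\otimes_\varphi\pi_2')$. (iii) $\pi_1\otimes_\varphi(\pi_2\otimes_\varphi\pi_3)=(\pi_1\otimes_\varphi\pi_2)\otimes_\varphi\pi_3$. (The equalities in (ii) and (iii) are understood under the usual identifications of Hilbert spaces $\mathcal H_1\otimes(\mathcal H_2\oplus\mathcal H_2')=(\mathcal H_1\otimes\mathcal H_2)\oplus(\mathcal H_1\otimes\mathcal H_2')$ and $\mathcal H_1\otimes(\mathcal H_2\otimes\mathcal H_3)=(\mathcal H_1\otimes\mathcal H_2)\otimes\mathcal H_3$.)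
   Context: For $N\ge2$, $\mathcal O_N$ is the Cuntz algebra: the universal C$^*$-algebra generated by $s_1,\dots,s_N$ (the canonical generators) with $s_i^*s_j=\delta_{ij}I$ and $\sum_{i=1}^N s_is_i^*=I$. $\mathrm{Rep}\,\mathcal O_N$ is the class of all unital $*$-representations of $\mathcal O_N$ on Hilbert spaces; $\pi\sim\pi'$ means unitary equivalence. For $N,M\ge2$ let $t_1,\dots,t_N$, $r_1,\dots,r_M$, $s_1,\dots,s_{NM}$ be the canonical generators of $\mathcal O_N,\mathcal O_M,\mathcal O_{NM}$. The unital $*$-embedding $\varphi_{N,M}:\mathcal O_{NM}\to\mathcal O_N\otimes\mathcal O_M$ is defined by $\varphi_{N,M}(s_{M(i-1)+j})=t_i\otimes r_j$ for $i=1,\dots,N$, $j=1,\dots,M$. For $\pi_1\in\mathrm{Rep}\,\mathcal O_N$ and $\pi_2\in\mathrm{Rep}\,\mathcal O_M$, the $\varphi$-tensor product is $\pi_1\otimes_\varphi\pi_2:=(\pi_1\otimes\pi_2)\circ\varphi_{N,M}\in\mathrm{Rep}\,\mathcal O_{NM}$, acting on the Hilbert space tensor product. *)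

theory Defs
  imports "HOL-Analysis.Analysis"
begin

section \<open>Complex Hilbert spaces\<close>

text \<open>
  A complex Hilbert space is a complete real inner product space (this supplies norm, topology and
  the type of bounded operators) with a complex scalar multiplication and a complex inner product,
  linear in the second argument, whose real part is the real inner product.
\<close>

class chilbert = real_inner + complete_space +
  fixes scaleC :: "complex \<Rightarrow> 'a \<Rightarrow> 'a"  (infixr "*\<^sub>C" 75)
    and cinner :: "'a \<Rightarrow> 'a \<Rightarrow> complex"
  assumes scaleC_add_right: "c *\<^sub>C (x + y) = c *\<^sub>C x + c *\<^sub>C y"
    and scaleC_add_left: "(c + d) *\<^sub>C x = c *\<^sub>C x + d *\<^sub>C x"
    and scaleC_scaleC: "c *\<^sub>C d *\<^sub>C x = (c * d) *\<^sub>C x"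
    and scaleC_of_real: "complex_of_real r *\<^sub>C x = r *\<^sub>R x"
    and cinner_commute: "cinner x y = cnj (cinner y x)"
    and cinner_add_right: "cinner x (y + z) = cinner x y + cinner x z"
    and cinner_scaleC_right: "cinner x (c *\<^sub>C y) = c * cinner x y"
    and Re_cinner: "Re (cinner x y) = inner x y"

lemma cinner_add_left: "cinner (x + y) z = cinner x z + cinner y z"
  by (metis cinner_add_right cinner_commute complex_cnj_add)

lemma cinner_scaleC_left: "cinner (c *\<^sub>C x) y = cnj c * cinner x y"
  by (metis cinner_commute cinner_scaleC_right complex_cnj_mult)

lemma cinner_self: "cinner x x = complex_of_real ((norm x)\<^sup>2)"
proof -
  have "Im (cinner x x) = 0"
    by (metis cinner_commute complex_cnj complex.sel(2) equal_neg_zero complex_surj)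
  then show ?thesis
    by (simp add: complex_eq_iff Re_cinner power2_norm_eq_inner)
qed

lemma cinner_zero_right [simp]: "cinner x 0 = 0"
  by (metis add_cancel_right_right cinner_add_right)

lemma cinner_zero_left [simp]: "cinner 0 x = 0"
  by (metis cinner_commute cinner_zero_right complex_cnj_zero)

lemma scaleC_zero_left [simp]: "0 *\<^sub>C (x::'a::chilbert) = 0"
  using scaleC_of_real[of 0 x] by simp

lemma scaleC_zero_right [simp]: "c *\<^sub>C (0::'a::chilbert) = 0"
  using scaleC_add_right[of c "0::'a" 0] by simp

lemma scaleC_one [simp]: "1 *\<^sub>C (x::'a::chilbert) = x"
  using scaleC_of_real[of 1 x] by simp

lemma scaleC_minus_one: "(-1) *\<^sub>C (x::'a::chilbert) = - x"
  using scaleC_of_real[of "-1" x] by simp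

lemma cinner_minus_right: "cinner x (- y) = - cinner x y"
  by (metis cinner_scaleC_right mult_minus1 scaleC_minus_one)

lemma cinner_diff_right: "cinner x (y - z) = cinner x y - cinner x z"
  using cinner_add_right[of x y "- z"] by (simp add: cinner_minus_right)

lemma cinner_diff_left: "cinner (x - y) z = cinner x z - cinner y z"
  by (metis cinner_commute cinner_diff_right complex_cnj_diff)

lemma cinner_sum_right: "cinner x (sum f A) = (\<Sum>i\<in>A. cinner x (f i))"
  by (induction A rule: infinite_finite_induct) (simp_all add: cinner_add_right)

lemma cinner_sum_left: "cinner (sum f A) x = (\<Sum>i\<in>A. cinner (f i) x)"
  by (induction A rule: infinite_finite_induct) (simp_all add: cinner_add_left)

lemma cinner_scaleR_right: "cinner x (r *\<^sub>R y) = complex_of_real r * cinner x y"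
  by (metis cinner_scaleC_right scaleC_of_real)

lemma norm_scaleC: "norm (c *\<^sub>C (x::'a::chilbert)) = cmod c * norm x"
proof -
  have "complex_of_real ((norm (c *\<^sub>C x))\<^sup>2) = cnj c * c * complex_of_real ((norm x)\<^sup>2)"
    by (simp only: cinner_self [symmetric] cinner_scaleC_left cinner_scaleC_right) simp
  also have "cnj c * c = complex_of_real ((cmod c)\<^sup>2)"
    by (metis complex_norm_square mult.commute)
  finally have "(norm (c *\<^sub>C x))\<^sup>2 = (cmod c)\<^sup>2 * (norm x)\<^sup>2"
    by (metis of_real_eq_iff of_real_mult)
  then show ?thesis
    by (metis norm_ge_zero power2_eq_iff_nonneg power_mult_distrib zero_le_mult_iff)
qed

lemma scaleC_scaleR_commute: "c *\<^sub>C r *\<^sub>R (x::'a::chilbert) = r *\<^sub>R c *\<^sub>C x"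
  by (simp only: scaleC_of_real [symmetric] scaleC_scaleC mult.commute)

lemma bounded_linear_scaleC: "bounded_linear (\<lambda>x::'a::chilbert. c *\<^sub>C x)"
  by (rule bounded_linear_intro[where K = "cmod c"])
     (simp_all add: scaleC_add_right scaleC_scaleR_commute norm_scaleC mult.commute)

lemma norm_cinner_le: "cmod (cinner x y) \<le> norm x * norm y"
proof (cases "cinner x y = 0")
  case False
  define u where "u = cnj (sgn (cinner x y))"
  have u: "cmod u = 1" using False by (simp add: u_def norm_sgn)
  have "u * cinner x y = complex_of_real (cmod (cinner x y))"
    unfolding u_def using False
    by (simp add: sgn_eq mult.commute complex_norm_square [symmetric] power2_eq_square)
  then have "cmod (cinner x y) = Re (cinner x (u *\<^sub>C y))"
    by (simp add: cinner_scaleC_right)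
  also have "\<dots> = inner x (u *\<^sub>C y)" by (simp add: Re_cinner)
  also have "\<dots> \<le> norm x * norm (u *\<^sub>C y)" by (rule norm_cauchy_schwarz)
  finally show ?thesis by (simp add: norm_scaleC u)
qed simp

lemma bounded_linear_cinner_right: "bounded_linear (\<lambda>y. cinner x y)"
  by (rule bounded_linear_intro[where K = "norm x"])
     (simp_all add: cinner_add_right cinner_scaleR_right scaleR_conv_of_real norm_cinner_le
       mult.commute[of _ "norm x"])

text \<open>The Hilbert space direct sum is the product type.\<close>

instantiation prod :: (chilbert, chilbert) chilbert
begin

definition scaleC_prod :: "complex \<Rightarrow> 'a \<times> 'b \<Rightarrow> 'a \<times> 'b"
  where "scaleC_prod c x = (c *\<^sub>C fst x, c *\<^sub>C snd x)"

definition cinner_prod :: "'a \<times> 'b \<Rightarrow> 'a \<times> 'b \<Rightarrow> complex"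
  where "cinner_prod x y = cinner (fst x) (fst y) + cinner (snd x) (snd y)"

instance
proof
  fix x y z :: "'a \<times> 'b" and c d :: complex and r :: real
  show "cinner x y = cnj (cinner y x)"
    unfolding cinner_prod_def
    using cinner_commute[of "fst x" "fst y"] cinner_commute[of "snd x" "snd y"] by simp
qed (simp_all add: scaleC_prod_def cinner_prod_def scaleC_add_right scaleC_add_left
       scaleC_scaleC scaleC_of_real cinner_add_right cinner_scaleC_right Re_cinner
       inner_prod_def algebra_simps scaleR_prod_def)

end

section \<open>Square-summable families\<close>

typedef 'i ell2 = "{f :: 'i \<Rightarrow> complex. (\<lambda>i. (cmod (f i))\<^sup>2) summable_on UNIV}"
  morphisms ell2_apply Abs_ell2
  by (rule exI[of _ "\<lambda>_. 0"]) simp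

setup_lifting type_definition_ell2

lemma ell2_apply_summable: "(\<lambda>i. (cmod (ell2_apply f i))\<^sup>2) summable_on A"
  using ell2_apply[of f] summable_on_subset_banach by blast

lemma ell2_mult_summable:
  assumes "(\<lambda>i. (cmod (f i))\<^sup>2) summable_on A" "(\<lambda>i. (cmod (g i))\<^sup>2) summable_on A"
  shows "(\<lambda>i. cnj (f i) * g i) summable_on A"
proof (rule abs_summable_summable, rule summable_on_comparison_test)
  show "(\<lambda>i. (cmod (f i))\<^sup>2 + (cmod (g i))\<^sup>2) summable_on A"
    using assms by (rule summable_on_add)
  fix i
  have "2 * (cmod (f i) * cmod (g i)) \<le> (cmod (f i))\<^sup>2 + (cmod (g i))\<^sup>2"
    using sum_squares_bound[of "cmod (f i)" "cmod (g i)"] by simp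
  moreover have "0 \<le> cmod (f i) * cmod (g i)" by simp
  ultimately have "cmod (f i) * cmod (g i) \<le> (cmod (f i))\<^sup>2 + (cmod (g i))\<^sup>2" by linarith
  then show "norm (cnj (f i) * g i) \<le> (cmod (f i))\<^sup>2 + (cmod (g i))\<^sup>2"
    by (simp add: norm_mult)
qed simp_all

lemma ell2_add_summable:
  assumes "(\<lambda>i. (cmod (f i))\<^sup>2) summable_on A" "(\<lambda>i. (cmod (g i))\<^sup>2) summable_on A"
  shows "(\<lambda>i. (cmod (f i + g i))\<^sup>2) summable_on A"
proof (rule summable_on_comparison_test)
  show "(\<lambda>i. 2 * (cmod (f i))\<^sup>2 + 2 * (cmod (g i))\<^sup>2) summable_on A"
    using assms by (intro summable_on_add summable_on_cmult_right)
  fix i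
  have "(cmod (f i + g i))\<^sup>2 \<le> (cmod (f i) + cmod (g i))\<^sup>2"
    by (simp add: norm_triangle_ineq power_mono)
  also have "\<dots> \<le> 2 * (cmod (f i))\<^sup>2 + 2 * (cmod (g i))\<^sup>2"
    using sum_squares_bound[of "cmod (f i)" "cmod (g i)"] by (simp add: power2_sum)
  finally show "(cmod (f i + g i))\<^sup>2 \<le> 2 * (cmod (f i))\<^sup>2 + 2 * (cmod (g i))\<^sup>2" .
qed simp_all

lemma ell2_scale_summable:
  assumes "(\<lambda>i. (cmod (f i))\<^sup>2) summable_on A"
  shows "(\<lambda>i. (cmod (c * f i))\<^sup>2) summable_on A"
  using summable_on_cmult_right[OF assms, of "(cmod c)\<^sup>2"]
  by (simp add: norm_mult power_mult_distrib)

instantiation ell2 :: (type) real_inner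
begin

lift_definition zero_ell2 :: "'a ell2" is "\<lambda>_. 0" by simp

lift_definition plus_ell2 :: "'a ell2 \<Rightarrow> 'a ell2 \<Rightarrow> 'a ell2" is "\<lambda>f g i. f i + g i"
  by (rule ell2_add_summable)

lift_definition uminus_ell2 :: "'a ell2 \<Rightarrow> 'a ell2" is "\<lambda>f i. - f i" by simp

lift_definition minus_ell2 :: "'a ell2 \<Rightarrow> 'a ell2 \<Rightarrow> 'a ell2" is "\<lambda>f g i. f i - g i"
  subgoal for f g using ell2_add_summable[of f UNIV "\<lambda>i. - g i"] by simp
  done

lift_definition scaleR_ell2 :: "real \<Rightarrow> 'a ell2 \<Rightarrow> 'a ell2" is "\<lambda>r f i. complex_of_real r * f i"
  by (rule ell2_scale_summable)

definition inner_ell2 :: "'a ell2 \<Rightarrow> 'a ell2 \<Rightarrow> real"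
  where "inner_ell2 f g = Re (\<Sum>\<^sub>\<infinity>i. cnj (ell2_apply f i) * ell2_apply g i)"

definition norm_ell2 :: "'a ell2 \<Rightarrow> real"
  where "norm_ell2 f = sqrt (\<Sum>\<^sub>\<infinity>i. (cmod (ell2_apply f i))\<^sup>2)"

definition dist_ell2 :: "'a ell2 \<Rightarrow> 'a ell2 \<Rightarrow> real"
  where "dist_ell2 f g = norm (f - g)"

definition sgn_ell2 :: "'a ell2 \<Rightarrow> 'a ell2"
  where "sgn_ell2 f = inverse (norm f) *\<^sub>R f"

definition uniformity_ell2 :: "('a ell2 \<times> 'a ell2) filter"
  where "uniformity_ell2 = (INF e\<in>{0<..}. principal {(f, g). dist f g < e})"

definition open_ell2 :: "'a ell2 set \<Rightarrow> bool"
  where "open_ell2 U \<longleftrightarrow> (\<forall>f\<in>U. \<forall>\<^sub>F (f', g) in uniformity. f' = f \<longrightarrow> g \<in> U)"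

lemma ell2_mult_summable': "(\<lambda>i. cnj (ell2_apply f i) * ell2_apply g i) summable_on UNIV"
  by (intro ell2_mult_summable ell2_apply_summable)

lemma inner_ell2_self: "inner (f::'a ell2) f = (\<Sum>\<^sub>\<infinity>i. (cmod (ell2_apply f i))\<^sup>2)"
proof -
  have "Re (cnj (ell2_apply f i) * ell2_apply f i) = (cmod (ell2_apply f i))\<^sup>2" for i
    by (simp add: cmod_power2) (simp add: power2_eq_square)
  then show ?thesis
    unfolding inner_ell2_def infsum_Re[OF ell2_mult_summable'[of f f], symmetric] by simp
qed

instance
proof
  fix f g h :: "'a ell2" and r s :: real
  show "f + g + h = f + (g + h)" "f + g = g + f" "0 + f = f" "- f + f = 0" "f - g = f + - g"
    "r *\<^sub>R (f + g) = r *\<^sub>R f + r *\<^sub>R g" "(r + s) *\<^sub>R f = r *\<^sub>R f + s *\<^sub>R f"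
    "r *\<^sub>R s *\<^sub>R f = (r * s) *\<^sub>R f" "1 *\<^sub>R f = f"
    by (transfer; simp add: algebra_simps fun_eq_iff)+
  show "dist f g = norm (f - g)" by (fact dist_ell2_def)
  show "sgn f = inverse (norm f) *\<^sub>R f" by (fact sgn_ell2_def)
  show "uniformity = (INF e\<in>{0<..}. principal {(f, g::'a ell2). dist f g < e})"
    by (fact uniformity_ell2_def)
  show "open U \<longleftrightarrow> (\<forall>f\<in>U. \<forall>\<^sub>F (f', g) in uniformity. f' = f \<longrightarrow> g \<in> U)" for U :: "'a ell2 set"
    by (fact open_ell2_def)
  show "inner f g = inner g f"
  proof -
    have "(\<Sum>\<^sub>\<infinity>i. cnj (ell2_apply f i) * ell2_apply g i)
        = (\<Sum>\<^sub>\<infinity>i. cnj (cnj (ell2_apply g i) * ell2_apply f i))"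
      by (simp add: mult.commute)
    also have "\<dots> = cnj (\<Sum>\<^sub>\<infinity>i. cnj (ell2_apply g i) * ell2_apply f i)"
      by (rule infsum_cnj)
    finally show ?thesis by (simp add: inner_ell2_def)
  qed
  show "inner (f + g) h = inner f h + inner g h"
    by (simp add: inner_ell2_def plus_ell2.rep_eq distrib_right
        infsum_add[OF ell2_mult_summable' ell2_mult_summable'])
  show "inner (r *\<^sub>R f) g = r * inner f g"
    by (simp add: inner_ell2_def scaleR_ell2.rep_eq mult.assoc infsum_cmult_right')
  show "0 \<le> inner f f" by (simp add: inner_ell2_self infsum_nonneg)
  show "norm f = sqrt (inner f f)" by (simp add: inner_ell2_self norm_ell2_def)
  show "inner f f = 0 \<longleftrightarrow> f = 0"
  proof
    assume "inner f f = 0"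
    then have "\<And>i. (cmod (ell2_apply f i))\<^sup>2 = 0"
      unfolding inner_ell2_self
      by (intro nonneg_infsum_le_0D[where A = UNIV]) (auto intro: ell2_apply_summable)
    then show "f = 0" by transfer auto
  next
    assume "f = 0"
    then show "inner f f = 0" by (simp add: inner_ell2_self zero_ell2.rep_eq)
  qed
qed

end

lemma power2_norm_ell2: "(norm (f::'i ell2))\<^sup>2 = (\<Sum>\<^sub>\<infinity>i. (cmod (ell2_apply f i))\<^sup>2)"
  by (simp add: power2_norm_eq_inner inner_ell2_self)

lemma ell2_sum_le_norm: "finite F \<Longrightarrow> (\<Sum>i\<in>F. (cmod (ell2_apply f i))\<^sup>2) \<le> (norm f)\<^sup>2"
  unfolding power2_norm_ell2 by (rule finite_sum_le_infsum) (auto intro: ell2_apply_summable)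

lemma ell2_apply_le_norm: "cmod (ell2_apply f i) \<le> norm f"
  using ell2_sum_le_norm[of "{i}" f] power2_le_imp_le by fastforce

instance ell2 :: (type) complete_space
proof
  fix X :: "nat \<Rightarrow> 'a ell2"
  assume X: "Cauchy X"
  have "Cauchy (\<lambda>n. ell2_apply (X n) i)" for i
  proof (rule metric_CauchyI)
    fix e :: real assume "e > 0"
    then obtain M where M: "\<And>m n. m \<ge> M \<Longrightarrow> n \<ge> M \<Longrightarrow> dist (X m) (X n) < e"
      using X metric_CauchyD by blast
    have "dist (ell2_apply (X m) i) (ell2_apply (X n) i) \<le> dist (X m) (X n)" for m n
      using ell2_apply_le_norm[of "X m - X n" i] by (simp add: dist_norm minus_ell2.rep_eq)
    then show "\<exists>M. \<forall>m\<ge>M. \<forall>n\<ge>M. dist (ell2_apply (X m) i) (ell2_apply (X n) i) < e"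
      using M by (meson le_less_trans)
  qed
  then have "\<forall>i. \<exists>l. (\<lambda>n. ell2_apply (X n) i) \<longlonglongrightarrow> l"
    by (simp add: Cauchy_convergent_iff convergent_def)
  from choice[OF this] obtain l where l: "\<And>i. (\<lambda>n. ell2_apply (X n) i) \<longlonglongrightarrow> l i"
    by blast
  have tail: "\<exists>M. \<forall>m\<ge>M. \<forall>F. finite F \<longrightarrow> (\<Sum>i\<in>F. (cmod (ell2_apply (X m) i - l i))\<^sup>2) \<le> e\<^sup>2"
    if "e > 0" for e
  proof -
    obtain M where M: "\<And>m n. m \<ge> M \<Longrightarrow> n \<ge> M \<Longrightarrow> dist (X m) (X n) < e"
      using X metric_CauchyD \<open>e > 0\<close> by blast
    have "(\<Sum>i\<in>F. (cmod (ell2_apply (X m) i - l i))\<^sup>2) \<le> e\<^sup>2" if "m \<ge> M" "finite F" for m F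
    proof (rule tendsto_upperbound)
      show "(\<lambda>n. \<Sum>i\<in>F. (cmod (ell2_apply (X m) i - ell2_apply (X n) i))\<^sup>2)
          \<longlonglongrightarrow> (\<Sum>i\<in>F. (cmod (ell2_apply (X m) i - l i))\<^sup>2)"
        by (intro tendsto_intros l)
      have "(\<Sum>i\<in>F. (cmod (ell2_apply (X m) i - ell2_apply (X n) i))\<^sup>2) \<le> e\<^sup>2" if "n \<ge> M" for n
      proof -
        have "(\<Sum>i\<in>F. (cmod (ell2_apply (X m) i - ell2_apply (X n) i))\<^sup>2) \<le> (norm (X m - X n))\<^sup>2"
          using ell2_sum_le_norm[OF \<open>finite F\<close>, of "X m - X n"] by (simp add: minus_ell2.rep_eq)
        also have "\<dots> \<le> e\<^sup>2"
          using M[OF \<open>m \<ge> M\<close> that] by (intro power_mono) (auto simp: dist_norm)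
        finally show ?thesis .
      qed
      then show "\<forall>\<^sub>F n in sequentially.
          (\<Sum>i\<in>F. (cmod (ell2_apply (X m) i - ell2_apply (X n) i))\<^sup>2) \<le> e\<^sup>2"
        using eventually_sequentially by blast
    qed simp
    then show ?thesis by blast
  qed
  have summ: "(\<lambda>i. (cmod (ell2_apply (X m) i - l i))\<^sup>2) summable_on UNIV"
    if "\<And>F. finite F \<Longrightarrow> (\<Sum>i\<in>F. (cmod (ell2_apply (X m) i - l i))\<^sup>2) \<le> e\<^sup>2" for m e
    using that by (intro nonneg_bdd_above_summable_on bdd_aboveI[where M = "e\<^sup>2"]) auto
  obtain M where "\<And>F. finite F \<Longrightarrow> (\<Sum>i\<in>F. (cmod (ell2_apply (X M) i - l i))\<^sup>2) \<le> 1\<^sup>2"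
    using tail[of 1] by auto
  then have "(\<lambda>i. (cmod (ell2_apply (X M) i + - (ell2_apply (X M) i - l i)))\<^sup>2) summable_on UNIV"
    using summ[of M 1]
    by (intro ell2_add_summable ell2_apply_summable) (simp only: norm_minus_cancel)
  then have "(\<lambda>i. (cmod (l i))\<^sup>2) summable_on UNIV" by simp
  then obtain L where L: "ell2_apply L = l" using Abs_ell2_inverse by blast
  have "X \<longlonglongrightarrow> L"
  proof (rule LIMSEQ_I)
    fix e :: real assume "e > 0"
    then obtain M where M:
      "\<And>m F. m \<ge> M \<Longrightarrow> finite F \<Longrightarrow> (\<Sum>i\<in>F. (cmod (ell2_apply (X m) i - l i))\<^sup>2) \<le> (e / 2)\<^sup>2"
      using tail[of "e / 2"] by auto
    have "norm (X m - L) < e" if "m \<ge> M" for m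
    proof -
      have "(norm (X m - L))\<^sup>2 = (\<Sum>\<^sub>\<infinity>i. (cmod (ell2_apply (X m) i - l i))\<^sup>2)"
        by (simp add: power2_norm_ell2 minus_ell2.rep_eq L)
      also have "\<dots> \<le> (e / 2)\<^sup>2"
        by (rule infsum_le_finite_sums[OF summ[OF M[OF that]]]) (use M[OF that] in simp_all)
      finally have "norm (X m - L) \<le> e / 2"
        by (rule power2_le_imp_le) (use \<open>e > 0\<close> in simp)
      then show ?thesis using \<open>e > 0\<close> by simp
    qed
    then show "\<exists>M. \<forall>m\<ge>M. norm (X m - L) < e" by blast
  qed
  then show "convergent X" by (auto simp: convergent_def)
qed

instantiation ell2 :: (type) chilbert
begin

lift_definition scaleC_ell2 :: "complex \<Rightarrow> 'a ell2 \<Rightarrow> 'a ell2" is "\<lambda>c f i. c * f i"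
  by (rule ell2_scale_summable)

definition cinner_ell2 :: "'a ell2 \<Rightarrow> 'a ell2 \<Rightarrow> complex"
  where "cinner_ell2 f g = (\<Sum>\<^sub>\<infinity>i. cnj (ell2_apply f i) * ell2_apply g i)"

instance
proof
  fix f g h :: "'a ell2" and c d :: complex and r :: real
  show "c *\<^sub>C (f + g) = c *\<^sub>C f + c *\<^sub>C g" "(c + d) *\<^sub>C f = c *\<^sub>C f + d *\<^sub>C f"
    "c *\<^sub>C d *\<^sub>C f = (c * d) *\<^sub>C f" "complex_of_real r *\<^sub>C f = r *\<^sub>R f"
    by (transfer; simp add: algebra_simps fun_eq_iff)+
  show "Re (cinner f g) = inner f g" by (simp add: cinner_ell2_def inner_ell2_def)
  have "(\<Sum>\<^sub>\<infinity>i. cnj (ell2_apply f i) * ell2_apply g i)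
      = (\<Sum>\<^sub>\<infinity>i. cnj (cnj (ell2_apply g i) * ell2_apply f i))"
    by (simp add: mult.commute)
  also have "\<dots> = cnj (\<Sum>\<^sub>\<infinity>i. cnj (ell2_apply g i) * ell2_apply f i)"
    by (rule infsum_cnj)
  finally show "cinner f g = cnj (cinner g f)" by (simp add: cinner_ell2_def)
  show "cinner f (g + h) = cinner f g + cinner f h"
    by (simp add: cinner_ell2_def plus_ell2.rep_eq distrib_left
        infsum_add[OF ell2_mult_summable' ell2_mult_summable'])
  have "cinner f (c *\<^sub>C g) = (\<Sum>\<^sub>\<infinity>i. c * (cnj (ell2_apply f i) * ell2_apply g i))"
    by (simp add: cinner_ell2_def scaleC_ell2.rep_eq ac_simps)
  then show "cinner f (c *\<^sub>C g) = c * cinner f g"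
    by (simp add: cinner_ell2_def infsum_cmult_right')
qed

end

section \<open>Orthonormal bases\<close>

definition orthonormal :: "'a::chilbert set \<Rightarrow> bool"
  where "orthonormal B \<longleftrightarrow> (\<forall>e\<in>B. \<forall>f\<in>B. cinner e f = (if e = f then 1 else 0))"

definition is_onb :: "'a::chilbert set \<Rightarrow> bool"
  where "is_onb B \<longleftrightarrow> orthonormal B \<and> (\<forall>x. (\<forall>e\<in>B. cinner e x = 0) \<longrightarrow> x = 0)"

lemma ex_onb: "\<exists>B::'a::chilbert set. is_onb B"
proof -
  have "\<exists>B\<in>Collect orthonormal. \<forall>X\<in>Collect orthonormal. B \<subseteq> X \<longrightarrow> X = (B::'a set)"
  proof (rule subset_Zorn_nonempty)
    have "orthonormal ({}::'a set)" by (simp add: orthonormal_def)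
    then show "Collect (orthonormal :: 'a set \<Rightarrow> bool) \<noteq> {}" by blast
    fix C :: "'a set set" assume C: "subset.chain (Collect orthonormal) C"
    have "cinner e f = (if e = f then 1 else 0)" if "e \<in> X" "X \<in> C" "f \<in> Y" "Y \<in> C" for e f X Y
    proof -
      have "X \<subseteq> Y \<or> Y \<subseteq> X" "orthonormal X" "orthonormal Y"
        using C that by (auto simp: subset_chain_def)
      then show ?thesis using that unfolding orthonormal_def by blast
    qed
    then show "\<Union> C \<in> Collect orthonormal" by (auto simp: orthonormal_def)
  qed
  then obtain B :: "'a set" where B: "orthonormal B"
    and max: "\<And>X. orthonormal X \<Longrightarrow> B \<subseteq> X \<Longrightarrow> X = B" by auto
  have "x = 0" if "\<forall>e\<in>B. cinner e x = 0" for x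
  proof (rule ccontr)
    assume "x \<noteq> 0"
    define u where "u = complex_of_real (inverse (norm x)) *\<^sub>C x"
    have u: "cinner u u = 1"
      using \<open>x \<noteq> 0\<close> by (simp add: cinner_self u_def norm_scaleC norm_inverse)
    have eu: "cinner e u = 0" if "e \<in> B" for e
      using \<open>\<forall>e\<in>B. cinner e x = 0\<close> that by (simp add: u_def cinner_scaleC_right)
    have ue: "cinner u e = 0" if "e \<in> B" for e
      using eu[OF that] cinner_commute[of u e] by simp
    have "orthonormal (insert u B)"
      using B u eu ue by (auto simp: orthonormal_def)
    then have "u \<in> B" using max by blast
    then show False using eu u by fastforce
  qed
  then show ?thesis using B unfolding is_onb_def by blast
qed

definition onb :: "'a::chilbert set"
  where "onb = (SOME B. is_onb B)"

lemma is_onb_onb: "is_onb onb"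
  unfolding onb_def by (rule someI_ex) (rule ex_onb)

lemma orthonormal_onb: "orthonormal onb"
  using is_onb_onb is_onb_def by blast

lemma norm_sum_orthonormal:
  assumes "orthonormal B" "finite F" "F \<subseteq> B"
  shows "(norm (\<Sum>e\<in>F. c e *\<^sub>C e))\<^sup>2 = (\<Sum>e\<in>F. (cmod (c e))\<^sup>2)"
proof -
  have "complex_of_real ((norm (\<Sum>e\<in>F. c e *\<^sub>C e))\<^sup>2)
      = (\<Sum>f\<in>F. \<Sum>e\<in>F. cnj (c e) * (c f * cinner e f))"
    unfolding cinner_self [symmetric]
    by (simp add: cinner_sum_left cinner_sum_right cinner_scaleC_left cinner_scaleC_right
        sum_distrib_left mult.left_commute)
  also have "\<dots> = (\<Sum>f\<in>F. \<Sum>e\<in>F. if e = f then cnj (c e) * c e else 0)"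
    using assms by (intro sum.cong refl) (auto simp: orthonormal_def subset_iff)
  also have "\<dots> = (\<Sum>e\<in>F. cnj (c e) * c e)"
    using assms(2) by simp
  also have "\<dots> = complex_of_real (\<Sum>e\<in>F. (cmod (c e))\<^sup>2)"
    by (simp add: complex_norm_square mult.commute del: of_real_power)
  finally show ?thesis using of_real_eq_iff by blast
qed

lemma cinner_sum_orthonormal:
  assumes "orthonormal B" "finite F" "F \<subseteq> B" "e \<in> B"
  shows "cinner e (\<Sum>f\<in>F. c f *\<^sub>C f) = (if e \<in> F then c e else 0)"
proof -
  have "cinner e (\<Sum>f\<in>F. c f *\<^sub>C f) = (\<Sum>f\<in>F. if e = f then c f else 0)"
    unfolding cinner_sum_right using assms
    by (intro sum.cong refl) (auto simp: orthonormal_def subset_iff cinner_scaleC_right)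
  then show ?thesis using assms(2) by simp
qed

lemma bessel:
  assumes "orthonormal B" "finite F" "F \<subseteq> B"
  shows "(\<Sum>e\<in>F. (cmod (cinner e x))\<^sup>2) \<le> (norm x)\<^sup>2"
proof -
  define y where "y = (\<Sum>e\<in>F. cinner e x *\<^sub>C e)"
  have ny: "(norm y)\<^sup>2 = (\<Sum>e\<in>F. (cmod (cinner e x))\<^sup>2)"
    unfolding y_def by (rule norm_sum_orthonormal[OF assms])
  have "cinner y x = complex_of_real ((norm y)\<^sup>2)"
    unfolding ny
    by (simp add: y_def cinner_sum_left cinner_scaleC_left complex_norm_square mult.commute
        del: of_real_power)
  then have "inner y x = (norm y)\<^sup>2" by (metis Re_cinner Re_complex_of_real)
  moreover have "0 \<le> (norm (x - y))\<^sup>2" by simp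
  ultimately have "(norm y)\<^sup>2 \<le> (norm x)\<^sup>2"
    by (simp add: power2_norm_eq_inner inner_diff_left inner_diff_right inner_commute)
  then show ?thesis by (simp only: ny)
qed

lemma bessel_summable:
  assumes "orthonormal B"
  shows "(\<lambda>e. (cmod (cinner e x))\<^sup>2) summable_on B"
  using bessel[OF assms, of _ x]
  by (intro nonneg_bdd_above_summable_on bdd_aboveI[where M = "(norm x)\<^sup>2"]) auto

lemma parseval_norm:
  assumes "is_onb B"
  shows "(\<Sum>\<^sub>\<infinity>e\<in>B. (cmod (cinner e x))\<^sup>2) = (norm x)\<^sup>2"
proof -
  have B: "orthonormal B" using assms by (simp add: is_onb_def)
  define c where "c e = (cmod (cinner e x))\<^sup>2" for e
  define S where "S = infsum c B"
  have c: "c summable_on B" unfolding c_def by (rule bessel_summable[OF B])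
  have c0: "0 \<le> c e" for e by (simp add: c_def)
  have le: "sum c F \<le> S" if "finite F" "F \<subseteq> B" for F
    unfolding S_def using c that c0 by (intro finite_sum_le_infsum) auto
  have "\<forall>n::nat. \<exists>F. finite F \<and> F \<subseteq> B \<and> S - sum c F \<le> inverse (real (Suc n))"
  proof
    fix n :: nat
    obtain F where "finite F" "F \<subseteq> B" "dist (sum c F) S \<le> inverse (real (Suc n))"
      using infsum_finite_approximation[OF c, of "inverse (real (Suc n))"] by (auto simp: S_def)
    then show "\<exists>F. finite F \<and> F \<subseteq> B \<and> S - sum c F \<le> inverse (real (Suc n))"
      by (intro exI[of _ F]) (auto simp: dist_real_def)
  qed
  from choice[OF this] obtain F where
    F: "\<And>n. finite (F n)" "\<And>n. F n \<subseteq> B" "\<And>n::nat. S - sum c (F n) \<le> inverse (real (Suc n))"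
    by blast
  define G where "G n = (\<Union>k\<le>n. F k)" for n
  have G: "finite (G n)" "G n \<subseteq> B" for n using F by (auto simp: G_def)
  have Gmono: "G m \<subseteq> G n" if "m \<le> n" for m n using that unfolding G_def by (intro UN_mono) auto
  have GS: "S - sum c (G n) \<le> inverse (real (Suc n))" for n
  proof -
    have "sum c (F n) \<le> sum c (G n)"
      using G c0 by (intro sum_mono2) (auto simp: G_def)
    then show ?thesis using F(3)[of n] by linarith
  qed
  define y where "y n = (\<Sum>e\<in>G n. cinner e x *\<^sub>C e)" for n
  have diff: "(norm (y n - y m))\<^sup>2 \<le> inverse (real (Suc m))" if "m \<le> n" for m n
  proof -
    have "y n - y m = (\<Sum>e\<in>G n - G m. cinner e x *\<^sub>C e)"
      unfolding y_def using G Gmono[OF that] by (simp add: sum_diff)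
    moreover have "finite (G n - G m)" "G n - G m \<subseteq> B" using G[of n] by auto
    ultimately have "(norm (y n - y m))\<^sup>2 = sum c (G n - G m)"
      unfolding c_def by (simp only: norm_sum_orthonormal[OF B])
    also have "\<dots> = sum c (G n) - sum c (G m)"
      using G Gmono[OF that] by (simp add: sum_diff)
    also have "\<dots> \<le> S - sum c (G m)" using le[OF G] by simp
    also have "\<dots> \<le> inverse (real (Suc m))" by (rule GS)
    finally show ?thesis .
  qed
  have inv0: "(\<lambda>n. inverse (real (Suc n))) \<longlonglongrightarrow> 0"
    by (rule LIMSEQ_inverse_real_of_nat)
  have "Cauchy y"
  proof (rule CauchyI')
    fix e :: real assume "e > 0"
    then have "\<forall>\<^sub>F n in sequentially. inverse (real (Suc n)) < e\<^sup>2"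
      using order_tendstoD(2)[OF inv0] by simp
    then obtain K where K: "inverse (real (Suc n)) < e\<^sup>2" if "n \<ge> K" for n
      by (auto simp: eventually_sequentially)
    have "dist (y m) (y n) < e" if "m \<ge> K" "n > m" for m n
    proof -
      have "(norm (y n - y m))\<^sup>2 < e\<^sup>2"
        using diff[of m n] K[of m] that by simp
      then have "norm (y n - y m) < e"
        using \<open>e > 0\<close> power_less_imp_less_base by fastforce
      then show ?thesis by (simp add: dist_norm norm_minus_commute)
    qed
    then show "\<exists>K. \<forall>m\<ge>K. \<forall>n>m. dist (y m) (y n) < e" by blast
  qed
  then obtain z where z: "y \<longlonglongrightarrow> z" using Cauchy_convergent convergent_def by blast
  have "cinner e z = cinner e x" if "e \<in> B" for e
  proof (rule LIMSEQ_unique)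
    show "(\<lambda>n. cinner e (y n)) \<longlonglongrightarrow> cinner e z"
      by (rule bounded_linear.tendsto[OF bounded_linear_cinner_right z])
    have "cmod (cinner e (y n) - cinner e x) \<le> sqrt (inverse (real (Suc n)))" for n
    proof (cases "e \<in> G n")
      case True
      then show ?thesis
        using cinner_sum_orthonormal[OF B G \<open>e \<in> B\<close>] by (simp add: y_def)
    next
      case False
      have "c e + sum c (G n) = sum c (insert e (G n))" using False G by simp
      also have "\<dots> \<le> S" using G that by (intro le) auto
      finally have "c e \<le> inverse (real (Suc n))" using GS[of n] by linarith
      moreover have "cinner e (y n) = 0"
        using cinner_sum_orthonormal[OF B G \<open>e \<in> B\<close>] False by (simp add: y_def)
      ultimately show ?thesis by (simp add: c_def real_le_rsqrt)
    qed
    moreover have "(\<lambda>n. sqrt (inverse (real (Suc n)))) \<longlonglongrightarrow> 0"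
      using tendsto_real_sqrt[OF inv0] by simp
    ultimately have "(\<lambda>n. cinner e (y n) - cinner e x) \<longlonglongrightarrow> 0"
      by (intro Lim_null_comparison[where f = "\<lambda>n. cinner e (y n) - cinner e x"]
          always_eventually) auto
    then show "(\<lambda>n. cinner e (y n)) \<longlonglongrightarrow> cinner e x" by (rule LIM_zero_cancel)
  qed
  then have "\<forall>e\<in>B. cinner e (z - x) = 0" by (simp add: cinner_diff_right)
  then have "z = x" using assms unfolding is_onb_def by (metis eq_iff_diff_eq_0)
  have "(\<lambda>n. (norm (y n))\<^sup>2) \<longlonglongrightarrow> (norm x)\<^sup>2"
    using z unfolding \<open>z = x\<close> by (intro tendsto_intros)
  moreover have "(norm (y n))\<^sup>2 = sum c (G n)" for n
    unfolding y_def c_def by (rule norm_sum_orthonormal[OF B G])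
  moreover have "(\<lambda>n. sum c (G n)) \<longlonglongrightarrow> S"
  proof (rule tendsto_sandwich)
    show "(\<lambda>n. S - inverse (real (Suc n))) \<longlonglongrightarrow> S"
      using tendsto_diff[OF tendsto_const inv0, of S] by simp
    show "\<forall>\<^sub>F n in sequentially. S - inverse (real (Suc n)) \<le> sum c (G n)"
      using GS by (intro always_eventually allI) (simp add: algebra_simps)
    show "\<forall>\<^sub>F n in sequentially. sum c (G n) \<le> S"
      using le[OF G] by (intro always_eventually allI)
  qed simp
  ultimately have "S = (norm x)\<^sup>2" using LIMSEQ_unique by simp
  then show ?thesis unfolding S_def c_def [abs_def] .
qed

lemma isometry_cinner:
  fixes V :: "'a::chilbert \<Rightarrow> 'b::chilbert"
  assumes add: "\<And>x y. V (x + y) = V x + V y" and scale: "\<And>c x. V (c *\<^sub>C x) = c *\<^sub>C V x"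
    and norm: "\<And>x. norm (V x) = norm x"
  shows "cinner (V x) (V y) = cinner x y"
proof -
  have inner: "inner (V x) (V y) = inner x y" for x y
    unfolding dot_norm by (simp only: add [symmetric] norm)
  have "Im (cinner (V x) (V y)) = - inner (V x) (V (\<i> *\<^sub>C y))"
    by (simp add: Re_cinner [symmetric] cinner_scaleC_right scale)
  also have "\<dots> = Im (cinner x y)"
    by (simp only: inner) (simp add: Re_cinner [symmetric] cinner_scaleC_right)
  finally show ?thesis
    by (simp add: complex_eq_iff Re_cinner inner)
qed

text \<open>The family of coefficients of a vector with respect to \<open>onb\<close>, extended by zero.\<close>

lift_definition onb_coords :: "'a::chilbert \<Rightarrow> 'a ell2"
  is "\<lambda>x e. if e \<in> onb then cinner e x else 0"
proof -
  fix x :: 'a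
  have "(\<lambda>e. (cmod (cinner e x))\<^sup>2) summable_on onb"
    by (rule bessel_summable[OF orthonormal_onb])
  then show "(\<lambda>e. (cmod (if e \<in> onb then cinner e x else 0))\<^sup>2) summable_on UNIV"
    by (subst summable_on_cong_neutral[where T = onb and g = "\<lambda>e. (cmod (cinner e x))\<^sup>2"]) auto
qed

lemma onb_coords_add: "onb_coords (x + y) = onb_coords x + onb_coords y"
  by transfer (auto simp: cinner_add_right)

lemma onb_coords_scaleC: "onb_coords (c *\<^sub>C x) = c *\<^sub>C onb_coords x"
  by transfer (auto simp: cinner_scaleC_right)

lemma norm_onb_coords: "norm (onb_coords (x::'a::chilbert)) = norm x"
proof -
  have "(norm (onb_coords x))\<^sup>2 = (\<Sum>\<^sub>\<infinity>e\<in>onb. (cmod (cinner e x))\<^sup>2)"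
    unfolding power2_norm_ell2 onb_coords.rep_eq by (intro infsum_cong_neutral) auto
  then show ?thesis by (simp add: parseval_norm[OF is_onb_onb])
qed

lemma cinner_onb_coords: "cinner (onb_coords x) (onb_coords y) = cinner x y"
  by (intro isometry_cinner onb_coords_add onb_coords_scaleC norm_onb_coords)

section \<open>The tensor product of Hilbert spaces\<close>

lift_definition ell2_tensor :: "'i ell2 \<Rightarrow> 'j ell2 \<Rightarrow> ('i \<times> 'j) ell2"
  is "\<lambda>f g p. f (fst p) * g (snd p)"
proof -
  fix f :: "'i \<Rightarrow> complex" and g :: "'j \<Rightarrow> complex"
  assume f: "(\<lambda>i. (cmod (f i))\<^sup>2) summable_on UNIV" and g: "(\<lambda>j. (cmod (g j))\<^sup>2) summable_on UNIV"
  have "(\<lambda>p. (cmod (f (fst p)))\<^sup>2 * (cmod (g (snd p)))\<^sup>2) summable_on (SIGMA i:UNIV. UNIV)"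
  proof (rule summable_on_SigmaI)
    fix i
    show "((\<lambda>j. (cmod (f (fst (i, j))))\<^sup>2 * (cmod (g (snd (i, j))))\<^sup>2) has_sum
        ((cmod (f i))\<^sup>2 * (\<Sum>\<^sub>\<infinity>j. (cmod (g j))\<^sup>2))) UNIV"
      unfolding fst_conv snd_conv by (intro has_sum_cmult_right has_sum_infsum g)
  next
    show "(\<lambda>i. (cmod (f i))\<^sup>2 * (\<Sum>\<^sub>\<infinity>j. (cmod (g j))\<^sup>2)) summable_on UNIV"
      by (intro summable_on_cmult_left f)
  qed simp
  then show "(\<lambda>p. (cmod (f (fst p) * g (snd p)))\<^sup>2) summable_on UNIV"
    by (simp add: norm_mult power_mult_distrib)
qed

lemma cinner_ell2_tensor:
  "cinner (ell2_tensor f g) (ell2_tensor f' g') = cinner f f' * cinner g g'"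
proof -
  let ?h = "\<lambda>i j. (cnj (ell2_apply f i) * ell2_apply f' i) * (cnj (ell2_apply g j) * ell2_apply g' j)"
  have eq: "(\<lambda>p. cnj (ell2_apply (ell2_tensor f g) p) * ell2_apply (ell2_tensor f' g') p)
      = (\<lambda>(i, j). ?h i j)"
    by (auto simp: ell2_tensor.rep_eq fun_eq_iff)
  have summ: "(\<lambda>(i, j). ?h i j) summable_on UNIV \<times> UNIV"
    using ell2_mult_summable'[of "ell2_tensor f g" "ell2_tensor f' g'"] unfolding eq by simp
  have "cinner (ell2_tensor f g) (ell2_tensor f' g') = (\<Sum>\<^sub>\<infinity>(i, j)\<in>UNIV \<times> UNIV. ?h i j)"
    by (simp only: cinner_ell2_def eq UNIV_Times_UNIV)
  also have "\<dots> = (\<Sum>\<^sub>\<infinity>i. \<Sum>\<^sub>\<infinity>j. ?h i j)"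
    using infsum_Sigma'_banach[OF summ] by simp
  finally show ?thesis
    by (simp only: infsum_cmult_right' infsum_cmult_left' cinner_ell2_def)
qed

lemma ell2_tensor_scaleC_left: "ell2_tensor (c *\<^sub>C f) g = c *\<^sub>C ell2_tensor f g"
  by transfer (auto simp: fun_eq_iff)

text \<open>
  The Hilbert space tensor product: the closed span of the elementary tensors, realized inside the
  square-summable families indexed by pairs of vectors. The real span is already complex, since
  scalars can be moved into the first factor. Lemmas \<open>cinner_tensor\<close> and \<open>closure_span_tensor\<close>
  below determine the space up to unitary isomorphism, independently of the chosen bases.
\<close>

definition elementary_tensors :: "('a::chilbert \<times> 'b::chilbert) ell2 set"
  where "elementary_tensors = range (\<lambda>(x, y). ell2_tensor (onb_coords x) (onb_coords y))"

typedef (overloaded) ('a, 'b) htensor =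
  "closure (span elementary_tensors) :: ('a::chilbert \<times> 'b::chilbert) ell2 set"
  using closure_subset span_zero by blast

setup_lifting type_definition_htensor

lemma subspace_closure_span: "subspace (closure (span (S :: 'a::real_normed_vector set)))"
proof (rule subspaceI)
  show "0 \<in> closure (span S)" using closure_subset span_zero by blast
  fix x y assume "x \<in> closure (span S)" "y \<in> closure (span S)"
  then obtain X Y where "\<And>n. X n \<in> span S" "X \<longlonglongrightarrow> x" "\<And>n. Y n \<in> span S" "Y \<longlonglongrightarrow> y"
    by (auto simp: closure_sequential)
  then show "x + y \<in> closure (span S)"
    unfolding closure_sequential
    by (intro exI[of _ "\<lambda>n. X n + Y n"]) (auto intro: span_add tendsto_add)
next
  fix c x assume "x \<in> closure (span S)"
  then obtain X where "\<And>n. X n \<in> span S" "X \<longlonglongrightarrow> x" by (auto simp: closure_sequential)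
  then show "c *\<^sub>R x \<in> closure (span S)"
    unfolding closure_sequential
    by (intro exI[of _ "\<lambda>n. c *\<^sub>R X n"]) (auto intro: span_scale tendsto_intros)
qed

lemma scaleC_closure_span:
  assumes "\<And>x c. x \<in> S \<Longrightarrow> c *\<^sub>C x \<in> S" "x \<in> closure (span (S :: 'a::chilbert set))"
  shows "c *\<^sub>C x \<in> closure (span S)"
proof -
  interpret bounded_linear "\<lambda>x::'a. c *\<^sub>C x" by (rule bounded_linear_scaleC)
  have "(\<lambda>x. c *\<^sub>C x) ` span S = span ((\<lambda>x. c *\<^sub>C x) ` S)"
    by (rule linear_span_image [symmetric]) (rule linear_axioms)
  also have "\<dots> \<subseteq> span S" using assms(1) by (intro span_mono) auto
  finally have "closure ((\<lambda>x. c *\<^sub>C x) ` span S) \<subseteq> closure (span S)" by (rule closure_mono)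
  then show ?thesis
    using closure_bounded_linear_image_subset[OF bounded_linear_axioms, of "span S"] assms(2)
    by blast
qed

lemma elementary_tensors_scaleC:
  assumes "x \<in> elementary_tensors"
  shows "c *\<^sub>C x \<in> elementary_tensors"
proof -
  obtain a b where "x = ell2_tensor (onb_coords a) (onb_coords b)"
    using assms by (auto simp: elementary_tensors_def)
  then have "c *\<^sub>C x = ell2_tensor (onb_coords (c *\<^sub>C a)) (onb_coords b)"
    by (simp add: ell2_tensor_scaleC_left onb_coords_scaleC)
  then show ?thesis unfolding elementary_tensors_def by force
qed

instantiation htensor :: (chilbert, chilbert) real_inner
begin

lift_definition zero_htensor :: "('a, 'b) htensor" is 0
  by (rule subspace_0[OF subspace_closure_span])

lift_definition plus_htensor :: "('a, 'b) htensor \<Rightarrow> ('a, 'b) htensor \<Rightarrow> ('a, 'b) htensor" is "(+)"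
  by (rule subspace_add[OF subspace_closure_span])

lift_definition minus_htensor :: "('a, 'b) htensor \<Rightarrow> ('a, 'b) htensor \<Rightarrow> ('a, 'b) htensor" is "(-)"
  by (rule subspace_diff[OF subspace_closure_span])

lift_definition uminus_htensor :: "('a, 'b) htensor \<Rightarrow> ('a, 'b) htensor" is uminus
  by (rule subspace_neg[OF subspace_closure_span])

lift_definition scaleR_htensor :: "real \<Rightarrow> ('a, 'b) htensor \<Rightarrow> ('a, 'b) htensor" is "(*\<^sub>R)"
  by (rule subspace_scale[OF subspace_closure_span])

lift_definition inner_htensor :: "('a, 'b) htensor \<Rightarrow> ('a, 'b) htensor \<Rightarrow> real" is inner .

lift_definition norm_htensor :: "('a, 'b) htensor \<Rightarrow> real" is norm .

definition dist_htensor :: "('a, 'b) htensor \<Rightarrow> ('a, 'b) htensor \<Rightarrow> real"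
  where "dist_htensor u v = norm (u - v)"

definition sgn_htensor :: "('a, 'b) htensor \<Rightarrow> ('a, 'b) htensor"
  where "sgn_htensor u = inverse (norm u) *\<^sub>R u"

definition uniformity_htensor :: "(('a, 'b) htensor \<times> ('a, 'b) htensor) filter"
  where "uniformity_htensor = (INF e\<in>{0<..}. principal {(u, v). dist u v < e})"

definition open_htensor :: "('a, 'b) htensor set \<Rightarrow> bool"
  where "open_htensor U \<longleftrightarrow> (\<forall>u\<in>U. \<forall>\<^sub>F (u', v) in uniformity. u' = u \<longrightarrow> v \<in> U)"

instance
proof
  fix u v w :: "('a, 'b) htensor" and r s :: real
  show "u + v + w = u + (v + w)" "u + v = v + u" "0 + u = u" "- u + u = 0" "u - v = u + - v"
    "r *\<^sub>R (u + v) = r *\<^sub>R u + r *\<^sub>R v" "(r + s) *\<^sub>R u = r *\<^sub>R u + s *\<^sub>R u"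
    "r *\<^sub>R s *\<^sub>R u = (r * s) *\<^sub>R u" "1 *\<^sub>R u = u"
    by (transfer; simp add: algebra_simps)+
  show "dist u v = norm (u - v)" by (fact dist_htensor_def)
  show "sgn u = inverse (norm u) *\<^sub>R u" by (fact sgn_htensor_def)
  show "uniformity = (INF e\<in>{0<..}. principal {(u, v::('a, 'b) htensor). dist u v < e})"
    by (fact uniformity_htensor_def)
  show "open U \<longleftrightarrow> (\<forall>u\<in>U. \<forall>\<^sub>F (u', v) in uniformity. u' = u \<longrightarrow> v \<in> U)"
    for U :: "('a, 'b) htensor set" by (fact open_htensor_def)
  show "inner u v = inner v u" by transfer (rule inner_commute)
  show "norm u = sqrt (inner u u)" by transfer (rule norm_eq_sqrt_inner)
  show "inner (u + v) w = inner u w + inner v w" "inner (r *\<^sub>R u) v = r * inner u v"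
    "0 \<le> inner u u" "inner u u = 0 \<longleftrightarrow> u = 0"
    by (transfer; simp add: inner_add_left)+
qed

end

lemma dist_Rep_htensor: "dist (Rep_htensor u) (Rep_htensor v) = dist u v"
  by (simp add: dist_norm norm_htensor.rep_eq minus_htensor.rep_eq)

instance htensor :: (chilbert, chilbert) complete_space
proof
  fix X :: "nat \<Rightarrow> ('a::chilbert, 'b::chilbert) htensor"
  assume "Cauchy X"
  then have "Cauchy (\<lambda>n. Rep_htensor (X n))"
    by (simp add: Cauchy_def dist_Rep_htensor)
  then obtain l where l: "(\<lambda>n. Rep_htensor (X n)) \<longlonglongrightarrow> l"
    unfolding Cauchy_convergent_iff convergent_def by blast
  have "l \<in> closure (span elementary_tensors)"
    by (rule closed_sequentially[OF closed_closure _ l]) (rule Rep_htensor)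
  then have "Rep_htensor (Abs_htensor l) = l" by (rule Abs_htensor_inverse)
  then have "(\<lambda>n. Rep_htensor (X n)) \<longlonglongrightarrow> Rep_htensor (Abs_htensor l)" using l by simp
  then have "X \<longlonglongrightarrow> Abs_htensor l" unfolding tendsto_iff dist_Rep_htensor .
  then show "convergent X" by (auto simp: convergent_def)
qed

instantiation htensor :: (chilbert, chilbert) chilbert
begin

lift_definition scaleC_htensor :: "complex \<Rightarrow> ('a, 'b) htensor \<Rightarrow> ('a, 'b) htensor" is "(*\<^sub>C)"
  by (rule scaleC_closure_span[OF elementary_tensors_scaleC])

lift_definition cinner_htensor :: "('a, 'b) htensor \<Rightarrow> ('a, 'b) htensor \<Rightarrow> complex" is cinner .

instance
proof
  fix u v w :: "('a, 'b) htensor" and c d :: complex and r :: real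
  show "cinner u v = cnj (cinner v u)" by transfer (rule cinner_commute)
qed (transfer; simp add: scaleC_add_right scaleC_add_left scaleC_scaleC scaleC_of_real
       cinner_add_right cinner_scaleC_right Re_cinner)+

end

lift_definition tensor :: "'a::chilbert \<Rightarrow> 'b::chilbert \<Rightarrow> ('a, 'b) htensor"  (infixr "\<otimes>\<^sub>H" 76)
  is "\<lambda>x y. ell2_tensor (onb_coords x) (onb_coords y)"
  by (rule subsetD[OF closure_subset], rule span_base) (auto simp: elementary_tensors_def)

lemma cinner_tensor: "cinner (x \<otimes>\<^sub>H y) (x' \<otimes>\<^sub>H y') = cinner x x' * cinner y y'"
  by transfer (simp add: cinner_ell2_tensor cinner_onb_coords)

lemma closure_span_tensor:
  "closure (span (range (\<lambda>(x, y). x \<otimes>\<^sub>H y))) = (UNIV :: ('a::chilbert, 'b::chilbert) htensor set)"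
proof -
  let ?T = "range (\<lambda>(x, y). x \<otimes>\<^sub>H y) :: ('a, 'b) htensor set"
  have lin: "linear (Rep_htensor :: ('a, 'b) htensor \<Rightarrow> _)"
    by (rule linearI) (simp_all add: plus_htensor.rep_eq scaleR_htensor.rep_eq)
  have "Rep_htensor ` ?T = elementary_tensors"
    by (auto simp: elementary_tensors_def image_image tensor.rep_eq case_prod_unfold)
  then have img: "Rep_htensor ` span ?T = span elementary_tensors"
    by (metis lin linear_span_image)
  have "u \<in> closure (span ?T)" for u
    unfolding closure_approachable
  proof (intro allI impI)
    fix e :: real assume "e > 0"
    have "Rep_htensor u \<in> closure (span elementary_tensors)" by (rule Rep_htensor)
    then obtain z where "z \<in> span elementary_tensors" "dist z (Rep_htensor u) < e"
      using \<open>e > 0\<close> by (auto simp: closure_approachable)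
    then show "\<exists>v\<in>span ?T. dist v u < e"
      unfolding img [symmetric] by (auto simp: dist_Rep_htensor)
  qed
  then show ?thesis by blast
qed

section \<open>Operators\<close>

text \<open>
  Bounded complex-linear operators are singled out among the bounded real-linear maps; operator
  norm, sums and composition are those of the library.
\<close>

definition clinear_ops :: "('a::chilbert \<Rightarrow>\<^sub>L 'b::chilbert) set"
  where "clinear_ops = {T. \<forall>c x. blinfun_apply T (c *\<^sub>C x) = c *\<^sub>C blinfun_apply T x}"

definition op_scaleC :: "complex \<Rightarrow> ('a::chilbert \<Rightarrow>\<^sub>L 'b::chilbert) \<Rightarrow> ('a \<Rightarrow>\<^sub>L 'b)"
  where "op_scaleC c T = Blinfun (\<lambda>x. c *\<^sub>C blinfun_apply T x)"

definition adj :: "('a::chilbert \<Rightarrow>\<^sub>L 'b::chilbert) \<Rightarrow> ('b \<Rightarrow>\<^sub>L 'a)"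
  where "adj T = (THE R. \<forall>x y. cinner (blinfun_apply R y) x = cinner y (blinfun_apply T x))"

definition unitary :: "('a::chilbert \<Rightarrow>\<^sub>L 'b::chilbert) \<Rightarrow> bool"
  where "unitary U \<longleftrightarrow> U \<in> clinear_ops \<and> adj U o\<^sub>L U = id_blinfun \<and> U o\<^sub>L adj U = id_blinfun"

definition op_sum ::
    "('a::chilbert \<Rightarrow>\<^sub>L 'c::chilbert) \<Rightarrow> ('b::chilbert \<Rightarrow>\<^sub>L 'd::chilbert) \<Rightarrow> (('a \<times> 'b) \<Rightarrow>\<^sub>L ('c \<times> 'd))"
  where "op_sum S T = Blinfun (\<lambda>x. (blinfun_apply S (fst x), blinfun_apply T (snd x)))"

text \<open>
  For complex-linear \<open>S\<close>, \<open>T\<close> this is the usual tensor product of operators; it is unique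
  because elementary tensors have dense span.
\<close>

definition op_tensor ::
    "('a::chilbert \<Rightarrow>\<^sub>L 'c::chilbert) \<Rightarrow> ('b::chilbert \<Rightarrow>\<^sub>L 'd::chilbert) \<Rightarrow>
      (('a, 'b) htensor \<Rightarrow>\<^sub>L ('c, 'd) htensor)"
  where "op_tensor S T = 
    (THE R. \<forall>x y. blinfun_apply R (x \<otimes>\<^sub>H y) = blinfun_apply S x \<otimes>\<^sub>H blinfun_apply T y)"

section \<open>Concrete C*-algebras\<close>

definition cstar_algebra :: "('a::chilbert \<Rightarrow>\<^sub>L 'a) set \<Rightarrow> bool"
  where "cstar_algebra A \<longleftrightarrow> A \<subseteq> clinear_ops \<and> closed A \<and> id_blinfun \<in> A \<and>
    (\<forall>S\<in>A. \<forall>T\<in>A. S + T \<in> A \<and> S o\<^sub>L T \<in> A) \<and>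
    (\<forall>c. \<forall>T\<in>A. op_scaleC c T \<in> A) \<and> (\<forall>T\<in>A. adj T \<in> A)"

definition cstar_generated :: "('a::chilbert \<Rightarrow>\<^sub>L 'a) set \<Rightarrow> ('a \<Rightarrow>\<^sub>L 'a) set"
  where "cstar_generated G = \<Inter> {A. cstar_algebra A \<and> G \<subseteq> A}"

definition unital_star_hom ::
    "('a::chilbert \<Rightarrow>\<^sub>L 'a) set \<Rightarrow> ('b::chilbert \<Rightarrow>\<^sub>L 'b) set \<Rightarrow> (('a \<Rightarrow>\<^sub>L 'a) \<Rightarrow> ('b \<Rightarrow>\<^sub>L 'b)) \<Rightarrow> bool"
  where "unital_star_hom A B f \<longleftrightarrow> f \<in> A \<rightarrow> B \<and> f id_blinfun = id_blinfun \<and>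
    (\<forall>S\<in>A. \<forall>T\<in>A. f (S + T) = f S + f T \<and> f (S o\<^sub>L T) = f S o\<^sub>L f T) \<and>
    (\<forall>c. \<forall>T\<in>A. f (op_scaleC c T) = op_scaleC c (f T)) \<and> (\<forall>T\<in>A. f (adj T) = adj (f T))"

text \<open>
  The spatial tensor product: the norm closure of the algebraic tensor product acting on the tensor
  product of the Hilbert spaces. The real span is the complex one because \<open>A\<close> admits complex
  scalars. For the nuclear Cuntz algebras it is the only C*-tensor product.
\<close>

definition cstar_tensor ::
    "('a::chilbert \<Rightarrow>\<^sub>L 'a) set \<Rightarrow> ('b::chilbert \<Rightarrow>\<^sub>L 'b) set \<Rightarrow>
      (('a, 'b) htensor \<Rightarrow>\<^sub>L ('a, 'b) htensor) set"
  where "cstar_tensor A B = closure (span {op_tensor S T | S T. S \<in> A \<and> T \<in> B})"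

text \<open>
  The tensor product of two representations is the representation with
  \<open>(\<pi> \<otimes> \<rho>)(S \<otimes> T) = \<pi>(S) \<otimes> \<rho>(T)\<close>. Homomorphisms are pinned down here, and below, only on the
  algebra they are defined on; outside of it they take the default value.
\<close>

definition hom_tensor ::
    "('a::chilbert \<Rightarrow>\<^sub>L 'a) set \<Rightarrow> ('b::chilbert \<Rightarrow>\<^sub>L 'b) set \<Rightarrow>
      (('a \<Rightarrow>\<^sub>L 'a) \<Rightarrow> ('c::chilbert \<Rightarrow>\<^sub>L 'c)) \<Rightarrow> (('b \<Rightarrow>\<^sub>L 'b) \<Rightarrow> ('d::chilbert \<Rightarrow>\<^sub>L 'd)) \<Rightarrow>
      ((('a, 'b) htensor \<Rightarrow>\<^sub>L ('a, 'b) htensor) \<Rightarrow> (('c, 'd) htensor \<Rightarrow>\<^sub>L ('c, 'd) htensor))"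
  where "hom_tensor A B \<pi> \<rho> =
    (THE f. f \<in> extensional (cstar_tensor A B) \<and>
      unital_star_hom (cstar_tensor A B) clinear_ops f \<and>
      (\<forall>S\<in>A. \<forall>T\<in>B. f (op_tensor S T) = op_tensor (\<pi> S) (\<rho> T)))"

section \<open>Cuntz algebras\<close>

definition cuntz_family :: "nat \<Rightarrow> (nat \<Rightarrow> ('a::chilbert \<Rightarrow>\<^sub>L 'a)) \<Rightarrow> bool"
  where "cuntz_family N s \<longleftrightarrow> (\<forall>i\<in>{1..N}. s i \<in> clinear_ops) \<and>
    (\<forall>i\<in>{1..N}. \<forall>j\<in>{1..N}. adj (s i) o\<^sub>L s j = (if i = j then id_blinfun else 0)) \<and>
    (\<Sum>i=1..N. s i o\<^sub>L adj (s i)) = id_blinfun"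

text \<open>
  The universal C*-algebra is realized on the direct sum of one copy of \<open>nat ell2\<close> for each Cuntz
  family \<open>s\<close> on \<open>nat ell2\<close>, where the \<open>i\<close>-th generator acts on the copy labelled \<open>s\<close> as \<open>s i\<close>.
  Hence the norm of a *-polynomial in the generators is the supremum of its norms over all Cuntz
  families on \<open>nat ell2\<close>. This is the universal norm, because for \<open>N \<ge> 2\<close> every nonzero vector of a
  Hilbert space with a Cuntz family lies in a separable infinite-dimensional reducing subspace.
  Labels that are not Cuntz families are given some fixed family.
\<close>

definition block_diagonal :: "('s \<Rightarrow> ('i ell2 \<Rightarrow>\<^sub>L 'i ell2)) \<Rightarrow> (('s \<times> 'i) ell2 \<Rightarrow>\<^sub>L ('s \<times> 'i) ell2)"
  where "block_diagonal T =
    Blinfun (\<lambda>f. Abs_ell2 (\<lambda>(s, i).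
      ell2_apply (blinfun_apply (T s) (Abs_ell2 (\<lambda>j. ell2_apply f (s, j)))) i))"

definition cuntz_block :: "nat \<Rightarrow> (nat \<Rightarrow> (nat ell2 \<Rightarrow>\<^sub>L nat ell2)) \<Rightarrow> nat \<Rightarrow> (nat ell2 \<Rightarrow>\<^sub>L nat ell2)"
  where "cuntz_block N s = (if cuntz_family N s then s else (SOME s'. cuntz_family N s'))"

type_synonym cuntz_space = "((nat \<Rightarrow> (nat ell2 \<Rightarrow>\<^sub>L nat ell2)) \<times> nat) ell2"

type_synonym cuntz_op = "cuntz_space \<Rightarrow>\<^sub>L cuntz_space"

definition cuntz_gen :: "nat \<Rightarrow> nat \<Rightarrow> cuntz_op"
  where "cuntz_gen N i = block_diagonal (\<lambda>s. cuntz_block N s i)"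

definition cuntz_algebra :: "nat \<Rightarrow> cuntz_op set"
  where "cuntz_algebra N = cstar_generated (cuntz_gen N ` {1..N})"

definition cuntz_embed ::
    "nat \<Rightarrow> nat \<Rightarrow> cuntz_op \<Rightarrow> ((cuntz_space, cuntz_space) htensor \<Rightarrow>\<^sub>L (cuntz_space, cuntz_space) htensor)"
  where "cuntz_embed N M =
    (THE f. f \<in> extensional (cuntz_algebra (N * M)) \<and>
      unital_star_hom (cuntz_algebra (N * M)) (cstar_tensor (cuntz_algebra N) (cuntz_algebra M)) f \<and>
      (\<forall>i\<in>{1..N}. \<forall>j\<in>{1..M}.
        f (cuntz_gen (N * M) (M * (i - 1) + j)) = op_tensor (cuntz_gen N i) (cuntz_gen M j)))"

section \<open>Representations\<close>

definition is_rep :: "nat \<Rightarrow> (cuntz_op \<Rightarrow> ('a::chilbert \<Rightarrow>\<^sub>L 'a)) \<Rightarrow> bool"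
  where "is_rep N \<pi> \<longleftrightarrow> unital_star_hom (cuntz_algebra N) clinear_ops \<pi>"

text \<open>Equality of two representations under the identification of their spaces by \<open>U\<close>.\<close>

definition rep_eq_via ::
    "nat \<Rightarrow> ('a::chilbert \<Rightarrow>\<^sub>L 'b::chilbert) \<Rightarrow>
      (cuntz_op \<Rightarrow> ('a \<Rightarrow>\<^sub>L 'a)) \<Rightarrow> (cuntz_op \<Rightarrow> ('b \<Rightarrow>\<^sub>L 'b)) \<Rightarrow> bool"
  where "rep_eq_via N U \<pi> \<pi>' \<longleftrightarrow> is_rep N \<pi> \<and> is_rep N \<pi>' \<and> unitary U \<and>
    (\<forall>a\<in>cuntz_algebra N. U o\<^sub>L \<pi> a o\<^sub>L adj U = \<pi>' a)"

definition rep_equiv ::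
    "nat \<Rightarrow> (cuntz_op \<Rightarrow> ('a::chilbert \<Rightarrow>\<^sub>L 'a)) \<Rightarrow> (cuntz_op \<Rightarrow> ('b::chilbert \<Rightarrow>\<^sub>L 'b)) \<Rightarrow> bool"
  where "rep_equiv N \<pi> \<pi>' \<longleftrightarrow> (\<exists>U. rep_eq_via N U \<pi> \<pi>')"

definition rep_sum ::
    "(cuntz_op \<Rightarrow> ('a::chilbert \<Rightarrow>\<^sub>L 'a)) \<Rightarrow> (cuntz_op \<Rightarrow> ('b::chilbert \<Rightarrow>\<^sub>L 'b)) \<Rightarrow>
      cuntz_op \<Rightarrow> (('a \<times> 'b) \<Rightarrow>\<^sub>L ('a \<times> 'b))"
  where "rep_sum \<pi> \<rho> a = op_sum (\<pi> a) (\<rho> a)"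

definition phi_tensor ::
    "nat \<Rightarrow> nat \<Rightarrow> (cuntz_op \<Rightarrow> ('a::chilbert \<Rightarrow>\<^sub>L 'a)) \<Rightarrow> (cuntz_op \<Rightarrow> ('b::chilbert \<Rightarrow>\<^sub>L 'b)) \<Rightarrow>
      cuntz_op \<Rightarrow> (('a, 'b) htensor \<Rightarrow>\<^sub>L ('a, 'b) htensor)"
  where "phi_tensor N M \<pi> \<rho> =
    hom_tensor (cuntz_algebra N) (cuntz_algebra M) \<pi> \<rho> \<circ> cuntz_embed N M"

end

theory Submission
  imports Defs
begin

text \<open>
  Homomorphisms are produced from intertwiners: if \<open>\<W>\<close> is a set of operators from \<open>H\<close> to \<open>K\<close>
  whose contractions norm \<open>H\<close>, then the pairs \<open>(u, R)\<close> with \<open>W R = u W\<close> and \<open>W R\<^sup>* = u\<^sup>* W\<close> for all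
  \<open>W \<in> \<W>\<close> form the graph of a *-homomorphism. A nonzero Hilbert space with a Cuntz family, \<open>N \<ge> 2\<close>, is the
  union of its infinite-dimensional separable reducing subspaces, each of which is a copy of one
  block of \<open>cuntz_space\<close>. The corresponding partial isometries give the universal property, hence
  the embedding of \<open>O\<^sub>N\<^sub>M\<close>, and their tensor products give \<open>\<pi> \<otimes> \<rho>\<close> on the spatial tensor product.
  As *-homomorphisms are contractive, they are determined by the generators. So each of the three
  claims only has to be checked for \<open>t\<^sub>i \<otimes> r\<^sub>j\<close> acting on elementary tensors.
\<close>

section \<open>Adjoints\<close>

text \<open>The tensor homomorphism and the embedding are defined by definite descriptions with
  purely algebraic conditions, so existence and uniqueness are both owed and no continuity is given.

  The obstacle to existence is that \<open>cuntz_space\<close> contains only families on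
  \<open>nat ell2\<close>, whereas a representation may act on a space of any dimension, which need
  not embed into \<open>cuntz_space\<close>. So the image R of u is not written down but
  characterised through intertwiners: each sees one separable piece, and a norming set of them gives
  norm R \<le> norm u, which yields uniqueness of R and a closed domain at one stroke. N \<ge> 2
  enters because a single unitary can have finite-dimensional reducing subspaces, and these have no
  basis indexed by \<open>nat\<close>.

  Intertwiners are made to fix a whole countable set of vectors: a vector of a tensor product is
  only a limit of finite sums of elementary tensors, and all factors of such a sum must be fixed by
  the same V and W. The error of this approximation is the e in \<open>norming\<close>.\<close>

instance chilbert \<subseteq> banach ..

lemma cinner_eqI:
  assumes "\<And>z. cinner z x = cinner z y"
  shows "x = y"
proof -
  have "cinner (x - y) (x - y) = 0"
    using assms by (simp add: cinner_diff_right)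
  then show ?thesis by (simp add: cinner_self)
qed

lemma cinner_zero_sym: "cinner x y = 0 \<Longrightarrow> cinner y x = 0"
  by (metis cinner_commute complex_cnj_zero)

lemma blinfun_eq_iff: "S = T \<longleftrightarrow> (\<forall>x. blinfun_apply S x = blinfun_apply T x)"
  by (auto intro: blinfun_eqI)

text \<open>A minimiser of J x = |x|^2 - 2 \<phi> x exists by the parallelogram law and
  completeness; stationarity of J at it is the claim. The complex form is recovered in
  \<open>adj_ex\<close>.\<close>

lemma riesz_real:
  fixes \<phi> :: "'a::chilbert \<Rightarrow> real"
  assumes "bounded_linear \<phi>"
  shows "\<exists>z. \<forall>x. \<phi> x = inner z x"
proof -
  interpret bounded_linear \<phi> by fact
  define J where "J x = (norm x)\<^sup>2 - 2 * \<phi> x" for x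
  obtain K where K: "\<And>x. \<bar>\<phi> x\<bar> \<le> norm x * K"
    using bounded by (metis real_norm_def)
  have "- K\<^sup>2 \<le> J x" for x
  proof -
    have "0 \<le> (norm x - K)\<^sup>2" by simp
    then show ?thesis using K[of x] by (simp add: J_def power2_diff)
  qed
  then have bdd: "bdd_below (range J)" by (intro bdd_belowI[where m = "- K\<^sup>2"]) auto
  define m where "m = Inf (range J)"
  have m: "m \<le> J x" for x unfolding m_def using bdd by (intro cInf_lower) auto
  \<comment> \<open>The \<phi>-terms cancel since \<phi> of the midpoint is the mean. What remains
    is the parallelogram law, which makes minimising sequences Cauchy.\<close>
  have par: "(norm (x - y))\<^sup>2 \<le> 2 * (J x - m) + 2 * (J y - m)" for x y
  proof -
    have "(norm (x - y))\<^sup>2 = 2 * J x + 2 * J y - 4 * J ((1/2) *\<^sub>R (x + y))"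
      by (simp add: J_def power2_norm_eq_inner inner_add_left inner_add_right inner_diff_left
          inner_diff_right inner_commute scaleR add algebra_simps)
    then show ?thesis using m[of "(1/2) *\<^sub>R (x + y)"] by simp
  qed
  have "\<exists>x. J x < m + inverse (real (Suc n))" for n
    using cInf_lessD[of "range J" "m + inverse (real (Suc n))"] by (auto simp: m_def)
  then obtain X where X: "\<And>n. J (X n) < m + inverse (real (Suc n))" by metis
  have "Cauchy X"
  proof (rule CauchyI')
    fix e :: real assume "e > 0"
    \<comment> \<open>e^2 / 4 because \<open>par\<close> adds two such excesses, each with factor
      2.\<close>
    then have "0 < e\<^sup>2 / 4" by simp
    then have "\<forall>\<^sub>F n in sequentially. inverse (real (Suc n)) < e\<^sup>2 / 4"
      by (rule order_tendstoD(2)[OF LIMSEQ_inverse_real_of_nat])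
    then obtain k where k: "inverse (real (Suc n)) < e\<^sup>2 / 4" if "n \<ge> k" for n
      by (auto simp: eventually_sequentially)
    have "dist (X i) (X j) < e" if "i \<ge> k" "j > i" for i j
    proof -
      have kj: "k \<le> j" using that by simp
      have "(norm (X i - X j))\<^sup>2 < e\<^sup>2"
        using par[of "X i" "X j"] X[of i] X[of j] k[OF that(1)] k[OF kj] by argo
      then show ?thesis
        using \<open>e > 0\<close> power_less_imp_less_base[of "norm (X i - X j)" 2 e] by (simp add: dist_norm)
    qed
    then show "\<exists>k. \<forall>i\<ge>k. \<forall>j>i. dist (X i) (X j) < e" by blast
  qed
  then obtain z where z: "X \<longlonglongrightarrow> z" using Cauchy_convergent convergent_def by blast
  have Jz: "J z \<le> m"
  proof (rule LIMSEQ_le)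
    show "(\<lambda>n. J (X n)) \<longlonglongrightarrow> J z" 
      unfolding J_def by (intro tendsto_diff tendsto_mult tendsto_const tendsto_power tendsto_norm tendsto[OF z] z)
    show "(\<lambda>n. m + inverse (real (Suc n))) \<longlonglongrightarrow> m"
      using tendsto_add[OF tendsto_const LIMSEQ_inverse_real_of_nat, of m] by simp
    show "\<exists>N. \<forall>n\<ge>N. J (X n) \<le> m + inverse (real (Suc n))" using X less_imp_le by blast
  qed
  have "\<phi> h = inner z h" for h
  proof (cases "h = 0")
    case True
    then show ?thesis by (simp add: zero)
  next
    case False
    define d where "d = inner z h - \<phi> h"
    \<comment> \<open>The minimiser of J (z + t h), a quadratic polynomial in t; its value there is
      J z - d^2 / |h|^2.\<close>
    define t where "t = - d / (norm h)\<^sup>2"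
    have "J (z + t *\<^sub>R h) = J z + 2 * t * d + t\<^sup>2 * (norm h)\<^sup>2"
      unfolding J_def d_def power2_norm_eq_inner inner_add_left inner_add_right inner_scaleR_left
        inner_scaleR_right inner_commute[of h z] scaleR add
      by (simp add: algebra_simps power2_eq_square)
    moreover have "2 * t * d + t\<^sup>2 * (norm h)\<^sup>2 = - d\<^sup>2 / (norm h)\<^sup>2"
      using False by (simp add: t_def power2_eq_square field_simps)
    ultimately have "d\<^sup>2 / (norm h)\<^sup>2 \<le> 0" using Jz m[of "z + t *\<^sub>R h"] by simp
    then show ?thesis using False by (simp add: d_def divide_le_0_iff)
  qed
  then show ?thesis by blast
qed

section \<open>Closure properties of the complex-linear operators\<close>

lemma clinear_ops_scaleC: "T \<in> clinear_ops \<Longrightarrow> T (c *\<^sub>C x) = c *\<^sub>C T x"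
  by (simp add: clinear_ops_def)

lemma op_scaleC_apply [simp]: "blinfun_apply (op_scaleC c T) x = c *\<^sub>C T x"
  unfolding op_scaleC_def
  by (subst bounded_linear_Blinfun_apply)
     (auto intro: bounded_linear_compose[OF bounded_linear_scaleC] blinfun.bounded_linear_right)

lemma op_scaleC_of_real: "op_scaleC (complex_of_real r) T = r *\<^sub>R T"
  by (rule blinfun_eqI) (simp add: scaleC_of_real blinfun.bilinear_simps)

lemma scaleC_diff_right: "c *\<^sub>C (x - y) = c *\<^sub>C x - c *\<^sub>C (y::'a::chilbert)"
  by (simp add: bounded_linear.linear[OF bounded_linear_scaleC] linear_diff)

lemma zero_clinear_ops [simp]: "0 \<in> clinear_ops"
  by (simp add: clinear_ops_def)

lemma id_clinear_ops [simp]: "id_blinfun \<in> clinear_ops"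
  by (simp add: clinear_ops_def)

lemma compose_clinear_ops: "S \<in> clinear_ops \<Longrightarrow> T \<in> clinear_ops \<Longrightarrow> S o\<^sub>L T \<in> clinear_ops"
  by (simp add: clinear_ops_def)

lemma add_clinear_ops: "S \<in> clinear_ops \<Longrightarrow> T \<in> clinear_ops \<Longrightarrow> S + T \<in> clinear_ops"
  by (simp add: clinear_ops_def blinfun.bilinear_simps scaleC_add_right)

lemma diff_clinear_ops: "S \<in> clinear_ops \<Longrightarrow> T \<in> clinear_ops \<Longrightarrow> S - T \<in> clinear_ops"
  by (simp add: clinear_ops_def blinfun.bilinear_simps scaleC_diff_right)

lemma op_scaleC_clinear_ops: "T \<in> clinear_ops \<Longrightarrow> op_scaleC c T \<in> clinear_ops"
  by (simp add: clinear_ops_def scaleC_scaleC mult.commute)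

lemma scaleR_clinear_ops: "T \<in> clinear_ops \<Longrightarrow> r *\<^sub>R T \<in> clinear_ops"
  by (metis op_scaleC_of_real op_scaleC_clinear_ops)

lemma closed_clinear_ops: "closed (clinear_ops :: ('a::chilbert \<Rightarrow>\<^sub>L 'b::chilbert) set)"
proof -
  have "closed {T :: 'a \<Rightarrow>\<^sub>L 'b. T (c *\<^sub>C x) = c *\<^sub>C T x}" for c x
    by (intro closed_Collect_eq bounded_linear.continuous_on[OF bounded_linear_scaleC]
        continuous_intros)
  then show ?thesis unfolding clinear_ops_def by (intro closed_Collect_all)
qed

section \<open>Existence and calculus of adjoints\<close>

lemma adj_eqI:
  fixes T :: "'a::chilbert \<Rightarrow>\<^sub>L 'b::chilbert" and R :: "'b \<Rightarrow>\<^sub>L 'a"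
  assumes "\<And>x y. cinner (R y) x = cinner y (T x)"
  shows "adj T = R"
  unfolding adj_def
proof (rule the_equality)
  show "\<forall>x y. cinner (R y) x = cinner y (T x)" using assms by blast
  fix R' assume "\<forall>x y. cinner (blinfun_apply R' y) x = cinner y (T x)"
  then show "R' = R" using assms by (intro blinfun_eqI cinner_eqI) (metis cinner_commute)
qed

text \<open>Riesz applied to the real part of <y, T x> matches real parts only; since T commutes
  with the scalar i, evaluation at i x matches the imaginary parts too. The bound on R comes from |R
  y|^2 = <y, T (R y)>.\<close>

lemma adj_ex:
  fixes T :: "'a::chilbert \<Rightarrow>\<^sub>L 'b::chilbert"
  assumes "T \<in> clinear_ops"
  shows "\<exists>R. \<forall>x y. cinner (blinfun_apply R y) x = cinner y (T x)"
proof -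
  have "\<exists>z. \<forall>x. cinner z x = cinner y (T x)" for y
  proof -
    have "bounded_linear (\<lambda>x. inner y (T x))"
      by (intro bounded_linear_compose[OF bounded_linear_inner_right] blinfun.bounded_linear_right)
    from riesz_real[OF this] obtain z where z: "\<And>x. inner y (T x) = inner z x" by blast
    have "Im (cinner z x) = Im (cinner y (T x))" for x
    proof -
      have "inner z (\<i> *\<^sub>C x) = inner y (\<i> *\<^sub>C T x)"
        by (simp add: z [symmetric] clinear_ops_scaleC[OF assms])
      then show ?thesis by (simp add: Re_cinner [symmetric] cinner_scaleC_right)
    qed
    then show ?thesis using z by (intro exI[of _ z]) (simp add: complex_eq_iff Re_cinner)
  qed
  then obtain R where R: "\<And>x y. cinner (R y) x = cinner y (T x)" by metis
  have R': "cinner x (R y) = cinner (T x) y" for x y by (metis R cinner_commute)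
  have "bounded_linear R"
  proof (rule bounded_linear_intro[where K = "norm T"])
    show "R (x + y) = R x + R y" for x y
      by (rule cinner_eqI) (simp add: R' cinner_add_right)
    show "R (r *\<^sub>R x) = r *\<^sub>R R x" for r x
      by (rule cinner_eqI) (simp add: R' cinner_scaleR_right)
    fix y
    have "(norm (R y))\<^sup>2 = cmod (cinner (R y) (R y))"
      by (simp add: cinner_self norm_power)
    also have "\<dots> = cmod (cinner y (T (R y)))" by (simp add: R)
    also have "\<dots> \<le> norm y * (norm T * norm (R y))"
      by (rule order_trans[OF norm_cinner_le]) (intro mult_left_mono norm_blinfun norm_ge_zero)
    finally show "norm (R y) \<le> norm y * norm T"
      by (cases "R y = 0") (auto simp: power2_eq_square mult.assoc)
  qed
  then show ?thesis
    by (intro exI[of _ "Blinfun R"]) (simp add: bounded_linear_Blinfun_apply R)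
qed

lemma cinner_adj_left: "T \<in> clinear_ops \<Longrightarrow> cinner (adj T y) x = cinner y (T x)"
  using adj_ex adj_eqI by metis

lemma cinner_adj_right: "T \<in> clinear_ops \<Longrightarrow> cinner x (adj T y) = cinner (T x) y"
  by (metis cinner_adj_left cinner_commute)

lemma adj_clinear_ops:
  assumes "T \<in> clinear_ops"
  shows "adj T \<in> clinear_ops"
  unfolding clinear_ops_def
  by (intro CollectI allI cinner_eqI) (simp add: cinner_adj_right[OF assms] cinner_scaleC_right)

lemma adj_adj: "T \<in> clinear_ops \<Longrightarrow> adj (adj T) = T"
  by (intro adj_eqI) (simp add: cinner_adj_right)

lemma adj_id [simp]: "adj id_blinfun = id_blinfun"
  by (intro adj_eqI) simp

lemma adj_zero [simp]: "adj 0 = 0"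
  by (intro adj_eqI) simp

lemma adj_compose:
  "S \<in> clinear_ops \<Longrightarrow> T \<in> clinear_ops \<Longrightarrow> adj (S o\<^sub>L T) = adj T o\<^sub>L adj S"
  by (intro adj_eqI) (simp add: cinner_adj_left)

lemma adj_add: "S \<in> clinear_ops \<Longrightarrow> T \<in> clinear_ops \<Longrightarrow> adj (S + T) = adj S + adj T"
  by (intro adj_eqI)
     (simp add: cinner_adj_left blinfun.bilinear_simps cinner_add_left cinner_add_right)

lemma adj_diff: "S \<in> clinear_ops \<Longrightarrow> T \<in> clinear_ops \<Longrightarrow> adj (S - T) = adj S - adj T"
  by (intro adj_eqI)
     (simp add: cinner_adj_left blinfun.bilinear_simps cinner_diff_left cinner_diff_right)

lemma adj_op_scaleC: "T \<in> clinear_ops \<Longrightarrow> adj (op_scaleC c T) = op_scaleC (cnj c) (adj T)"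
  by (intro adj_eqI) (simp add: cinner_adj_left cinner_scaleC_left cinner_scaleC_right)

lemma adj_scaleR: "T \<in> clinear_ops \<Longrightarrow> adj (r *\<^sub>R T) = r *\<^sub>R adj T"
  using adj_op_scaleC[of T "complex_of_real r"] by (simp add: op_scaleC_of_real)

lemma norm_adj_le:
  assumes "T \<in> clinear_ops"
  shows "norm (adj T) \<le> norm T"
proof (rule norm_blinfun_bound)
  fix y
  have "(norm (adj T y))\<^sup>2 = cmod (cinner (adj T y) (adj T y))"
    by (simp add: cinner_self norm_power)
  also have "\<dots> = cmod (cinner y (T (adj T y)))" by (simp add: cinner_adj_left[OF assms])
  also have "\<dots> \<le> norm y * (norm T * norm (adj T y))"
    by (rule order_trans[OF norm_cinner_le]) (intro mult_left_mono norm_blinfun norm_ge_zero)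
  finally show "norm (adj T y) \<le> norm T * norm y"
    by (cases "adj T y = 0") (auto simp: power2_eq_square mult_ac)
qed simp

lemma tendsto_adj:
  assumes "X \<longlonglongrightarrow> T" "\<And>n. X n \<in> clinear_ops" "T \<in> clinear_ops"
  shows "(\<lambda>n. adj (X n)) \<longlonglongrightarrow> adj T"
proof -
  have "(\<lambda>n. norm (X n - T)) \<longlonglongrightarrow> 0" using assms(1) by (simp add: LIM_zero tendsto_norm_zero)
  moreover have "norm (adj (X n) - adj T) \<le> norm (X n - T)" for n
    using norm_adj_le[of "X n - T"] assms by (simp add: adj_diff diff_clinear_ops)
  ultimately have "(\<lambda>n. adj (X n) - adj T) \<longlonglongrightarrow> 0"
    by (intro Lim_null_comparison[where f = "\<lambda>n. adj (X n) - adj T"] always_eventually) auto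
  then show ?thesis by (rule LIM_zero_cancel)
qed

section \<open>Isometries and unitaries\<close>

lemma cinner_isometry:
  assumes "V \<in> clinear_ops" "\<And>x. norm (V x) = norm x"
  shows "cinner (V x) (V y) = cinner x y"
  by (intro isometry_cinner) (simp_all add: assms blinfun.bilinear_simps clinear_ops_scaleC)

lemma adj_isometry:
  assumes "V \<in> clinear_ops" "\<And>x. norm (V x) = norm x"
  shows "adj V o\<^sub>L V = id_blinfun"
  by (intro blinfun_eqI cinner_eqI)
     (simp add: cinner_adj_right assms(1) cinner_isometry[OF assms])

text \<open>The partial isometries built later are controlled only on vectors fixed by
  \<open>adj W\<close> after \<open>W\<close>; this turns such a fixed point into preservation of
  its norm.\<close>

lemma norm_eq_of_adj_fixed:
  assumes "W \<in> clinear_ops" "adj W (W x) = x"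
  shows "norm (W x) = norm x"
proof -
  have "cinner (W x) (W x) = cinner x x"
    using cinner_adj_right[OF assms(1), of x "W x"] assms(2) by simp
  then show ?thesis by (simp add: cinner_self flip: of_real_power)
qed

text \<open>Since adj U = adj U U V = V, an isometry needs only a right inverse to be
  unitary.\<close>

lemma unitaryI:
  assumes "U \<in> clinear_ops" "\<And>x. norm (U x) = norm x" "U o\<^sub>L V = id_blinfun"
  shows "unitary U" "adj U = V"
proof -
  have iso: "adj U o\<^sub>L U = id_blinfun" by (rule adj_isometry[OF assms(1,2)])
  have "adj U = adj U o\<^sub>L (U o\<^sub>L V)" using assms(3) by (simp add: blinfun_eqI)
  also have "\<dots> = (adj U o\<^sub>L U) o\<^sub>L V" by (rule blinfun_eqI) simp
  finally show "adj U = V" using iso by (simp add: blinfun_eqI)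
  then show "unitary U" using assms iso by (simp add: unitary_def)
qed

lemma unitaryD:
  assumes "unitary U"
  shows "U \<in> clinear_ops" "adj U o\<^sub>L U = id_blinfun" "U o\<^sub>L adj U = id_blinfun"
    and "adj U (U x) = x" "U (adj U y) = y"
  using assms by (auto simp: unitary_def blinfun_eq_iff)

section \<open>Homomorphisms of concrete C*-algebras\<close>

lemmas tendsto_blinfun_compose = bounded_bilinear.tendsto[OF bounded_bilinear_blinfun_compose]

lemma cstar_algebraD:
  assumes "cstar_algebra A"
  shows "A \<subseteq> clinear_ops" "closed A" "id_blinfun \<in> A"
    and "S \<in> A \<Longrightarrow> T \<in> A \<Longrightarrow> S + T \<in> A" "S \<in> A \<Longrightarrow> T \<in> A \<Longrightarrow> S o\<^sub>L T \<in> A"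
    and "T \<in> A \<Longrightarrow> op_scaleC c T \<in> A" "T \<in> A \<Longrightarrow> adj T \<in> A" "T \<in> A \<Longrightarrow> T \<in> clinear_ops"
  using assms by (auto simp: cstar_algebra_def)

lemma cstar_algebra_scaleR: "cstar_algebra A \<Longrightarrow> T \<in> A \<Longrightarrow> r *\<^sub>R T \<in> A"
  by (metis cstar_algebraD(6) op_scaleC_of_real)

lemma cstar_algebra_diff: "cstar_algebra A \<Longrightarrow> S \<in> A \<Longrightarrow> T \<in> A \<Longrightarrow> S - T \<in> A"
  using cstar_algebraD(4)[of A S "- 1 *\<^sub>R T"] cstar_algebra_scaleR[of A T "- 1"] by simp

lemma cstar_algebra_clinear_ops: "cstar_algebra clinear_ops"
  by (simp add: cstar_algebra_def closed_clinear_ops add_clinear_ops compose_clinear_ops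
      op_scaleC_clinear_ops adj_clinear_ops)

lemma cstar_algebra_Inter:
  assumes "\<A> \<noteq> {}" "\<And>A. A \<in> \<A> \<Longrightarrow> cstar_algebra A"
  shows "cstar_algebra (\<Inter> \<A>)"
proof -
  have "\<Inter> \<A> \<subseteq> clinear_ops" using assms unfolding cstar_algebra_def by blast
  moreover have "closed (\<Inter> \<A>)" using assms(2) by (intro closed_Inter) (auto simp: cstar_algebra_def)
  ultimately show ?thesis using assms(2) by (auto simp: cstar_algebra_def)
qed

lemma cstar_algebra_generated: "G \<subseteq> clinear_ops \<Longrightarrow> cstar_algebra (cstar_generated G)"
  unfolding cstar_generated_def
  by (intro cstar_algebra_Inter) (use cstar_algebra_clinear_ops in auto)

lemma cstar_generated_subset: "cstar_algebra A \<Longrightarrow> G \<subseteq> A \<Longrightarrow> cstar_generated G \<subseteq> A"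
  by (auto simp: cstar_generated_def)

lemma generators_subset: "G \<subseteq> cstar_generated G"
  by (auto simp: cstar_generated_def)

lemma unital_star_homD:
  assumes "unital_star_hom A B f"
  shows "T \<in> A \<Longrightarrow> f T \<in> B" "f id_blinfun = id_blinfun"
    and "S \<in> A \<Longrightarrow> T \<in> A \<Longrightarrow> f (S + T) = f S + f T"
    and "S \<in> A \<Longrightarrow> T \<in> A \<Longrightarrow> f (S o\<^sub>L T) = f S o\<^sub>L f T"
    and "T \<in> A \<Longrightarrow> f (op_scaleC c T) = op_scaleC c (f T)"
    and "T \<in> A \<Longrightarrow> f (adj T) = adj (f T)"
    and "T \<in> A \<Longrightarrow> f (r *\<^sub>R T) = r *\<^sub>R f T"
  using assms by (auto simp: unital_star_hom_def op_scaleC_of_real [symmetric])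

lemma unital_star_hom_diff:
  assumes "unital_star_hom A B f" "cstar_algebra A" "S \<in> A" "T \<in> A"
  shows "f (S - T) = f S - f T"
  using unital_star_homD(3)[OF assms(1,3), of "- 1 *\<^sub>R T"] unital_star_homD(7)[OF assms(1,4), of "- 1"]
    cstar_algebra_scaleR[OF assms(2,4), of "- 1"] by simp

lemma unital_star_hom_id: "A \<subseteq> clinear_ops \<Longrightarrow> unital_star_hom A clinear_ops (\<lambda>a. a)"
  by (auto simp: unital_star_hom_def)

lemma unital_star_hom_comp:
  assumes "unital_star_hom A B f" "unital_star_hom B C g"
  shows "unital_star_hom A C (g \<circ> f)"
  using assms unfolding unital_star_hom_def by (auto simp: Pi_iff)

lemma unital_star_hom_subset: "A \<subseteq> A' \<Longrightarrow> unital_star_hom A' B f \<Longrightarrow> unital_star_hom A B f"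
  unfolding unital_star_hom_def by blast

lemma unital_star_hom_restrict:
  assumes "cstar_algebra A" "unital_star_hom A B f"
  shows "unital_star_hom A B (restrict f A)"
  using assms unfolding unital_star_hom_def cstar_algebra_def by (auto simp: Pi_iff)

text \<open>
  The solution of \<open>2y = a + y\<^sup>2\<close> satisfies \<open>(1 - y)\<^sup>2 = 1 - a\<close>. On the ball of radius
  \<open>1 - sqrt (1 - norm a)\<close> the map \<open>y \<mapsto> (a + y\<^sup>2) / 2\<close> is a contraction, so no functional calculus
  is needed to find it.
\<close>

lemma cstar_algebra_square_root:
  assumes A: "cstar_algebra A" and a: "a \<in> A" "adj a = a" "norm a < 1"
  shows "\<exists>y\<in>A. adj y = y \<and> 2 *\<^sub>R y = a + (y o\<^sub>L y)"
proof -
  define r where "r = 1 - sqrt (1 - norm a)"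
  have r: "0 \<le> r" "r < 1" using a(3) by (simp_all add: r_def)
  \<comment> \<open>The fixed-point equation of the radius: it makes the ball of radius r invariant
    under f.\<close>
  have ra: "norm a + r\<^sup>2 = 2 * r"
    using a(3) by (simp add: r_def power2_diff)
  define S where "S = {y \<in> A. adj y = y} \<inter> cball 0 r"
  define f where "f y = (1/2) *\<^sub>R (a + (y o\<^sub>L y))" for y
  have AC: "y \<in> A \<Longrightarrow> y \<in> clinear_ops" for y by (rule cstar_algebraD(8)[OF A])
  \<comment> \<open>Closedness of the self-adjoint part keeps the fixed point self-adjoint and
    inside A.\<close>
  have "closed {y \<in> A. adj y = y}"
    unfolding closed_sequential_limits
  proof (intro allI impI, elim conjE)
    fix X l assume X: "\<forall>n. X n \<in> {y \<in> A. adj y = y}" and l: "X \<longlonglongrightarrow> l"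
    then have lA: "l \<in> A" using cstar_algebraD(2)[OF A] unfolding closed_sequential_limits by blast
    have "(\<lambda>n. adj (X n)) \<longlonglongrightarrow> adj l" using X lA AC by (intro tendsto_adj l) auto
    then have "adj l = l" using X l LIMSEQ_unique by auto
    then show "l \<in> {y \<in> A. adj y = y}" using lA by simp
  qed
  then have "complete S" unfolding S_def by (simp add: complete_eq_closed closed_Int)
  moreover have "0 \<in> S"
    using r cstar_algebra_scaleR[OF A cstar_algebraD(3)[OF A], of 0] by (simp add: S_def)
  moreover have "f ` S \<subseteq> S"
  proof
    fix z assume "z \<in> f ` S"
    then obtain y where y: "y \<in> A" "adj y = y" "norm y \<le> r" and z: "z = f y" by (auto simp: S_def)
    have yy: "y o\<^sub>L y \<in> A" "a + (y o\<^sub>L y) \<in> A" using y a A cstar_algebraD(4,5) by metis+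
    have "adj z = z"
      unfolding z f_def using y a yy
      by (simp add: adj_scaleR adj_add adj_compose AC)
    moreover have "z \<in> A" unfolding z f_def using yy A by (intro cstar_algebra_scaleR)
    moreover have "norm z \<le> r"
    proof -
      have "norm (y o\<^sub>L y) \<le> r\<^sup>2"
        using norm_blinfun_compose[of y y] mult_mono[OF y(3,3)] r by (simp add: power2_eq_square)
      then have "norm (a + (y o\<^sub>L y)) \<le> 2 * r" using norm_triangle_ineq[of a "y o\<^sub>L y"] ra by linarith
      then show ?thesis by (simp add: z f_def)
    qed
    ultimately show "z \<in> S" by (simp add: S_def)
  qed
  moreover have "dist (f x) (f y) \<le> r * dist x y" if "x \<in> S" "y \<in> S" for x y
  proof -
    have xy: "norm x \<le> r" "norm y \<le> r" using that by (auto simp: S_def)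
    have "(x o\<^sub>L x) - (y o\<^sub>L y) = (x o\<^sub>L (x - y)) + ((x - y) o\<^sub>L y)"
      by (rule blinfun_eqI) (simp add: blinfun.bilinear_simps)
    then have "norm ((x o\<^sub>L x) - (y o\<^sub>L y)) \<le> norm x * norm (x - y) + norm (x - y) * norm y"
      by (metis add_mono norm_blinfun_compose norm_triangle_le)
    also have "\<dots> \<le> r * norm (x - y) + norm (x - y) * r"
      using xy by (intro add_mono mult_left_mono mult_right_mono) auto
    finally have "norm ((x o\<^sub>L x) - (y o\<^sub>L y)) \<le> 2 * (r * norm (x - y))" by (simp add: mult.commute)
    moreover have "f x - f y = (1/2) *\<^sub>R ((x o\<^sub>L x) - (y o\<^sub>L y))"
      by (simp add: f_def scaleR_diff_right scaleR_add_right)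
    ultimately show ?thesis by (simp add: dist_norm)
  qed
  ultimately have "\<exists>!y\<in>S. f y = y" using r by (intro Banach_fix[where c = r]) auto
  then obtain y where "y \<in> S" and y: "f y = y" by blast
  have "2 *\<^sub>R y = 2 *\<^sub>R f y" by (simp add: y)
  then have "2 *\<^sub>R y = a + (y o\<^sub>L y)" by (simp add: f_def)
  then show ?thesis using \<open>y \<in> S\<close> by (auto simp: S_def)
qed

text \<open>For norm S < 1 the square root gives 1 - \<open>adj S o S\<close> = (1 - y)^2 with y
  self-adjoint in A. Applying f shows that 1 - \<open>adj (f S) o f S\<close> is again the square of
  a self-adjoint operator, hence positive, so \<open>f S\<close> is a contraction.\<close>

lemma unital_star_hom_contractive:
  fixes f :: "('a::chilbert \<Rightarrow>\<^sub>L 'a) \<Rightarrow> ('b::chilbert \<Rightarrow>\<^sub>L 'b)"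
  assumes A: "cstar_algebra A" and f: "unital_star_hom A B f" and B: "B \<subseteq> clinear_ops"
    and T: "T \<in> A"
  shows "norm (f T) \<le> norm T"
\<comment> \<open>It suffices to bound by every c above norm T; the strict inequality puts T / c
  into the open unit ball, where the square root exists.\<close>
proof (rule dense_ge)
  fix c assume c: "norm T < c"
  then have "c > 0" by (smt (verit) norm_ge_zero)
  define S where "S = (1/c) *\<^sub>R T"
  have S: "S \<in> A" unfolding S_def by (rule cstar_algebra_scaleR[OF A T])
  have nS: "norm S < 1" using c \<open>c > 0\<close> by (simp add: S_def)
  define a where "a = adj S o\<^sub>L S"
  have SC: "S \<in> clinear_ops" using S A cstar_algebraD(8) by blast
  have adjS: "adj S \<in> A" by (rule cstar_algebraD(7)[OF A S])
  have aA: "a \<in> A" unfolding a_def by (rule cstar_algebraD(5)[OF A adjS S])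
  have "adj a = a" unfolding a_def by (simp add: adj_compose SC adj_clinear_ops adj_adj)
  moreover have "norm a < 1"
  proof -
    have "norm a \<le> norm (adj S) * norm S" unfolding a_def by (rule norm_blinfun_compose)
    also have "\<dots> \<le> norm S * norm S" by (intro mult_right_mono norm_adj_le SC) simp
    also have "\<dots> \<le> norm S * 1" using nS by (intro mult_left_mono) auto
    finally show ?thesis using nS by simp
  qed
  ultimately obtain y where y: "y \<in> A" "adj y = y" "2 *\<^sub>R y = a + (y o\<^sub>L y)"
    using cstar_algebra_square_root[OF A aA] by blast
  have yy: "y o\<^sub>L y \<in> A" by (rule cstar_algebraD(5)[OF A y(1) y(1)])
  have fC: "f u \<in> clinear_ops" if "u \<in> A" for u using unital_star_homD(1)[OF f that] B by blast
  have fa: "f a = adj (f S) o\<^sub>L f S"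
    unfolding a_def using f S adjS by (simp add: unital_star_homD(4,6))
  have fy: "adj (f y) = f y" using unital_star_homD(6)[OF f y(1)] y(2) by simp
  have "2 *\<^sub>R f y = f a + (f y o\<^sub>L f y)"
    using unital_star_homD(7)[OF f y(1), of 2] unital_star_homD(3)[OF f aA yy]
      unital_star_homD(4)[OF f y(1) y(1)] y(3) by simp
  then have fa': "f a x = 2 *\<^sub>R f y x - f y (f y x)" for x
    by (metis add_diff_cancel_right' blinfun.add_left blinfun.scaleR_left blinfun_apply_blinfun_compose)
  have "norm (f S) \<le> 1"
  proof (rule norm_blinfun_bound)
    fix x
    have sa: "inner x (f y z) = inner (f y x) z" for z
      using cinner_adj_left[OF fC[OF y(1)], of x z] by (simp add: fy Re_cinner [symmetric])
    have "(norm (f S x))\<^sup>2 = inner x (f a x)"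
      using cinner_adj_right[OF fC[OF S], of x "f S x"]
      by (simp add: fa power2_norm_eq_inner Re_cinner [symmetric])
    \<comment> \<open>This is <x, (1 - (1 - f y)^2) x>, expanded with \<open>f y\<close>
      self-adjoint.\<close>
    also have "\<dots> = (norm x)\<^sup>2 - (norm (x - f y x))\<^sup>2"
      using inner_commute[of x "f y x"]
      by (simp add: fa' power2_norm_eq_inner inner_diff_left inner_diff_right sa[of "f y x"])
    also have "\<dots> \<le> (norm x)\<^sup>2" by simp
    finally show "norm (f S x) \<le> 1 * norm x" using power2_le_imp_le by force
  qed simp
  moreover have "f S = (1/c) *\<^sub>R f T" unfolding S_def by (rule unital_star_homD(7)[OF f T])
  ultimately show "norm (f T) \<le> c" using \<open>c > 0\<close> by simp
qed

section \<open>From generators to the generated algebra\<close>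

lemma unital_star_hom_tendsto:
  assumes A: "cstar_algebra A" and f: "unital_star_hom A B f" and B: "B \<subseteq> clinear_ops"
    and X: "\<And>n. X n \<in> A" "X \<longlonglongrightarrow> a"
  shows "(\<lambda>n. f (X n)) \<longlonglongrightarrow> f a"
proof -
  have a: "a \<in> A" using cstar_algebraD(2)[OF A] X unfolding closed_sequential_limits by blast
  have "(\<lambda>n. norm (X n - a)) \<longlonglongrightarrow> 0" using X(2) by (simp add: LIM_zero tendsto_norm_zero)
  moreover have "norm (f (X n) - f a) \<le> norm (X n - a)" for n
    using unital_star_hom_contractive[OF A f B cstar_algebra_diff[OF A X(1)[of n] a]]
    by (simp only: unital_star_hom_diff[OF f A X(1) a])
  ultimately have "(\<lambda>n. f (X n) - f a) \<longlonglongrightarrow> 0"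
    by (intro Lim_null_comparison[where f = "\<lambda>n. f (X n) - f a"] always_eventually) auto
  then show ?thesis by (rule LIM_zero_cancel)
qed

lemma closed_intertwined:
  assumes A: "cstar_algebra A" and f: "unital_star_hom A B f" "B \<subseteq> clinear_ops"
    and g: "unital_star_hom A C g" "C \<subseteq> clinear_ops"
  shows "closed {a \<in> A. W o\<^sub>L f a = g a o\<^sub>L W}"
  unfolding closed_sequential_limits
proof (intro allI impI, elim conjE)
  fix X a assume "\<forall>n. X n \<in> {a \<in> A. W o\<^sub>L f a = g a o\<^sub>L W}" and lim: "X \<longlonglongrightarrow> a"
  then have X: "\<And>n. X n \<in> A" "\<And>n. W o\<^sub>L f (X n) = g (X n) o\<^sub>L W" by auto
  have "a \<in> A" using cstar_algebraD(2)[OF A] X lim unfolding closed_sequential_limits by blast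
  moreover have "(\<lambda>n. W o\<^sub>L f (X n)) \<longlonglongrightarrow> (W o\<^sub>L f a)"
    by (intro tendsto_blinfun_compose tendsto_const unital_star_hom_tendsto[OF A f X(1) lim])
  moreover have "(\<lambda>n. g (X n) o\<^sub>L W) \<longlonglongrightarrow> (g a o\<^sub>L W)"
    by (intro tendsto_blinfun_compose tendsto_const unital_star_hom_tendsto[OF A g X(1) lim])
  ultimately show "a \<in> {a \<in> A. W o\<^sub>L f a = g a o\<^sub>L W}" using X LIMSEQ_unique by auto
qed

text \<open>The elements intertwined by W form a closed subalgebra, but since W need not be unitary
  it is not visibly self-adjoint. Hence the relation is assumed for the adjoints of generators as
  well, and D keeps only elements for which it holds together with the adjoint.\<close>

lemma unital_star_hom_intertwined:
  fixes W :: "'b::chilbert \<Rightarrow>\<^sub>L 'c::chilbert"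
  assumes G: "G \<subseteq> clinear_ops" and A: "A = cstar_generated G"
    and f: "unital_star_hom A B f" "B \<subseteq> clinear_ops"
    and g: "unital_star_hom A C g" "C \<subseteq> clinear_ops"
    and W: "W \<in> clinear_ops"
    and gen: "\<And>a. a \<in> G \<Longrightarrow> W o\<^sub>L f a = g a o\<^sub>L W"
      "\<And>a. a \<in> G \<Longrightarrow> W o\<^sub>L adj (f a) = adj (g a) o\<^sub>L W"
    and a: "a \<in> A"
  shows "W o\<^sub>L f a = g a o\<^sub>L W"
proof -
  have CA: "cstar_algebra A" unfolding A by (rule cstar_algebra_generated[OF G])
  define E where "E = {a \<in> A. W o\<^sub>L f a = g a o\<^sub>L W}"
  define D where "D = {a \<in> A. a \<in> E \<and> adj a \<in> E}"
  note fD = unital_star_homD[OF f(1)] and gD = unital_star_homD[OF g(1)] and AD = cstar_algebraD[OF CA]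
  have E: "a \<in> E \<longleftrightarrow> a \<in> A \<and> (\<forall>x. W (f a x) = g a (W x))" for a
    by (auto simp: E_def blinfun_eq_iff)
  have Eadd: "S + T \<in> E" if "S \<in> E" "T \<in> E" for S T
    using that by (simp add: E fD gD AD blinfun.bilinear_simps)
  have Ecomp: "S o\<^sub>L T \<in> E" if "S \<in> E" "T \<in> E" for S T
    using that by (simp add: E fD gD AD)
  have Escale: "op_scaleC c T \<in> E" if "T \<in> E" for c T
    using that by (simp add: E fD gD AD clinear_ops_scaleC[OF W])
  have cl: "closed E" unfolding E_def by (rule closed_intertwined[OF CA f g])
  have AC: "T \<in> A \<Longrightarrow> T \<in> clinear_ops" for T by (rule AD(8))
  have "closed D"
    unfolding closed_sequential_limits
  proof (intro allI impI, elim conjE)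
    fix X l assume X: "\<forall>n. X n \<in> D" and lim: "X \<longlonglongrightarrow> l"
    then have XD: "X n \<in> A" "X n \<in> E" "adj (X n) \<in> E" for n by (auto simp: D_def)
    have lE: "l \<in> E" by (rule closed_sequentially[OF cl XD(2) lim])
    then have lA: "l \<in> A" by (simp add: E)
    have "(\<lambda>n. adj (X n)) \<longlonglongrightarrow> adj l" by (intro tendsto_adj lim AC lA XD)
    then have "adj l \<in> E" by (rule closed_sequentially[OF cl XD(3)])
    then show "l \<in> D" using lA lE by (simp add: D_def)
  qed
  moreover have "D \<subseteq> clinear_ops" using AC by (auto simp: D_def)
  moreover have "id_blinfun \<in> D" by (simp add: D_def E fD(2) gD(2) AD(3))
  moreover have "S + T \<in> D" "S o\<^sub>L T \<in> D" if "S \<in> D" "T \<in> D" for S T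
    using that AC by (simp_all add: D_def adj_add adj_compose Eadd Ecomp AD(4,5))
  moreover have "op_scaleC c T \<in> D" "adj T \<in> D" if "T \<in> D" for c T
    using that AC by (simp_all add: D_def adj_op_scaleC adj_adj Escale AD(6,7))
  ultimately have "cstar_algebra D" by (auto simp: cstar_algebra_def)
  moreover have "G \<subseteq> D"
  proof
    fix a assume "a \<in> G"
    then have "a \<in> A" using generators_subset[of G] A by auto
    then show "a \<in> D"
      using gen[OF \<open>a \<in> G\<close>] fD(6) gD(6) by (auto simp: D_def E_def AD)
  qed
  ultimately have "A \<subseteq> D" unfolding A by (rule cstar_generated_subset)
  then show ?thesis using a by (auto simp: D_def E_def)
qed

text \<open>The case W = id of the intertwining lemma; contractivity enters there, through the
  closedness of the set of coincidence.\<close>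

lemma unital_star_hom_unique:
  assumes "G \<subseteq> clinear_ops" "A = cstar_generated G"
    and "unital_star_hom A B f" "B \<subseteq> clinear_ops" "unital_star_hom A C g" "C \<subseteq> clinear_ops"
    and "\<And>a. a \<in> G \<Longrightarrow> f a = g a" "a \<in> A"
  shows "f a = g a"
proof -
  have "id_blinfun o\<^sub>L f a = g a o\<^sub>L id_blinfun"
    by (rule unital_star_hom_intertwined[OF assms(1-6) _ _ _ assms(8)])
       (simp_all add: assms(7) blinfun_eqI)
  then show ?thesis by (simp add: blinfun_eq_iff)
qed

text \<open>The universal property delivers values in \<open>clinear_ops\<close> only, whereas
  \<open>cuntz_embed\<close> has the tensor algebra as its target. The preimage of C is a C*-algebra
  containing the generators.\<close>

lemma unital_star_hom_range:
  assumes G: "G \<subseteq> clinear_ops" and A: "A = cstar_generated G"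
    and f: "unital_star_hom A B f" "B \<subseteq> clinear_ops"
    and C: "cstar_algebra C" "\<And>a. a \<in> G \<Longrightarrow> f a \<in> C"
  shows "unital_star_hom A C f"
proof -
  have CA: "cstar_algebra A" unfolding A by (rule cstar_algebra_generated[OF G])
  note AD = cstar_algebraD[OF CA] and CD = cstar_algebraD[OF C(1)] and fD = unital_star_homD[OF f(1)]
  define D where "D = {a \<in> A. f a \<in> C}"
  have "closed D"
    unfolding closed_sequential_limits
  proof (intro allI impI, elim conjE)
    fix X l assume "\<forall>n. X n \<in> D" and lim: "X \<longlonglongrightarrow> l"
    then have X: "X n \<in> A" "f (X n) \<in> C" for n by (auto simp: D_def)
    have "l \<in> A" by (rule closed_sequentially[OF AD(2) X(1) lim])
    moreover have "f l \<in> C"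
      by (rule closed_sequentially[OF CD(2) X(2) unital_star_hom_tendsto[OF CA f X(1) lim]])
    ultimately show "l \<in> D" by (simp add: D_def)
  qed
  moreover have "D \<subseteq> clinear_ops" using AD(1) by (auto simp: D_def)
  ultimately have "cstar_algebra D"
    by (auto simp: cstar_algebra_def D_def fD(2-6) AD(3-7) CD(3-7))
  moreover have "G \<subseteq> D" using generators_subset[of G] C(2) by (auto simp: D_def A)
  ultimately have "A \<subseteq> D" unfolding A by (rule cstar_generated_subset)
  then show ?thesis using f(1) by (auto simp: unital_star_hom_def D_def)
qed

section \<open>Homomorphisms from intertwiners\<close>

text \<open>R acts on the space \<open>'b\<close> of the representation to be found, u on
  \<open>'a\<close>, and each W maps \<open>'b\<close> to \<open>'a\<close>: R is u as seen through
  W. The relation for adjoints is imposed separately because W need not be unitary.\<close>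

definition intertwines ::
    "('b::chilbert \<Rightarrow>\<^sub>L 'a::chilbert) set \<Rightarrow> ('a \<Rightarrow>\<^sub>L 'a) \<Rightarrow> ('b \<Rightarrow>\<^sub>L 'b) \<Rightarrow> bool"
  where "intertwines \<W> u R \<longleftrightarrow> u \<in> clinear_ops \<and> R \<in> clinear_ops \<and>
    (\<forall>W\<in>\<W>. W o\<^sub>L R = u o\<^sub>L W \<and> W o\<^sub>L adj R = adj u o\<^sub>L W)"

text \<open>The slack e leaves room for vectors that are only approximated by vectors on which some
  W is isometric.\<close>

definition norming :: "('b::chilbert \<Rightarrow>\<^sub>L 'a::chilbert) set \<Rightarrow> bool"
  where "norming \<W> \<longleftrightarrow> \<W> \<subseteq> clinear_ops \<and>
    (\<forall>x. \<forall>e>0. \<exists>W\<in>\<W>. norm W \<le> 1 \<and> norm x \<le> norm (blinfun_apply W x) + e)"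

lemma intertwines_apply:
  assumes "intertwines \<W> u R" "W \<in> \<W>"
  shows "W (R x) = u (W x)" "W (adj R x) = adj u (W x)"
  using assms by (auto simp: intertwines_def blinfun_eq_iff)

text \<open>|W (R x)| = |u (W x)| \<le> norm u |x|, and the W recover the norm of R x. Uniqueness of
  R and closedness of the domain both rest on this estimate.\<close>

lemma intertwines_norm_le:
  assumes "norming \<W>" "intertwines \<W> u R"
  shows "norm R \<le> norm u"
proof (rule norm_blinfun_bound)
  fix x
  show "norm (R x) \<le> norm u * norm x"
  proof (rule field_le_epsilon)
    fix e :: real assume "e > 0"
    then obtain W where W: "W \<in> \<W>" "norm W \<le> 1" "norm (R x) \<le> norm (W (R x)) + e"
      using assms(1) unfolding norming_def by blast
    have "norm (W (R x)) \<le> norm u * norm (W x)"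
      by (simp add: intertwines_apply[OF assms(2) W(1)] norm_blinfun)
    also have "norm (W x) \<le> norm x"
      using norm_blinfun[of W x] mult_right_mono[OF W(2) norm_ge_zero[of x]] by simp
    finally show "norm (R x) \<le> norm u * norm x + e" using W(3) by (simp add: mult_left_mono)
  qed
qed simp

lemma intertwines_add:
  "intertwines \<W> u R \<Longrightarrow> intertwines \<W> v S \<Longrightarrow> intertwines \<W> (u + v) (R + S)"
  by (simp add: intertwines_def blinfun_eq_iff add_clinear_ops adj_add blinfun.bilinear_simps)

lemma intertwines_diff:
  "intertwines \<W> u R \<Longrightarrow> intertwines \<W> v S \<Longrightarrow> intertwines \<W> (u - v) (R - S)"
  by (simp add: intertwines_def blinfun_eq_iff diff_clinear_ops adj_diff blinfun.bilinear_simps)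

lemma intertwines_compose:
  "intertwines \<W> u R \<Longrightarrow> intertwines \<W> v S \<Longrightarrow> intertwines \<W> (u o\<^sub>L v) (R o\<^sub>L S)"
  by (simp add: intertwines_def blinfun_eq_iff compose_clinear_ops adj_compose)

lemma intertwines_op_scaleC:
  assumes "norming \<W>" "intertwines \<W> u R"
  shows "intertwines \<W> (op_scaleC c u) (op_scaleC c R)"
proof -
  have "W (d *\<^sub>C x) = d *\<^sub>C W x" if "W \<in> \<W>" for W d x
    using that assms(1) by (auto simp: norming_def intro: clinear_ops_scaleC)
  then show ?thesis
    using assms(2)
    by (simp add: intertwines_def blinfun_eq_iff op_scaleC_clinear_ops adj_op_scaleC)
qed

lemma intertwines_adj: "intertwines \<W> u R \<Longrightarrow> intertwines \<W> (adj u) (adj R)"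
  by (auto simp: intertwines_def adj_clinear_ops adj_adj)

lemma intertwines_id: "intertwines \<W> id_blinfun id_blinfun"
  by (simp add: intertwines_def blinfun_eq_iff)

lemma intertwines_unique:
  assumes "norming \<W>" "intertwines \<W> u R" "intertwines \<W> u S"
  shows "R = S"
  using intertwines_norm_le[OF assms(1) intertwines_diff[OF assms(2,3)]] by simp

lemma intertwines_the:
  assumes "norming \<W>" "intertwines \<W> u R"
  shows "(THE R. intertwines \<W> u R) = R"
  using assms intertwines_unique by blast

text \<open>The norm estimate applied to differences makes the R Cauchy when the u converge; the
  relations then pass to the limit.\<close>

lemma intertwines_closed:
  assumes \<W>: "norming \<W>"
  shows "closed {u. \<exists>R. intertwines \<W> u R}"
  unfolding closed_sequential_limits
proof (intro allI impI, elim conjE)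
  fix X u assume "\<forall>n. X n \<in> {u. \<exists>R. intertwines \<W> u R}" and lim: "X \<longlonglongrightarrow> u"
  then obtain Y where Y: "\<And>n. intertwines \<W> (X n) (Y n)" by simp metis
  have le: "dist (Y m) (Y n) \<le> dist (X m) (X n)" for m n
    unfolding dist_norm by (intro intertwines_norm_le[OF \<W>] intertwines_diff Y)
  have "Cauchy X" using lim LIMSEQ_imp_Cauchy by blast
  then have "Cauchy Y" unfolding Cauchy_def using le by (meson le_less_trans)
  then obtain R where R: "Y \<longlonglongrightarrow> R" using Cauchy_convergent convergent_def by blast
  have XC: "X n \<in> clinear_ops" and YC: "Y n \<in> clinear_ops" for n
    using Y[of n] by (auto simp: intertwines_def)
  have uC: "u \<in> clinear_ops" and RC: "R \<in> clinear_ops"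
    using closed_clinear_ops XC YC lim R unfolding closed_sequential_limits by blast+
  have adjs: "(\<lambda>n. adj (X n)) \<longlonglongrightarrow> adj u" "(\<lambda>n. adj (Y n)) \<longlonglongrightarrow> adj R"
    by (intro tendsto_adj lim R XC YC uC RC)+
  have "W o\<^sub>L R = u o\<^sub>L W" if "W \<in> \<W>" for W
  proof (rule LIMSEQ_unique)
    show "(\<lambda>n. W o\<^sub>L Y n) \<longlonglongrightarrow> (W o\<^sub>L R)" by (intro tendsto_blinfun_compose tendsto_const R)
    have "W o\<^sub>L Y n = X n o\<^sub>L W" for n using Y[of n] that by (simp add: intertwines_def)
    then show "(\<lambda>n. W o\<^sub>L Y n) \<longlonglongrightarrow> (u o\<^sub>L W)"
      by simp (intro tendsto_blinfun_compose tendsto_const lim)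
  qed
  moreover have "W o\<^sub>L adj R = adj u o\<^sub>L W" if "W \<in> \<W>" for W
  proof (rule LIMSEQ_unique)
    show "(\<lambda>n. W o\<^sub>L adj (Y n)) \<longlonglongrightarrow> (W o\<^sub>L adj R)"
      by (intro tendsto_blinfun_compose tendsto_const adjs)
    have "W o\<^sub>L adj (Y n) = adj (X n) o\<^sub>L W" for n using Y[of n] that by (simp add: intertwines_def)
    then show "(\<lambda>n. W o\<^sub>L adj (Y n)) \<longlonglongrightarrow> (adj u o\<^sub>L W)"
      by simp (intro tendsto_blinfun_compose tendsto_const adjs)
  qed
  ultimately show "u \<in> {u. \<exists>R. intertwines \<W> u R}"
    using uC RC by (auto simp: intertwines_def)
qed

lemma intertwines_cstar_algebra:
  assumes "norming \<W>"
  shows "cstar_algebra {u. \<exists>R. intertwines \<W> u R}"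
  unfolding cstar_algebra_def
proof (intro conjI)
  show "{u. \<exists>R. intertwines \<W> u R} \<subseteq> clinear_ops" by (auto simp: intertwines_def)
  show "closed {u. \<exists>R. intertwines \<W> u R}" by (rule intertwines_closed[OF assms])
qed (blast intro: intertwines_id intertwines_add intertwines_compose
       intertwines_op_scaleC[OF assms] intertwines_adj)+

text \<open>By uniqueness, any R found for a sum, a product, a scalar multiple or an adjoint is the
  one selected by \<open>THE\<close>.\<close>

lemma intertwines_hom:
  assumes "norming \<W>"
  shows "unital_star_hom {u. \<exists>R. intertwines \<W> u R} clinear_ops (\<lambda>u. THE R. intertwines \<W> u R)"
  unfolding unital_star_hom_def
  by (auto simp: intertwines_the[OF assms] intro!: intertwines_the[OF assms] intertwines_id
      intertwines_add intertwines_compose intertwines_op_scaleC[OF assms] intertwines_adj)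
     (simp add: intertwines_def)

section \<open>Operators on square-summable families\<close>

lemma ell2_eqI: "(\<And>i. ell2_apply f i = ell2_apply g i) \<Longrightarrow> f = g"
  by (metis ell2_apply_inject ext)

lemma ell2_apply_sum: "ell2_apply (sum f A) i = (\<Sum>a\<in>A. ell2_apply (f a) i)"
  by (induction A rule: infinite_finite_induct) (simp_all add: plus_ell2.rep_eq zero_ell2.rep_eq)

text \<open>A partial injection and its inverse, with \<open>None\<close> outside the domain. Shifts
  of sequences, block inclusions and block projections are all of this kind, so one computation of
  adjoints serves them all.\<close>

definition partial_inverse :: "('i \<Rightarrow> 'j option) \<Rightarrow> ('j \<Rightarrow> 'i option) \<Rightarrow> bool"
  where "partial_inverse p q \<longleftrightarrow> (\<forall>i j. p i = Some j \<longleftrightarrow> q j = Some i)"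

lemma partial_inverse_sym: "partial_inverse p q \<Longrightarrow> partial_inverse q p"
  by (auto simp: partial_inverse_def)

text \<open>Both sums run over the graph of p, whose coordinate projections are injective; the value
  0 at \<open>None\<close> lets them be written over \<open>UNIV\<close>.\<close>

lemma has_sum_partial_inverse:
  assumes "partial_inverse p q"
  shows "((\<lambda>i. case p i of None \<Rightarrow> 0 | Some j \<Rightarrow> g i j) has_sum s) UNIV \<longleftrightarrow>
    ((\<lambda>j. case q j of None \<Rightarrow> 0 | Some i \<Rightarrow> g i j) has_sum s) UNIV"
proof -
  define P where "P = {i. p i \<noteq> None}"
  define Q where "Q = {j. q j \<noteq> None}"
  have pP: "p i = Some (the (p i))" "q (the (p i)) = Some i" if i: "i \<in> P" for i
  proof -
    obtain j where "p i = Some j" using i by (auto simp: P_def)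
    moreover from this have "q j = Some i" using assms by (simp add: partial_inverse_def)
    ultimately show "p i = Some (the (p i))" "q (the (p i)) = Some i" by simp_all
  qed
  have qQ: "q j = Some (the (q j))" "p (the (q j)) = Some j" if j: "j \<in> Q" for j
  proof -
    obtain i where "q j = Some i" using j by (auto simp: Q_def)
    moreover from this have "p i = Some j" using assms by (simp add: partial_inverse_def)
    ultimately show "q j = Some (the (q j))" "p (the (q j)) = Some j" by simp_all
  qed
  have bij: "bij_betw (\<lambda>i. the (p i)) P Q"
  proof (rule bij_betwI[where g = "\<lambda>j. the (q j)"])
    show "(\<lambda>i. the (p i)) \<in> P \<rightarrow> Q" using pP(2) by (auto simp: Q_def)
    show "(\<lambda>j. the (q j)) \<in> Q \<rightarrow> P" using qQ(2) by (auto simp: P_def)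
  qed (simp_all add: pP(2) qQ(2))
  have "((\<lambda>i. case p i of None \<Rightarrow> 0 | Some j \<Rightarrow> g i j) has_sum s) UNIV \<longleftrightarrow>
      ((\<lambda>i. g (the (q (the (p i)))) (the (p i))) has_sum s) P"
  proof (rule has_sum_cong_neutral)
    show "(case p i of None \<Rightarrow> 0 | Some j \<Rightarrow> g i j) = g (the (q (the (p i)))) (the (p i))"
      if "i \<in> UNIV \<inter> P" for i
    proof -
      have "i \<in> P" using that by simp
      then show ?thesis by (subst pP(1)) (simp_all add: pP(2))
    qed
  qed (auto simp: P_def)
  also have "\<dots> \<longleftrightarrow> ((\<lambda>j. g (the (q j)) j) has_sum s) Q"
    by (rule has_sum_reindex_bij_betw[OF bij])
  also have "\<dots> \<longleftrightarrow> ((\<lambda>j. case q j of None \<Rightarrow> 0 | Some i \<Rightarrow> g i j) has_sum s) UNIV"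
    by (rule has_sum_cong_neutral) (auto simp: Q_def)
  finally show ?thesis .
qed

text \<open>Composition with p, set to 0 where p is undefined. For a partial injection p this is a
  partial isometry, whose adjoint is composition with the inverse.\<close>

definition pull :: "('i \<Rightarrow> 'j option) \<Rightarrow> 'j ell2 \<Rightarrow>\<^sub>L 'i ell2"
  where "pull p = Blinfun (\<lambda>f. Abs_ell2 (\<lambda>i. case p i of None \<Rightarrow> 0 | Some j \<Rightarrow> ell2_apply f j))"

lemma
  assumes pq: "partial_inverse p q"
  shows pull_apply: "ell2_apply (blinfun_apply (pull p) f) i = (case p i of None \<Rightarrow> 0 | Some j \<Rightarrow> ell2_apply f j)"
    and norm_pull_le: "norm (pull p) \<le> 1"
proof -
  define F where "F f = Abs_ell2 (\<lambda>i. case p i of None \<Rightarrow> 0 | Some j \<Rightarrow> ell2_apply f j)" for f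
  have eq: "(cmod (case p i of None \<Rightarrow> 0 | Some j \<Rightarrow> ell2_apply f j))\<^sup>2
      = (case p i of None \<Rightarrow> 0 | Some j \<Rightarrow> (cmod (ell2_apply f j))\<^sup>2)" for f i
    by (simp split: option.split)
  have summ: "(\<lambda>j. case q j of None \<Rightarrow> 0 | Some i \<Rightarrow> (cmod (ell2_apply f j))\<^sup>2) summable_on UNIV" for f
    by (rule summable_on_comparison_test[OF ell2_apply_summable[of f]]) (auto split: option.split)
  have hs: "((\<lambda>i. (cmod (case p i of None \<Rightarrow> 0 | Some j \<Rightarrow> ell2_apply f j))\<^sup>2) has_sum
      (\<Sum>\<^sub>\<infinity>j. case q j of None \<Rightarrow> 0 | Some i \<Rightarrow> (cmod (ell2_apply f j))\<^sup>2)) UNIV" for f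
    unfolding eq has_sum_partial_inverse[OF pq] by (rule has_sum_infsum[OF summ])
  then have F: "ell2_apply (F f) i = (case p i of None \<Rightarrow> 0 | Some j \<Rightarrow> ell2_apply f j)" for f i
    unfolding F_def by (subst Abs_ell2_inverse) (auto simp: summable_on_def)
  have norm: "norm (F f) \<le> norm f" for f
  proof -
    have "(norm (F f))\<^sup>2 = (\<Sum>\<^sub>\<infinity>j. case q j of None \<Rightarrow> 0 | Some i \<Rightarrow> (cmod (ell2_apply f j))\<^sup>2)"
      unfolding power2_norm_ell2 F by (rule infsumI[OF hs])
    also have "\<dots> \<le> (norm f)\<^sup>2"
      unfolding power2_norm_ell2
      by (intro infsum_mono summ ell2_apply_summable) (auto split: option.split)
    finally show ?thesis using power2_le_imp_le by force
  qed
  have "bounded_linear F"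
  proof (rule bounded_linear_intro[where K = 1])
    show "F (f + g) = F f + F g" for f g
      by (rule ell2_eqI) (simp add: F plus_ell2.rep_eq split: option.split)
    show "F (r *\<^sub>R f) = r *\<^sub>R F f" for r f
      by (rule ell2_eqI) (simp add: F scaleR_ell2.rep_eq split: option.split)
  qed (simp add: norm)
  then have app: "blinfun_apply (pull p) = F"
    unfolding pull_def F_def by (rule bounded_linear_Blinfun_apply)
  show "ell2_apply (blinfun_apply (pull p) f) i = (case p i of None \<Rightarrow> 0 | Some j \<Rightarrow> ell2_apply f j)"
    by (simp add: app F)
  show "norm (pull p) \<le> 1" by (rule norm_blinfun_bound) (simp_all add: app norm)
qed

lemma pull_clinear_ops: "partial_inverse p q \<Longrightarrow> pull p \<in> clinear_ops"
  unfolding clinear_ops_def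
  by (auto intro!: ell2_eqI simp: pull_apply scaleC_ell2.rep_eq split: option.split)

lemma adj_pull:
  fixes p :: "'i \<Rightarrow> 'j option"
  assumes pq: "partial_inverse p q"
  shows "adj (pull p) = pull q"
proof (rule adj_eqI)
  fix f :: "'j ell2" and g :: "'i ell2"
  note qp = partial_inverse_sym[OF pq]
  let ?h = "\<lambda>i j. cnj (ell2_apply g i) * ell2_apply f j"
  have "((\<lambda>i. cnj (ell2_apply g i) * ell2_apply (pull p f) i) has_sum cinner g (pull p f)) UNIV"
    unfolding cinner_ell2_def by (rule has_sum_infsum[OF ell2_mult_summable'])
  moreover have "cnj (ell2_apply g i) * ell2_apply (pull p f) i
      = (case p i of None \<Rightarrow> 0 | Some j \<Rightarrow> ?h i j)" for i
    by (simp add: pull_apply[OF pq] split: option.split)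
  ultimately have "((\<lambda>j. case q j of None \<Rightarrow> 0 | Some i \<Rightarrow> ?h i j) has_sum cinner g (pull p f)) UNIV"
    by (simp add: has_sum_partial_inverse[OF pq])
  from infsumI[OF this] have "cinner g (pull p f) = (\<Sum>\<^sub>\<infinity>j. case q j of None \<Rightarrow> 0 | Some i \<Rightarrow> ?h i j)"
    by simp
  also have "\<dots> = cinner (pull q g) f"
    unfolding cinner_ell2_def by (intro infsum_cong) (simp add: pull_apply[OF qp] split: option.split)
  finally show "cinner (pull q g) f = cinner g (pull p f)" ..
qed

section \<open>Cuntz families, with an example on square-summable sequences\<close>

lemma cuntz_family_apply:
  assumes "cuntz_family N s" "i \<in> {1..N}" "j \<in> {1..N}"
  shows "adj (s i) (s j x) = (if i = j then x else 0)"
proof -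
  have "adj (s i) o\<^sub>L s j = (if i = j then id_blinfun else 0)"
    using assms by (simp add: cuntz_family_def)
  then show ?thesis by (auto simp: blinfun_eq_iff split: if_splits)
qed

lemma cuntz_family_clinear_ops: "cuntz_family N s \<Longrightarrow> i \<in> {1..N} \<Longrightarrow> s i \<in> clinear_ops"
  by (simp add: cuntz_family_def)

lemma cuntz_family_sum:
  assumes "cuntz_family N s"
  shows "(\<Sum>i=1..N. s i (adj (s i) x)) = x"
proof -
  have "(\<Sum>i=1..N. s i o\<^sub>L adj (s i)) x = id_blinfun x" using assms by (simp add: cuntz_family_def)
  then show ?thesis by (simp add: blinfun.sum_left)
qed

lemma cuntz_familyI:
  assumes "\<And>i. i \<in> {1..N} \<Longrightarrow> s i \<in> clinear_ops"
    and "\<And>i j x. i \<in> {1..N} \<Longrightarrow> j \<in> {1..N} \<Longrightarrow> adj (s i) (s j x) = (if i = j then x else 0)"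
    and "\<And>x. (\<Sum>i=1..N. s i (adj (s i) x)) = x"
  shows "cuntz_family N s"
  unfolding cuntz_family_def using assms by (auto intro!: blinfun_eqI simp: blinfun.sum_left)

lemma cuntz_family_norm:
  assumes "cuntz_family N s" "i \<in> {1..N}"
  shows "norm (s i x) = norm x"
proof -
  have "cinner (s i x) (s i x) = cinner x x"
    using cinner_adj_right[OF cuntz_family_clinear_ops[OF assms], of x "s i x"]
    by (simp add: cuntz_family_apply[OF assms(1,2,2)])
  then show ?thesis by (simp add: cinner_self flip: of_real_power)
qed

lemma cuntz_family_norm_le:
  assumes "cuntz_family N s" "i \<in> {1..N}"
  shows "norm (s i) \<le> 1"
  by (rule norm_blinfun_bound) (simp_all add: cuntz_family_norm[OF assms])

text \<open>On unit sequences, s_i sends e_n to e_(N n + i - 1): the ranges belong to the residue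
  classes mod N, which partition the naturals. The example gives meaning to the default family in
  \<open>cuntz_block\<close>.\<close>

lemma ex_cuntz_family:
  assumes "1 \<le> N"
  shows "\<exists>s :: nat \<Rightarrow> (nat ell2 \<Rightarrow>\<^sub>L nat ell2). cuntz_family N s"
proof -
  define p where "p i m = (if m mod N = i - 1 then Some (m div N) else None)" for i m
  define q where "q i n = Some (N * n + (i - 1))" for i n
  have pq: "partial_inverse (p i) (q i)" if "i \<in> {1..N}" for i
  proof -
    from that obtain k where "i = Suc k" "k < N" by (cases i) auto
    moreover have "(N * j + k) mod N = k" "(N * j + k) div N = j" for j using \<open>k < N\<close> by simp_all
    then have "m mod N = k \<and> m div N = j \<longleftrightarrow> N * j + k = m" for m j by force
    ultimately show ?thesis by (auto simp: partial_inverse_def p_def q_def)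
  qed
  have adj: "adj (pull (p i)) = pull (q i)" if "i \<in> {1..N}" for i by (rule adj_pull[OF pq[OF that]])
  have P: "ell2_apply (pull (p i) f) m = (if m mod N = i - 1 then ell2_apply f (m div N) else 0)"
    if "i \<in> {1..N}" for i f m by (simp add: pull_apply[OF pq[OF that]] p_def)
  have Q: "ell2_apply (pull (q i) f) n = ell2_apply f (N * n + (i - 1))"
    if "i \<in> {1..N}" for i f n
    by (simp add: pull_apply[OF partial_inverse_sym[OF pq[OF that]]] q_def)
  have "cuntz_family N (\<lambda>i. pull (p i))"
  proof (rule cuntz_familyI)
    show "pull (p i) \<in> clinear_ops" if "i \<in> {1..N}" for i by (rule pull_clinear_ops[OF pq[OF that]])
    show "adj (pull (p i)) (pull (p j) f) = (if i = j then f else 0)"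
      if "i \<in> {1..N}" "j \<in> {1..N}" for i j f
    proof -
      from that obtain k l where "i = Suc k" "k < N" "j = Suc l" "l < N" by (cases i; cases j) auto
      then show ?thesis
        using that by (intro ell2_eqI) (auto simp: adj P Q zero_ell2.rep_eq)
    qed
    show "(\<Sum>i=1..N. pull (p i) (adj (pull (p i)) f)) = f" for f
    proof (rule ell2_eqI)
      fix m
      \<comment> \<open>Only the index i with i - 1 = m mod N contributes at position m.\<close>
      have "ell2_apply (\<Sum>i=1..N. pull (p i) (adj (pull (p i)) f)) m
          = (\<Sum>i=1..N. if i = Suc (m mod N) then ell2_apply f m else 0)"
        unfolding ell2_apply_sum by (intro sum.cong refl) (auto simp: adj P Q)
      also have "\<dots> = ell2_apply f m" using assms by (simp add: Suc_le_eq)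
      finally show "ell2_apply (\<Sum>i=1..N. pull (p i) (adj (pull (p i)) f)) m = ell2_apply f m" .
    qed
  qed
  then show ?thesis by blast
qed

section \<open>Blocks of a direct sum of copies of one sequence space\<close>

definition slice :: "'s \<Rightarrow> ('s \<times> 'i) ell2 \<Rightarrow>\<^sub>L 'i ell2"
  where "slice s = pull (\<lambda>i. Some (s, i))"

definition incl :: "'s \<Rightarrow> 'i ell2 \<Rightarrow>\<^sub>L ('s \<times> 'i) ell2"
  where "incl s = pull (\<lambda>(t, i). if t = s then Some i else None)"

lemma partial_inverse_slice:
  "partial_inverse (\<lambda>i. Some (s, i)) (\<lambda>(t, i). if t = s then Some i else None)"
  by (auto simp: partial_inverse_def)

lemma slice_apply: "ell2_apply (slice s f) i = ell2_apply f (s, i)"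
  unfolding slice_def by (simp add: pull_apply[OF partial_inverse_slice])

lemma slice_clinear_ops: "slice s \<in> clinear_ops"
  unfolding slice_def by (rule pull_clinear_ops[OF partial_inverse_slice])

lemma incl_clinear_ops: "incl s \<in> clinear_ops"
  unfolding incl_def by (rule pull_clinear_ops[OF partial_inverse_sym[OF partial_inverse_slice]])

lemma norm_incl_le: "norm (incl s) \<le> 1"
  unfolding incl_def by (rule norm_pull_le[OF partial_inverse_sym[OF partial_inverse_slice]])

lemma adj_incl: "adj (incl s) = slice s"
  unfolding incl_def slice_def by (rule adj_pull[OF partial_inverse_sym[OF partial_inverse_slice]])

lemma slice_incl: "slice t (incl s f) = (if t = s then f else 0)"
  by (rule ell2_eqI)
     (simp add: slice_apply zero_ell2.rep_eq incl_def
       pull_apply[OF partial_inverse_sym[OF partial_inverse_slice]])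

lemma slice_eqI:
  assumes "\<And>s. slice s f = slice s g"
  shows "f = g"
proof (rule ell2_eqI)
  fix p show "ell2_apply f p = ell2_apply g p"
    using assms[of "fst p"] slice_apply[of "fst p" f "snd p"] slice_apply[of "fst p" g "snd p"] by simp
qed

lemma norm_slice_sum:
  shows "(\<lambda>s. (norm (slice s f))\<^sup>2) summable_on UNIV"
    and "(\<Sum>\<^sub>\<infinity>s. (norm (slice s f))\<^sup>2) = (norm f)\<^sup>2"
proof -
  have "(\<lambda>p. (cmod (ell2_apply f p))\<^sup>2) summable_on (SIGMA s:UNIV. UNIV)"
    using ell2_apply_summable[of f UNIV] by simp
  then have summ: "(\<lambda>(s, i). (cmod (ell2_apply f (s, i)))\<^sup>2) summable_on (SIGMA s:UNIV. UNIV)"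
    by (simp add: case_prod_unfold)
  have *: "(norm (slice s f))\<^sup>2 = (\<Sum>\<^sub>\<infinity>i. (cmod (ell2_apply f (s, i)))\<^sup>2)" for s
    by (simp add: power2_norm_ell2 slice_apply)
  show "(\<lambda>s. (norm (slice s f))\<^sup>2) summable_on UNIV"
    unfolding * using summable_on_Sigma_banach[OF summ] .
  show "(\<Sum>\<^sub>\<infinity>s. (norm (slice s f))\<^sup>2) = (norm f)\<^sup>2"
    unfolding * using infsum_Sigma'_banach[OF summ] by (simp add: power2_norm_ell2 case_prod_unfold)
qed

lemma cinner_slice_sum: "cinner f g = (\<Sum>\<^sub>\<infinity>s. cinner (slice s f) (slice s g))"
proof -
  have "(\<lambda>p. cnj (ell2_apply f p) * ell2_apply g p) summable_on (SIGMA s:UNIV. UNIV)"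
    using ell2_mult_summable'[of f g] by simp
  then have "(\<lambda>(s, i). cnj (ell2_apply f (s, i)) * ell2_apply g (s, i)) summable_on (SIGMA s:UNIV. UNIV)"
    by (simp add: case_prod_unfold)
  from infsum_Sigma'_banach[OF this] show ?thesis
    by (simp add: cinner_ell2_def slice_apply case_prod_unfold)
qed

text \<open>The uniform bound makes the blockwise images square-summable, so the
  \<open>Abs_ell2\<close> and \<open>Blinfun\<close> of the definition describe an actual vector and
  an actual operator. By \<open>slice_eqI\<close> this equation determines the operator.\<close>

lemma
  fixes T :: "'s \<Rightarrow> ('i ell2 \<Rightarrow>\<^sub>L 'i ell2)"
  assumes T: "\<And>s. norm (T s) \<le> 1"
  shows slice_block_diagonal: "slice s (block_diagonal T f) = T s (slice s f)"
proof -
  define F where "F f = Abs_ell2 (\<lambda>(s, i). ell2_apply (T s (slice s f)) i)" for f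
  \<comment> \<open>The inner \<open>Abs_ell2\<close> in the definition of
    \<open>block_diagonal\<close> is \<open>slice\<close>.\<close>
  have sl: "Abs_ell2 (\<lambda>j. ell2_apply f (s, j)) = slice s f" for f :: "('s \<times> 'i) ell2" and s
    by (simp add: slice_apply [symmetric] ell2_apply_inverse)
  have le: "norm (T s g) \<le> norm g" for s g
    using norm_blinfun[of "T s" g] mult_right_mono[OF T[of s] norm_ge_zero[of g]] by simp
  have hs: "((\<lambda>i. (cmod (ell2_apply g i))\<^sup>2) has_sum (norm g)\<^sup>2) UNIV" for g :: "'i ell2"
    unfolding power2_norm_ell2 by (rule has_sum_infsum[OF ell2_apply_summable])
  have "(\<lambda>p. (cmod (case p of (s, i) \<Rightarrow> ell2_apply (T s (slice s f)) i))\<^sup>2) summable_on (SIGMA s:UNIV. UNIV)" for f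
  proof (rule summable_on_SigmaI)
    show "((\<lambda>i. (cmod (case (s, i) of (s, i) \<Rightarrow> ell2_apply (T s (slice s f)) i))\<^sup>2) has_sum
        (norm (T s (slice s f)))\<^sup>2) UNIV" for s
      using hs by simp
    show "(\<lambda>s. (norm (T s (slice s f)))\<^sup>2) summable_on UNIV"
      by (rule summable_on_comparison_test[OF norm_slice_sum(1)[of f]]) (auto intro: power_mono le)
  qed simp
  then have Fapp: "ell2_apply (F f) (s, i) = ell2_apply (T s (slice s f)) i" for f s i
    unfolding F_def by (subst Abs_ell2_inverse) (simp_all del: split_def)
  have F: "slice s (F f) = T s (slice s f)" for f s
    by (rule ell2_eqI) (simp add: slice_apply Fapp)
  have norm: "norm (F f) \<le> norm f" for f
  proof -
    have "(norm (F f))\<^sup>2 \<le> (norm f)\<^sup>2"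
      unfolding norm_slice_sum(2) [symmetric]
      by (intro infsum_mono norm_slice_sum(1)) (auto simp: F intro: power_mono le)
    then show ?thesis using power2_le_imp_le by force
  qed
  have "bounded_linear F"
  proof (rule bounded_linear_intro[where K = 1])
    show "F (f + g) = F f + F g" for f g
      by (rule slice_eqI) (simp add: F blinfun.bilinear_simps)
    show "F (r *\<^sub>R f) = r *\<^sub>R F f" for r f
      by (rule slice_eqI) (simp add: F blinfun.bilinear_simps)
  qed (simp add: norm)
  then have "blinfun_apply (block_diagonal T) = F"
    unfolding block_diagonal_def sl F_def [symmetric]
    using bounded_linear_Blinfun_apply[of F] by (simp add: F_def [abs_def])
  then show "slice s (block_diagonal T f) = T s (slice s f)" by (simp add: F)
qed

lemma block_diagonal_clinear_ops:
  assumes "\<And>s. norm (T s) \<le> 1" "\<And>s. T s \<in> clinear_ops"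
  shows "block_diagonal T \<in> clinear_ops"
  unfolding clinear_ops_def
  by (intro CollectI allI slice_eqI)
     (simp add: slice_block_diagonal assms clinear_ops_scaleC[OF slice_clinear_ops] clinear_ops_scaleC)

lemma adj_block_diagonal:
  assumes "\<And>s. norm (T s) \<le> 1" "\<And>s. T s \<in> clinear_ops"
  shows "adj (block_diagonal T) = block_diagonal (\<lambda>s. adj (T s))"
proof (rule adj_eqI)
  fix f g
  have "norm (adj (T s)) \<le> 1" for s using norm_adj_le[OF assms(2)] assms(1) order_trans by blast
  then show "cinner (block_diagonal (\<lambda>s. adj (T s)) g) f = cinner g (block_diagonal T f)"
    by (simp add: cinner_slice_sum[of _ f] cinner_slice_sum[of g] slice_block_diagonal assms
        cinner_adj_left)
qed

section \<open>The canonical generators on \<open>cuntz_space\<close>\<close>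

lemma cuntz_family_cuntz_block:
  assumes "1 \<le> N"
  shows "cuntz_family N (cuntz_block N s)"
  using someI_ex[OF ex_cuntz_family[OF assms]] by (simp add: cuntz_block_def)

lemma
  assumes i: "i \<in> {1..N}"
  shows slice_cuntz_gen: "slice s (cuntz_gen N i f) = cuntz_block N s i (slice s f)"
    and slice_adj_cuntz_gen: "slice s (adj (cuntz_gen N i) f) = adj (cuntz_block N s i) (slice s f)"
    and cuntz_gen_clinear_ops: "cuntz_gen N i \<in> clinear_ops"
proof -
  have "1 \<le> N" using i by auto
  note cb = cuntz_family_cuntz_block[OF this]
  have n: "norm (cuntz_block N s i) \<le> 1" for s by (rule cuntz_family_norm_le[OF cb i])
  have c: "cuntz_block N s i \<in> clinear_ops" for s by (rule cuntz_family_clinear_ops[OF cb i])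
  have na: "norm (adj (cuntz_block N s i)) \<le> 1" for s using norm_adj_le[OF c] n order_trans by blast
  show "slice s (cuntz_gen N i f) = cuntz_block N s i (slice s f)"
    unfolding cuntz_gen_def by (rule slice_block_diagonal[OF n])
  show "cuntz_gen N i \<in> clinear_ops"
    unfolding cuntz_gen_def by (rule block_diagonal_clinear_ops[OF n c])
  show "slice s (adj (cuntz_gen N i) f) = adj (cuntz_block N s i) (slice s f)"
    unfolding cuntz_gen_def adj_block_diagonal[OF n c] by (rule slice_block_diagonal[OF na])
qed

text \<open>The relations hold block by block, because labels that are not Cuntz families carry one
  by default.\<close>

lemma cuntz_family_cuntz_gen:
  assumes "1 \<le> N"
  shows "cuntz_family N (cuntz_gen N)"
proof (rule cuntz_familyI)
  note cb = cuntz_family_cuntz_block[OF assms]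
  show "cuntz_gen N i \<in> clinear_ops" if "i \<in> {1..N}" for i by (rule cuntz_gen_clinear_ops[OF that])
  show "adj (cuntz_gen N i) (cuntz_gen N j f) = (if i = j then f else 0)"
    if "i \<in> {1..N}" "j \<in> {1..N}" for i j f
    using that
    by (intro slice_eqI)
       (simp add: slice_cuntz_gen slice_adj_cuntz_gen cuntz_family_apply[OF cb that])
  show "(\<Sum>i=1..N. cuntz_gen N i (adj (cuntz_gen N i) f)) = f" for f
  proof (rule slice_eqI)
    fix s
    have "slice s (\<Sum>i=1..N. cuntz_gen N i (adj (cuntz_gen N i) f))
        = (\<Sum>i=1..N. cuntz_block N s i (adj (cuntz_block N s i) (slice s f)))"
      unfolding blinfun.sum_right by (intro sum.cong) (simp_all add: slice_cuntz_gen slice_adj_cuntz_gen)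
    then show "slice s (\<Sum>i=1..N. cuntz_gen N i (adj (cuntz_gen N i) f)) = slice s f"
      by (simp only: cuntz_family_sum[OF cb])
  qed
qed

text \<open>A Cuntz family on \<open>nat ell2\<close> is the label of its own block, so entering
  that block turns the family into the canonical generators. This is what the sum over all families
  is for.\<close>

lemma incl_cuntz_gen:
  assumes "i \<in> {1..N}" "cuntz_family N s"
  shows "incl s (s i f) = cuntz_gen N i (incl s f)"
    and "incl s (adj (s i) f) = adj (cuntz_gen N i) (incl s f)"
  using assms
  by (auto intro!: slice_eqI simp: slice_cuntz_gen slice_adj_cuntz_gen slice_incl cuntz_block_def)

section \<open>Separable reducing subspaces\<close>

text \<open>M is given as the double orthogonal complement of some D, which encodes a closed complex
  subspace without closures or projections. For an adjoint-closed set of operators, invariance of M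
  also gives invariance of its complement.\<close>

definition reducing_on :: "('a::chilbert \<Rightarrow>\<^sub>L 'a) set \<Rightarrow> 'a set \<Rightarrow> bool"
  where "reducing_on \<S> M \<longleftrightarrow> (\<exists>D. M = {x. \<forall>y. (\<forall>d\<in>D. cinner d y = 0) \<longrightarrow> cinner y x = 0}) \<and>
    (\<forall>T\<in>\<S>. \<forall>x\<in>M. T x \<in> M)"

lemma reducing_on_add: "reducing_on \<S> M \<Longrightarrow> x \<in> M \<Longrightarrow> y \<in> M \<Longrightarrow> x + y \<in> M"
  by (auto simp: reducing_on_def cinner_add_right)

lemma reducing_on_diff: "reducing_on \<S> M \<Longrightarrow> x \<in> M \<Longrightarrow> y \<in> M \<Longrightarrow> x - y \<in> M"
  by (auto simp: reducing_on_def cinner_diff_right)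

lemma reducing_on_scaleC: "reducing_on \<S> M \<Longrightarrow> x \<in> M \<Longrightarrow> c *\<^sub>C x \<in> M"
  by (auto simp: reducing_on_def cinner_scaleC_right)

lemma reducing_on_zero: "reducing_on \<S> M \<Longrightarrow> 0 \<in> M"
  by (auto simp: reducing_on_def)

lemma reducing_on_sum: "reducing_on \<S> M \<Longrightarrow> (\<And>i. i \<in> A \<Longrightarrow> f i \<in> M) \<Longrightarrow> sum f A \<in> M"
  by (induction A rule: infinite_finite_induct) (auto intro: reducing_on_add reducing_on_zero)

text \<open>A vector orthogonal to D is orthogonal to M, so D may be replaced by M in the double
  complement.\<close>

lemma reducing_on_bipolar:
  assumes "reducing_on \<S> M" "\<And>y. (\<And>m. m \<in> M \<Longrightarrow> cinner m y = 0) \<Longrightarrow> cinner y x = 0"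
  shows "x \<in> M"
proof -
  obtain D where M: "M = {x. \<forall>y. (\<forall>d\<in>D. cinner d y = 0) \<longrightarrow> cinner y x = 0}"
    using assms(1) by (auto simp: reducing_on_def)
  have "cinner y x = 0" if "\<forall>d\<in>D. cinner d y = 0" for y
  proof (rule assms(2))
    fix m assume "m \<in> M"
    then have "cinner y m = 0" using that by (simp add: M)
    then show "cinner m y = 0" by (rule cinner_zero_sym)
  qed
  then show ?thesis by (simp add: M)
qed

definition onb_of :: "'a::chilbert set \<Rightarrow> 'a set \<Rightarrow> bool"
  where "onb_of M B \<longleftrightarrow> orthonormal B \<and> B \<subseteq> M \<and> (\<forall>x\<in>M. (\<forall>b\<in>B. cinner b x = 0) \<longrightarrow> x = 0)"

lemma ex_onb_of:
  assumes M: "reducing_on \<S> M"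
  shows "\<exists>B. onb_of M B"
proof -
  let ?O = "{B. orthonormal B \<and> B \<subseteq> M}"
  have "\<exists>B\<in>?O. \<forall>X\<in>?O. B \<subseteq> X \<longrightarrow> X = B"
  proof (rule subset_Zorn_nonempty)
    have "{} \<in> ?O" by (simp add: orthonormal_def)
    then show "?O \<noteq> {}" by blast
    fix C assume C: "subset.chain ?O C"
    have "cinner e f = (if e = f then 1 else 0)" if "e \<in> X" "X \<in> C" "f \<in> Y" "Y \<in> C" for e f X Y
    proof -
      have "X \<subseteq> Y \<or> Y \<subseteq> X" "orthonormal X" "orthonormal Y"
        using C that by (auto simp: subset_chain_def)
      then show ?thesis using that unfolding orthonormal_def by blast
    qed
    moreover have "\<Union> C \<subseteq> M" using C by (auto simp: subset_chain_def)
    ultimately show "\<Union> C \<in> ?O" by (auto simp: orthonormal_def)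
  qed
  then obtain B where B: "orthonormal B" "B \<subseteq> M"
    and max: "\<And>X. orthonormal X \<Longrightarrow> X \<subseteq> M \<Longrightarrow> B \<subseteq> X \<Longrightarrow> X = B" by auto
  have "x = 0" if x: "x \<in> M" "\<forall>e\<in>B. cinner e x = 0" for x
  proof (rule ccontr)
    assume "x \<noteq> 0"
    define u where "u = complex_of_real (inverse (norm x)) *\<^sub>C x"
    have u: "cinner u u = 1"
      using \<open>x \<noteq> 0\<close> by (simp add: cinner_self u_def norm_scaleC norm_inverse)
    have uM: "u \<in> M" unfolding u_def by (rule reducing_on_scaleC[OF M x(1)])
    have eu: "cinner e u = 0" if "e \<in> B" for e
      using x(2) that by (simp add: u_def cinner_scaleC_right)
    have ue: "cinner u e = 0" if "e \<in> B" for e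
      using eu[OF that] cinner_commute[of u e] by simp
    have "orthonormal (insert u B)"
      using B(1) u eu ue by (auto simp: orthonormal_def)
    then have "insert u B = B" using B(2) uM by (intro max) auto
    then have "u \<in> B" by blast
    then show False using eu u by fastforce
  qed
  then show ?thesis using B unfolding onb_of_def by blast
qed

text \<open>M is the closed span of all words in the operators applied to vectors of F. Such words
  are countable in number, and by Bessel's inequality each word vector meets only countably many
  basis vectors.\<close>

lemma ex_separable_reducing:
  fixes \<S> :: "('a::chilbert \<Rightarrow>\<^sub>L 'a) set"
  assumes \<S>: "countable \<S>" "\<S> \<subseteq> clinear_ops" "\<And>T. T \<in> \<S> \<Longrightarrow> adj T \<in> \<S>" and F: "countable F"
  shows "\<exists>M B. reducing_on \<S> M \<and> F \<subseteq> M \<and> onb_of M B \<and> countable B"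
proof -
  define D where "D = (\<lambda>(w, x). foldr blinfun_apply w x) ` (lists \<S> \<times> F)"
  have D: "countable D" unfolding D_def using \<S>(1) F by (intro countable_image countable_SIGMA) auto
  have FD: "x \<in> D" if "x \<in> F" for x
    unfolding D_def using that by (intro image_eqI[where x = "([], x)"]) auto
  have \<S>D: "T d \<in> D" if "T \<in> \<S>" "d \<in> D" for T d
  proof -
    from that(2) obtain w x where "w \<in> lists \<S>" "x \<in> F" "d = foldr blinfun_apply w x"
      by (auto simp: D_def)
    then show ?thesis
      unfolding D_def using that(1) by (intro image_eqI[where x = "(T # w, x)"]) auto
  qed
  define M where "M = {x. \<forall>y. (\<forall>d\<in>D. cinner d y = 0) \<longrightarrow> cinner y x = 0}"
  have DM: "D \<subseteq> M" unfolding M_def using cinner_zero_sym by blast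
  \<comment> \<open>T maps D into D, so \<open>adj T\<close> preserves orthogonality to D; moving T
    to the other side then shows that T x is orthogonal to every such y.\<close>
  have "T x \<in> M" if T: "T \<in> \<S>" and x: "x \<in> M" for T x
    unfolding M_def
  proof (intro CollectI allI impI)
    fix y assume y: "\<forall>d\<in>D. cinner d y = 0"
    have TC: "T \<in> clinear_ops" using T \<S>(2) by blast
    have "cinner d (adj T y) = 0" if "d \<in> D" for d
      using y \<S>D[OF T that] by (simp add: cinner_adj_right[OF TC])
    then have "cinner (adj T y) x = 0" using x by (simp add: M_def)
    then show "cinner y (T x) = 0" by (simp add: cinner_adj_left[OF TC])
  qed
  then have M: "reducing_on \<S> M" unfolding reducing_on_def M_def by blast
  then obtain B where B: "onb_of M B" using ex_onb_of by blast
  have "countable {b \<in> B. cinner b d \<noteq> 0}" for d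
  proof -
    have "(\<lambda>b. (cmod (cinner b d))\<^sup>2) summable_on B"
      using B by (intro bessel_summable) (simp add: onb_of_def)
    then have "countable {b \<in> B. (cmod (cinner b d))\<^sup>2 \<noteq> 0}"
      by (intro summable_countable_real)
    then show ?thesis by simp
  qed
  \<comment> \<open>A basis vector orthogonal to all of D would be orthogonal to M, hence to
    itself.\<close>
  moreover have "B \<subseteq> (\<Union>d\<in>D. {b \<in> B. cinner b d \<noteq> 0})"
  proof
    fix b assume b: "b \<in> B"
    have "\<exists>d\<in>D. cinner b d \<noteq> 0"
    proof (rule ccontr)
      assume "\<not> (\<exists>d\<in>D. cinner b d \<noteq> 0)"
      then have "\<forall>d\<in>D. cinner d b = 0" using cinner_zero_sym by blast
      moreover have "b \<in> M" using b B by (auto simp: onb_of_def)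
      ultimately have "cinner b b = 0" by (simp add: M_def)
      then show False using b B by (auto simp: onb_of_def orthonormal_def)
    qed
    then show "b \<in> (\<Union>d\<in>D. {b \<in> B. cinner b d \<noteq> 0})" using b by blast
  qed
  ultimately have "countable B" by (meson D countable_UN countable_subset)
  then show ?thesis using M B FD DM by blast
qed

text \<open>
  If a reducing subspace \<open>M\<close> had a finite basis \<open>B\<close>, then Bessel's inequality for the orthonormal
  vectors \<open>s\<^sub>p\<^sup>k s\<^sub>q x\<close>, summed over \<open>B\<close>, would bound the number of these vectors by \<open>card B\<close>.
\<close>

lemma infinite_onb_of_cuntz:
  fixes s :: "nat \<Rightarrow> ('a::chilbert \<Rightarrow>\<^sub>L 'a)"
  assumes N: "2 \<le> N" and s: "cuntz_family N s"
    and M: "reducing_on \<S> M" and \<S>: "\<And>i. i \<in> {1..N} \<Longrightarrow> s i \<in> \<S>"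
    and B: "onb_of M B" and x: "x \<in> M" "x \<noteq> 0"
  shows "infinite B"
proof
  assume fin: "finite B"
  have oB: "orthonormal B" using B by (simp add: onb_of_def)
  have "1 \<in> {1..N}" "2 \<in> {1..N}" "1 \<noteq> (2::nat)" using N by auto
  then obtain p q where pq: "p \<in> {1..N}" "q \<in> {1..N}" "p \<noteq> q" by blast
  note s1 = cuntz_family_norm[OF s pq(1)]
  have sM: "s i y \<in> M" if "i \<in> {1..N}" "y \<in> M" for i y
    using M \<S>[OF that(1)] that(2) by (auto simp: reducing_on_def)
  define x1 where "x1 = complex_of_real (inverse (norm x)) *\<^sub>C x"
  have x1: "norm x1 = 1" using x(2) by (simp add: x1_def norm_scaleC norm_inverse)
  have x1M: "x1 \<in> M" unfolding x1_def by (rule reducing_on_scaleC[OF M x(1)])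
  \<comment> \<open>\<open>s q x1\<close> is orthogonal to the range of the isometry
    \<open>s p\<close>, a wandering vector: its images under the powers of \<open>s p\<close> are
    pairwise orthogonal.\<close>
  define u where "u k = (blinfun_apply (s p) ^^ k) (s q x1)" for k
  have uM: "u k \<in> M" for k by (induction k) (simp_all add: u_def sM[OF pq(1)] sM[OF pq(2) x1M])
  have u_norm: "norm (u k) = 1" for k
    by (induction k) (simp_all add: u_def s1 cuntz_family_norm[OF s pq(2)] x1)
  have s1_cinner: "cinner (s p y) (s p z) = cinner y z" for y z
    by (rule cinner_isometry[OF cuntz_family_clinear_ops[OF s pq(1)] s1])
  have s12: "cinner (s q y) (s p z) = 0" for y z
    using cinner_adj_right[OF cuntz_family_clinear_ops[OF s pq(2)], of y "s p z"]
      cuntz_family_apply[OF s pq(2,1), of z] pq(3)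
    by simp
  have u_less: "cinner (u k) (u (k + Suc d)) = 0" for k d
  proof (induction k)
    case 0
    then show ?case using s12 by (simp add: u_def)
  next
    case (Suc k)
    then show ?case using s1_cinner by (simp add: u_def)
  qed
  have u_ne: "cinner (u k) (u l) = 0" if "k \<noteq> l" for k l
  proof (cases "k < l")
    case True
    then show ?thesis using u_less[of k "l - Suc k"] by simp
  next
    case False
    then have "cinner (u l) (u k) = 0" using u_less[of l "k - Suc l"] that by simp
    then show ?thesis by (rule cinner_zero_sym)
  qed
  have u_self: "cinner (u k) (u k) = 1" for k by (simp add: cinner_self u_norm)
  have inj: "inj u"
  proof (rule injI)
    fix k l assume "u k = u l"
    then show "k = l" using u_ne[of k l] u_self[of k] by (cases "k = l") auto
  qed
  have ortho: "orthonormal (range u)"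
    unfolding orthonormal_def using u_ne u_self inj by (auto simp: inj_eq)
  define m where "m = Suc (card B)"
  \<comment> \<open>With B finite the expansion z is a finite sum, and totality of B in M makes it
    equal to \<open>u k\<close>; Bessel's inequality becomes an equality.\<close>
  have parseval: "(\<Sum>b\<in>B. (cmod (cinner b (u k)))\<^sup>2) = 1" for k
  proof -
    define z where "z = (\<Sum>b\<in>B. cinner b (u k) *\<^sub>C b)"
    have zM: "z \<in> M"
      unfolding z_def using B by (intro reducing_on_sum[OF M] reducing_on_scaleC[OF M]) (auto simp: onb_of_def)
    have "cinner b (u k - z) = 0" if "b \<in> B" for b
      unfolding cinner_diff_right z_def using cinner_sum_orthonormal[OF oB fin order_refl that] that by simp
    then have "u k - z = 0" using B reducing_on_diff[OF M uM zM] unfolding onb_of_def by blast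
    then have "u k = z" by simp
    then show ?thesis
      using norm_sum_orthonormal[OF oB fin order_refl, of "\<lambda>b. cinner b (u k)"] u_norm[of k]
      by (simp add: z_def)
  qed
  have "real m = (\<Sum>k<m. \<Sum>b\<in>B. (cmod (cinner b (u k)))\<^sup>2)" by (simp add: parseval)
  also have "\<dots> = (\<Sum>b\<in>B. \<Sum>k<m. (cmod (cinner b (u k)))\<^sup>2)" by (rule sum.swap)
  also have "\<dots> = (\<Sum>b\<in>B. \<Sum>v\<in>u ` {..<m}. (cmod (cinner v b))\<^sup>2)"
  proof (intro sum.cong refl)
    fix b
    have "(\<Sum>v\<in>u ` {..<m}. (cmod (cinner v b))\<^sup>2) = (\<Sum>k<m. (cmod (cinner (u k) b))\<^sup>2)"
      using inj by (subst sum.reindex) (auto intro: inj_on_subset)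
    moreover have "cmod (cinner (u k) b) = cmod (cinner b (u k))" for k
      by (metis cinner_commute complex_mod_cnj)
    ultimately show "(\<Sum>k<m. (cmod (cinner b (u k)))\<^sup>2) = (\<Sum>v\<in>u ` {..<m}. (cmod (cinner v b))\<^sup>2)" by simp
  qed
  also have "\<dots> \<le> (\<Sum>b\<in>B. (norm b)\<^sup>2)" by (intro sum_mono bessel[OF ortho]) auto
  also have "\<dots> = real (card B)"
  proof -
    have "(norm b)\<^sup>2 = 1" if "b \<in> B" for b
      using oB that cinner_self[of b] by (simp add: orthonormal_def flip: of_real_power)
    then show ?thesis by simp
  qed
  finally show False by (simp add: m_def)
qed

section \<open>The universal property of the Cuntz algebra\<close>

text \<open>The coefficient map of an orthonormal sequence, contractive by Bessel; its adjoint is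
  the isometry sending the n-th unit sequence to b n.\<close>

lemma ex_coords_op:
  fixes b :: "nat \<Rightarrow> 'a::chilbert"
  assumes "inj b" "orthonormal (range b)"
  shows "\<exists>W::'a \<Rightarrow>\<^sub>L nat ell2. W \<in> clinear_ops \<and> norm W \<le> 1 \<and> (\<forall>x n. ell2_apply (W x) n = cinner (b n) x)"
proof -
  have summ: "(\<lambda>n. (cmod (cinner (b n) x))\<^sup>2) summable_on UNIV" for x
    using bessel_summable[OF assms(2), of x] summable_on_reindex[OF assms(1), of "\<lambda>e. (cmod (cinner e x))\<^sup>2"]
    by (simp add: o_def)
  define F where "F x = Abs_ell2 (\<lambda>n. cinner (b n) x)" for x
  have F: "ell2_apply (F x) n = cinner (b n) x" for x n
    unfolding F_def using summ[of x] by (subst Abs_ell2_inverse) auto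
  have norm: "norm (F x) \<le> norm x" for x
  proof -
    have "(norm (F x))\<^sup>2 \<le> (norm x)\<^sup>2"
      unfolding power2_norm_ell2 F
    proof (rule infsum_le_finite_sums[OF summ])
      fix A :: "nat set" assume "finite A"
      then have "(\<Sum>e\<in>b ` A. (cmod (cinner e x))\<^sup>2) \<le> (norm x)\<^sup>2" by (intro bessel[OF assms(2)]) auto
      then show "(\<Sum>n\<in>A. (cmod (cinner (b n) x))\<^sup>2) \<le> (norm x)\<^sup>2"
        using assms(1) by (subst (asm) sum.reindex) (auto intro: inj_on_subset)
    qed
    then show ?thesis using power2_le_imp_le by force
  qed
  have "bounded_linear F"
  proof (rule bounded_linear_intro[where K = 1])
    show "F (x + y) = F x + F y" for x y
      by (rule ell2_eqI) (simp add: F plus_ell2.rep_eq cinner_add_right)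
    show "F (r *\<^sub>R x) = r *\<^sub>R F x" for r x
      by (rule ell2_eqI) (simp add: F scaleR_ell2.rep_eq cinner_scaleR_right)
  qed (simp add: norm)
  then have app: "blinfun_apply (Blinfun F) = F" by (rule bounded_linear_Blinfun_apply)
  have "Blinfun F \<in> clinear_ops"
    unfolding clinear_ops_def
    by (intro CollectI allI ell2_eqI) (simp add: app F scaleC_ell2.rep_eq cinner_scaleC_right)
  moreover have "norm (Blinfun F) \<le> 1" by (rule norm_blinfun_bound) (simp_all add: app norm)
  ultimately show ?thesis using F app by (intro exI[of _ "Blinfun F"]) auto
qed

text \<open>A basis of a separable reducing subspace M containing F identifies M with
  \<open>nat ell2\<close>. W is the projection onto M followed by this identification, and v is the
  compression of w. As M and its complement are both invariant, compression is multiplicative and W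
  intertwines on the whole space.\<close>

lemma ex_cuntz_compression:
  fixes w :: "nat \<Rightarrow> ('a::chilbert \<Rightarrow>\<^sub>L 'a)"
  assumes N: "2 \<le> N" and w: "cuntz_family N w" and F: "countable F" "\<not> F \<subseteq> {0}"
  shows "\<exists>(W::'a \<Rightarrow>\<^sub>L nat ell2) v. W \<in> clinear_ops \<and> norm W \<le> 1 \<and> cuntz_family N v \<and>
    (\<forall>x\<in>F. adj W (W x) = x) \<and>
    (\<forall>i\<in>{1..N}. \<forall>x. W (w i x) = v i (W x) \<and> W (adj (w i) x) = adj (v i) (W x))"
proof -
  define \<S> where "\<S> = w ` {1..N} \<union> (\<lambda>i. adj (w i)) ` {1..N}"
  have wC: "w i \<in> clinear_ops" if "i \<in> {1..N}" for i by (rule cuntz_family_clinear_ops[OF w that])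
  have \<S>C: "\<S> \<subseteq> clinear_ops" using wC adj_clinear_ops[OF wC] by (auto simp: \<S>_def)
  have \<S>adj: "adj T \<in> \<S>" if "T \<in> \<S>" for T using that wC by (auto simp: \<S>_def adj_adj)
  have "countable \<S>" by (simp add: \<S>_def)
  then obtain M B where M: "reducing_on \<S> M" and FM: "F \<subseteq> M" and B: "onb_of M B" "countable B"
    using ex_separable_reducing[OF _ \<S>C \<S>adj F(1)] by blast
  have \<S>M: "T x \<in> M" if "T \<in> \<S>" "x \<in> M" for T x using M that by (auto simp: reducing_on_def)
  \<comment> \<open>A nonzero vector of M forces the basis to be infinite; being countable, it is
    then indexed by all of \<open>nat\<close>.\<close>
  obtain x where "x \<in> F" "x \<noteq> 0" using F(2) by auto
  then have "infinite B"
    using FM by (intro infinite_onb_of_cuntz[OF N w M _ B(1), of x]) (auto simp: \<S>_def)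
  then obtain b :: "nat \<Rightarrow> 'a" where b: "bij_betw b UNIV B"
    using B(2) bij_betw_from_nat_into by blast
  have inj: "inj b" and ran: "range b = B" using b by (auto simp: bij_betw_def)
  have oB: "orthonormal B" and BM: "B \<subseteq> M" and Btotal: "\<And>x. x \<in> M \<Longrightarrow> \<forall>e\<in>B. cinner e x = 0 \<Longrightarrow> x = 0"
    using B(1) by (auto simp: onb_of_def)
  obtain W :: "'a \<Rightarrow>\<^sub>L nat ell2" where W: "W \<in> clinear_ops" "norm W \<le> 1"
    and Wn: "\<And>x n. ell2_apply (W x) n = cinner (b n) x"
    using ex_coords_op[OF inj] oB ran by metis
  define V where "V = adj W"
  have VC: "V \<in> clinear_ops" unfolding V_def by (rule adj_clinear_ops[OF W(1)])
  have Wb: "ell2_apply (W (b n)) m = (if m = n then 1 else 0)" for m n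
    using oB ran inj by (auto simp: Wn orthonormal_def inj_eq)
  have WV: "W (V f) = f" for f
  proof (rule ell2_eqI)
    fix n
    have "ell2_apply (W (V f)) n = cinner (W (b n)) f" by (simp add: Wn V_def cinner_adj_right[OF W(1)])
    also have "\<dots> = (\<Sum>\<^sub>\<infinity>m. if m = n then ell2_apply f n else 0)"
      unfolding cinner_ell2_def by (intro infsum_cong) (simp add: Wb)
    also have "\<dots> = (\<Sum>\<^sub>\<infinity>m\<in>{n}. ell2_apply f n)" by (intro infsum_cong_neutral) auto
    finally show "ell2_apply (W (V f)) n = ell2_apply f n" by simp
  qed
  have W_perp: "W y = 0" if "\<And>m. m \<in> M \<Longrightarrow> cinner m y = 0" for y
    using that BM ran by (intro ell2_eqI) (auto simp: Wn zero_ell2.rep_eq)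
  \<comment> \<open>W kills the complement of M, so the range of its adjoint lies in the double
    complement, which is M.\<close>
  have VM: "V f \<in> M" for f
    by (rule reducing_on_bipolar[OF M]) (simp add: V_def cinner_adj_right[OF W(1)] W_perp)
  have VW: "V (W x) = x" if "x \<in> M" for x
  proof -
    have "cinner e (V (W x) - x) = 0" if e: "e \<in> B" for e
    proof -
      obtain n where "e = b n" using e ran by auto
      then show ?thesis using WV[of "W x"] Wn[of "V (W x)" n] Wn[of x n] by (simp add: cinner_diff_right)
    qed
    then have "V (W x) - x = 0" using that by (intro Btotal reducing_on_diff[OF M] VM) auto
    then show ?thesis by simp
  qed
  define c where "c T = W o\<^sub>L T o\<^sub>L V" for T
  have c_apply: "c T f = W (T (V f))" for T f by (simp add: c_def)
  have adj_c: "adj (c T) = c (adj T)" if "T \<in> \<S>" for T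
  proof -
    have TC: "T \<in> clinear_ops" using that \<S>C by blast
    show ?thesis
    proof (rule adj_eqI)
      fix f g
      have "cinner (c (adj T) g) f = cinner (adj T (V g)) (V f)"
        unfolding c_apply V_def by (rule cinner_adj_right[OF W(1), symmetric])
      also have "\<dots> = cinner (V g) (T (V f))" by (rule cinner_adj_left[OF TC])
      also have "\<dots> = cinner g (c T f)" unfolding c_apply V_def by (rule cinner_adj_left[OF W(1)])
      finally show "cinner (c (adj T) g) f = cinner g (c T f)" .
    qed
  qed
  have cc: "c S (c T f) = W (S (T (V f)))" if "S \<in> \<S>" "T \<in> \<S>" for S T f
    using VW[OF \<S>M[OF that(2) VM]] by (simp add: c_apply)
  \<comment> \<open>x - V (W x) is orthogonal to M, and T keeps it so because \<open>adj T\<close>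
    preserves M; hence W does not see this component.\<close>
  have Wc: "W (T x) = c T (W x)" if T: "T \<in> \<S>" for T x
  proof -
    have TC: "T \<in> clinear_ops" using T \<S>C by blast
    have "W (T (x - V (W x))) = 0"
    proof (rule W_perp)
      fix m assume "m \<in> M"
      then have m: "adj T m \<in> M" by (intro \<S>M \<S>adj T)
      have "cinner (adj T m) (V (W x)) = cinner (adj T m) x"
        using VW[OF m] by (simp add: V_def cinner_adj_right[OF W(1)]) (metis W(1) cinner_adj_left)
      then show "cinner m (T (x - V (W x))) = 0"
        by (simp add: cinner_adj_left[OF TC, symmetric] cinner_diff_right)
    qed
    then show ?thesis by (simp add: c_apply blinfun.diff_right)
  qed
  have w\<S>: "w i \<in> \<S>" "adj (w i) \<in> \<S>" if "i \<in> {1..N}" for i using that by (auto simp: \<S>_def)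
  have "cuntz_family N (\<lambda>i. c (w i))"
  proof (rule cuntz_familyI)
    show "c (w i) \<in> clinear_ops" if "i \<in> {1..N}" for i
      unfolding c_def by (intro compose_clinear_ops W(1) VC wC that)
    show "adj (c (w i)) (c (w j) f) = (if i = j then f else 0)"
      if "i \<in> {1..N}" "j \<in> {1..N}" for i j f
      unfolding adj_c[OF w\<S>(1)[OF that(1)]] cc[OF w\<S>(2)[OF that(1)] w\<S>(1)[OF that(2)]]
        cuntz_family_apply[OF w that]
      by (simp add: WV)
    show "(\<Sum>i=1..N. c (w i) (adj (c (w i)) f)) = f" for f
    proof -
      have "(\<Sum>i=1..N. c (w i) (adj (c (w i)) f)) = (\<Sum>i=1..N. W (w i (adj (w i) (V f))))"
        by (intro sum.cong refl) (simp only: adj_c[OF w\<S>(1)] cc[OF w\<S>])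
      also have "\<dots> = W (\<Sum>i=1..N. w i (adj (w i) (V f)))" by (simp add: blinfun.sum_right)
      finally show ?thesis by (simp only: cuntz_family_sum[OF w] WV)
    qed
  qed
  moreover have "W (w i x) = c (w i) (W x) \<and> W (adj (w i) x) = adj (c (w i)) (W x)"
    if "i \<in> {1..N}" for i x
    by (simp only: adj_c[OF w\<S>(1)[OF that]] Wc[OF w\<S>(1)[OF that]] Wc[OF w\<S>(2)[OF that]])
  moreover have "adj W (W x) = x" if "x \<in> F" for x using VW[of x] that FM by (auto simp: V_def)
  ultimately show ?thesis using W by (intro exI[of _ W] exI[of _ "\<lambda>i. c (w i)"]) blast
qed

lemma ex_cuntz_intertwiner:
  fixes w :: "nat \<Rightarrow> ('a::chilbert \<Rightarrow>\<^sub>L 'a)"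
  assumes N: "2 \<le> N" and w: "cuntz_family N w" and F: "countable F"
  shows "\<exists>W. W \<in> clinear_ops \<and> norm W \<le> 1 \<and> (\<forall>x\<in>F. adj W (W x) = x) \<and>
    (\<forall>i\<in>{1..N}. intertwines {W} (cuntz_gen N i) (w i))"
proof (cases "F \<subseteq> {0}")
  \<comment> \<open>W = 0 fixes the zero vector. This also covers a zero space, which has no
    orthonormal sequence.\<close>
  case True
  then show ?thesis
    using cuntz_family_clinear_ops[OF w]
    by (intro exI[of _ 0]) (auto simp: intertwines_def cuntz_gen_clinear_ops blinfun_eq_iff)
next
  case False
  from ex_cuntz_compression[OF N w F False] obtain W :: "'a \<Rightarrow>\<^sub>L nat ell2" and v where
    W: "W \<in> clinear_ops" "norm W \<le> 1" and v: "cuntz_family N v"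
    and WF: "\<forall>x\<in>F. adj W (W x) = x"
    and Wv: "\<forall>i\<in>{1..N}. \<forall>x. W (w i x) = v i (W x) \<and> W (adj (w i) x) = adj (v i) (W x)"
    by blast
  \<comment> \<open>Moving into the block labelled v turns v into the canonical generators.\<close>
  define U where "U = incl v o\<^sub>L W"
  have "U \<in> clinear_ops" unfolding U_def by (intro compose_clinear_ops incl_clinear_ops W)
  moreover have "norm U \<le> 1"
    unfolding U_def
    by (rule order_trans[OF norm_blinfun_compose mult_le_one[OF norm_incl_le norm_ge_zero W(2)]])
  moreover have "adj U (U x) = x" if "x \<in> F" for x
    using WF that by (simp add: U_def adj_compose incl_clinear_ops W(1) adj_incl slice_incl)
  moreover have "intertwines {U} (cuntz_gen N i) (w i)" if "i \<in> {1..N}" for i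
    using that Wv incl_cuntz_gen[OF that v] cuntz_family_clinear_ops[OF w that]
    by (simp add: intertwines_def cuntz_gen_clinear_ops blinfun_eq_iff U_def)
  ultimately show ?thesis by blast
qed

lemma cuntz_gens_clinear_ops: "cuntz_gen N ` {1..N} \<subseteq> clinear_ops"
  using cuntz_gen_clinear_ops by blast

lemma cstar_algebra_cuntz: "cstar_algebra (cuntz_algebra N)"
  unfolding cuntz_algebra_def by (rule cstar_algebra_generated[OF cuntz_gens_clinear_ops])

lemma cuntz_gen_in_algebra: "i \<in> {1..N} \<Longrightarrow> cuntz_gen N i \<in> cuntz_algebra N"
  unfolding cuntz_algebra_def using generators_subset by blast

text \<open>All operators intertwining the generators with w are used at once: one of them may see
  only a separable part, but each vector keeps its norm under some contraction among them. The
  generators lie in the domain of the resulting homomorphism, and this domain is a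
  C*-algebra.\<close>

theorem cuntz_algebra_universal:
  fixes w :: "nat \<Rightarrow> ('a::chilbert \<Rightarrow>\<^sub>L 'a)"
  assumes N: "2 \<le> N" and w: "cuntz_family N w"
  shows "\<exists>\<pi>. is_rep N \<pi> \<and> (\<forall>i\<in>{1..N}. \<pi> (cuntz_gen N i) = w i)"
proof -
  define \<W> where "\<W> = {W \<in> clinear_ops. \<forall>i\<in>{1..N}. intertwines {W} (cuntz_gen N i) (w i)}"
  have norming: "norming \<W>"
    unfolding norming_def
  proof (intro conjI allI impI)
    show "\<W> \<subseteq> clinear_ops" by (auto simp: \<W>_def)
    fix x :: 'a and e :: real assume "e > 0"
    from ex_cuntz_intertwiner[OF N w, of "{x}"] obtain W where
      "W \<in> clinear_ops" "norm W \<le> 1" "adj W (W x) = x"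
      "\<forall>i\<in>{1..N}. intertwines {W} (cuntz_gen N i) (w i)" by auto
    then show "\<exists>W\<in>\<W>. norm W \<le> 1 \<and> norm x \<le> norm (blinfun_apply W x) + e"
      using \<open>e > 0\<close> by (intro bexI[of _ W]) (auto simp: \<W>_def norm_eq_of_adj_fixed)
  qed
  define \<pi> where "\<pi> u = (THE R. intertwines \<W> u R)" for u
  have gen: "intertwines \<W> (cuntz_gen N i) (w i)" if "i \<in> {1..N}" for i
    using that cuntz_family_clinear_ops[OF w that] cuntz_gen_clinear_ops[OF that]
    by (auto simp: \<W>_def intertwines_def)
  have "cuntz_algebra N \<subseteq> {u. \<exists>R. intertwines \<W> u R}"
    unfolding cuntz_algebra_def
    using gen by (intro cstar_generated_subset intertwines_cstar_algebra norming) blast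
  then have "is_rep N \<pi>"
    unfolding is_rep_def \<pi>_def by (rule unital_star_hom_subset[OF _ intertwines_hom[OF norming]])
  moreover have "\<pi> (cuntz_gen N i) = w i" if "i \<in> {1..N}" for i
    unfolding \<pi>_def by (rule intertwines_the[OF norming gen[OF that]])
  ultimately show ?thesis by blast
qed

section \<open>Tensor products of operators\<close>

lemma ell2_tensor_add_left: "ell2_tensor (f + f') g = ell2_tensor f g + ell2_tensor f' g"
  by transfer (auto simp: fun_eq_iff algebra_simps)

lemma ell2_tensor_add_right: "ell2_tensor f (g + g') = ell2_tensor f g + ell2_tensor f g'"
  by transfer (auto simp: fun_eq_iff algebra_simps)

lemma ell2_tensor_scaleC_right: "ell2_tensor f (c *\<^sub>C g) = c *\<^sub>C ell2_tensor f g"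
  by transfer (auto simp: fun_eq_iff)

lemma tensor_add_left: "(x + x') \<otimes>\<^sub>H y = x \<otimes>\<^sub>H y + x' \<otimes>\<^sub>H y"
  by transfer (simp add: onb_coords_add ell2_tensor_add_left)

lemma tensor_add_right: "x \<otimes>\<^sub>H (y + y') = x \<otimes>\<^sub>H y + x \<otimes>\<^sub>H y'"
  by transfer (simp add: onb_coords_add ell2_tensor_add_right)

lemma tensor_scaleC_left: "(c *\<^sub>C x) \<otimes>\<^sub>H y = c *\<^sub>C (x \<otimes>\<^sub>H y)"
  by transfer (simp add: onb_coords_scaleC ell2_tensor_scaleC_left)

lemma tensor_scaleC_right: "x \<otimes>\<^sub>H (c *\<^sub>C y) = c *\<^sub>C (x \<otimes>\<^sub>H y)"
  by transfer (simp add: onb_coords_scaleC ell2_tensor_scaleC_right)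

lemma tensor_scaleR_left: "(r *\<^sub>R x) \<otimes>\<^sub>H y = r *\<^sub>R (x \<otimes>\<^sub>H y)"
  by (metis scaleC_of_real tensor_scaleC_left)

lemma tensor_scaleR_right: "x \<otimes>\<^sub>H (r *\<^sub>R y) = r *\<^sub>R (x \<otimes>\<^sub>H y)"
  by (metis scaleC_of_real tensor_scaleC_right)

lemma tensor_zero [simp]: "0 \<otimes>\<^sub>H y = 0" "x \<otimes>\<^sub>H 0 = 0"
  using tensor_scaleR_left[of 0 0 y] tensor_scaleR_right[of x 0 0] by simp_all

lemma tensor_sum_left: "sum f A \<otimes>\<^sub>H y = (\<Sum>i\<in>A. f i \<otimes>\<^sub>H y)"
  by (induction A rule: infinite_finite_induct) (simp_all add: tensor_add_left)

lemma tensor_sum_right: "x \<otimes>\<^sub>H sum f A = (\<Sum>i\<in>A. x \<otimes>\<^sub>H f i)"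
  by (induction A rule: infinite_finite_induct) (simp_all add: tensor_add_right)

lemma norm_tensor: "norm (x \<otimes>\<^sub>H y) = norm x * norm y"
proof -
  have "complex_of_real ((norm (x \<otimes>\<^sub>H y))\<^sup>2) = complex_of_real ((norm x)\<^sup>2) * complex_of_real ((norm y)\<^sup>2)"
    unfolding cinner_self [symmetric] by (rule cinner_tensor)
  then have "(norm (x \<otimes>\<^sub>H y))\<^sup>2 = (norm x * norm y)\<^sup>2"
    unfolding of_real_mult [symmetric] of_real_eq_iff by (simp add: power_mult_distrib)
  then show ?thesis by (simp add: power2_eq_iff_nonneg)
qed

section \<open>Arguments by density of the elementary tensors\<close>

lemma bounded_linear_tensor_right: "bounded_linear (\<lambda>y. x \<otimes>\<^sub>H y)"
  by (rule bounded_linear_intro[where K = "norm x"])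
     (simp_all add: tensor_add_right tensor_scaleR_right norm_tensor mult.commute)

lemma bounded_linear_tensor_left: "bounded_linear (\<lambda>x. x \<otimes>\<^sub>H y)"
  by (rule bounded_linear_intro[where K = "norm y"])
     (simp_all add: tensor_add_left tensor_scaleR_left norm_tensor)

text \<open>Induction along elementary tensors, for properties stable under limits and real
  combinations.\<close>

lemma htensor_closed_subspace:
  fixes C :: "('a::chilbert, 'b::chilbert) htensor set"
  assumes "closed C" "subspace C" "\<And>x y. x \<otimes>\<^sub>H y \<in> C"
  shows "u \<in> C"
proof -
  have "closure (span (range (\<lambda>(x, y). x \<otimes>\<^sub>H y))) \<subseteq> C"
    using assms by (intro closure_minimal span_minimal) auto
  then show ?thesis unfolding closure_span_tensor by blast
qed

lemma htensor_blinfun_eqI: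
  fixes R R' :: "('a::chilbert, 'b::chilbert) htensor \<Rightarrow>\<^sub>L 'c::real_normed_vector"
  assumes "\<And>x y. R (x \<otimes>\<^sub>H y) = R' (x \<otimes>\<^sub>H y)"
  shows "R = R'"
proof (rule blinfun_eqI)
  fix u
  have "u \<in> {u. R u = R' u}"
  proof (rule htensor_closed_subspace)
    show "closed {u. R u = R' u}" by (intro closed_Collect_eq continuous_intros)
    show "subspace {u. R u = R' u}" by (auto simp: subspace_def blinfun.bilinear_simps)
  qed (use assms in simp)
  then show "R u = R' u" by simp
qed

lemma htensor_vec_eqI:
  assumes "\<And>x y. cinner (x \<otimes>\<^sub>H y) u = cinner (x \<otimes>\<^sub>H y) v"
  shows "u = v"
proof (rule cinner_eqI)
  fix z
  have cont: "continuous_on UNIV (\<lambda>z. cinner (u - v) z)"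
    by (intro bounded_linear.continuous_on[OF bounded_linear_cinner_right] continuous_intros)
  have "z \<in> {z. cinner (u - v) z = 0}"
  proof (rule htensor_closed_subspace)
    show "closed {z. cinner (u - v) z = 0}" by (intro closed_Collect_eq cont continuous_intros)
    show "subspace {z. cinner (u - v) z = 0}"
      by (auto simp: subspace_def cinner_add_right cinner_scaleR_right)
    show "x \<otimes>\<^sub>H y \<in> {z. cinner (u - v) z = 0}" for x y
      using assms[of x y] by (auto intro: cinner_zero_sym simp: cinner_diff_right)
  qed
  then have "cinner z (u - v) = 0" by (auto intro: cinner_zero_sym)
  then show "cinner z u = cinner z v" by (simp add: cinner_diff_right)
qed

section \<open>Operators prescribed on a total family\<close>

lemma span_range_explicit:
  assumes "z \<in> span (range f)"
  shows "\<exists>F r. finite F \<and> z = (\<Sum>p\<in>F. r p *\<^sub>R f p)"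
proof -
  obtain T u where T: "finite T" "T \<subseteq> range f" "z = (\<Sum>v\<in>T. u v *\<^sub>R v)"
    using assms by (auto simp: span_explicit)
  \<comment> \<open>One index is chosen for each vector of T, so that a second family can be summed
    over the same F.\<close>
  obtain F where F: "inj_on f F" "T = f ` F" using T(2) by (auto simp: subset_image_inj)
  have "finite F" using T(1) F by (simp add: finite_image_iff)
  moreover have "z = (\<Sum>p\<in>F. u (f p) *\<^sub>R f p)"
    unfolding T(3) F(2) by (simp add: sum.reindex[OF F(1)])
  ultimately show ?thesis by (intro exI[of _ F] exI[of _ "\<lambda>p. u (f p)"]) simp
qed

text \<open>On the closed span G of the pairs (t p, g p) the second entry is bounded by c times the
  first, so G is the graph of an operator. The bound itself guarantees that linear relations among
  the t p are respected.\<close>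

lemma ex_blinfun_extension:
  fixes t :: "'p \<Rightarrow> 'a::banach" and g :: "'p \<Rightarrow> 'b::banach"
  assumes dense: "closure (span (range t)) = UNIV" and c: "0 \<le> c"
    and bound: "\<And>F r. finite F \<Longrightarrow> norm (\<Sum>p\<in>F. r p *\<^sub>R g p) \<le> c * norm (\<Sum>p\<in>F. r p *\<^sub>R t p)"
  shows "\<exists>R::'a \<Rightarrow>\<^sub>L 'b. (\<forall>p. blinfun_apply R (t p) = g p) \<and> norm R \<le> c"
proof -
  let ?f = "\<lambda>p. (t p, g p)"
  define G where "G = closure (span (range ?f))"
  have sub: "subspace G" unfolding G_def by (rule subspace_closure_span)
  have span_le: "norm (snd z) \<le> c * norm (fst z)" if "z \<in> span (range ?f)" for z
  proof -
    from span_range_explicit[OF that] obtain F r where F: "finite F" "z = (\<Sum>p\<in>F. r p *\<^sub>R ?f p)"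
      by blast
    then show ?thesis using bound[OF F(1), of r] by (simp add: fst_sum snd_sum)
  qed
  have "closed {z::'a \<times> 'b. norm (snd z) \<le> c * norm (fst z)}"
    by (intro closed_Collect_le continuous_intros)
  then have "G \<subseteq> {z. norm (snd z) \<le> c * norm (fst z)}"
    unfolding G_def using span_le by (intro closure_minimal) auto
  then have le: "norm b \<le> c * norm a" if "(a, b) \<in> G" for a b using that by auto
  have "\<exists>b. (a, b) \<in> G" for a
  proof -
    have "a \<in> closure (span (range t))" by (simp add: dense)
    then obtain X where X: "\<And>n. X n \<in> span (range t)" "X \<longlonglongrightarrow> a" by (auto simp: closure_sequential)
    have "range t = fst ` range ?f" by (simp add: image_image)
    then have "span (range t) = fst ` span (range ?f)"
      using linear_span_image[OF bounded_linear.linear[OF bounded_linear_fst]] by metis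
    then have "\<forall>n. \<exists>b. (X n, b) \<in> span (range ?f)" using X(1) by force
    then obtain Y where Y: "\<And>n. (X n, Y n) \<in> span (range ?f)" by metis
    have dist: "dist (Y m) (Y n) \<le> c * dist (X m) (X n)" for m n
      using span_le[OF span_diff[OF Y[of m] Y[of n]]] by (simp add: dist_norm)
    have "Cauchy Y"
    proof (rule metric_CauchyI)
      fix e :: real assume "e > 0"
      have "Cauchy X" using X(2) LIMSEQ_imp_Cauchy by blast
      \<comment> \<open>c + 1 keeps the denominator positive when c = 0.\<close>
      then obtain K where K: "\<And>m n. m \<ge> K \<Longrightarrow> n \<ge> K \<Longrightarrow> dist (X m) (X n) < e / (c + 1)"
        using \<open>e > 0\<close> c metric_CauchyD[of X "e / (c + 1)"] by auto
      have "dist (Y m) (Y n) < e" if "m \<ge> K" "n \<ge> K" for m n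
      proof -
        have "(c + 1) * dist (X m) (X n) < e"
          using K[OF that] c by (simp add: pos_less_divide_eq mult.commute)
        moreover have "c * dist (X m) (X n) \<le> (c + 1) * dist (X m) (X n)"
          by (intro mult_right_mono) auto
        ultimately show ?thesis using dist[of m n] by linarith
      qed
      then show "\<exists>K. \<forall>m\<ge>K. \<forall>n\<ge>K. dist (Y m) (Y n) < e" by blast
    qed
    then obtain b where "Y \<longlonglongrightarrow> b" using Cauchy_convergent convergent_def by blast
    then have "(\<lambda>n. (X n, Y n)) \<longlonglongrightarrow> (a, b)" using X(2) by (intro tendsto_Pair)
    then have "(a, b) \<in> G"
      unfolding G_def closure_sequential using Y by (intro exI[of _ "\<lambda>n. (X n, Y n)"]) simp
    then show ?thesis by blast
  qed
  then obtain R where R: "\<And>a. (a, R a) \<in> G" by metis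
  \<comment> \<open>Two values over a differ by some d with (0, d) in G, and the bound gives d =
    0.\<close>
  have uniq: "R a = b" if "(a, b) \<in> G" for a b
    using le[of 0 "R a - b"] subspace_diff[OF sub R[of a] that] by simp
  have "bounded_linear R"
  proof (rule bounded_linear_intro[where K = c])
    show "R (x + y) = R x + R y" for x y
      using subspace_add[OF sub R[of x] R[of y]] by (intro uniq) simp
    show "R (r *\<^sub>R x) = r *\<^sub>R R x" for r x
      using subspace_scale[OF sub R[of x], of r] by (intro uniq) simp
    show "norm (R x) \<le> norm x * c" for x using le[OF R[of x]] by (simp add: mult.commute)
  qed
  then have app: "blinfun_apply (Blinfun R) = R" by (rule bounded_linear_Blinfun_apply)
  have "R (t p) = g p" for p
    unfolding G_def by (rule uniq) (auto simp: G_def intro!: subsetD[OF closure_subset] span_base)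
  moreover have "norm (Blinfun R) \<le> c" using c le[OF R] by (intro norm_blinfun_bound) (auto simp: app)
  ultimately show ?thesis by (intro exI[of _ "Blinfun R"]) (simp add: app)
qed

text \<open>The norm of a real combination depends on the vectors only through their Gram
  matrix.\<close>

lemma norm_sum_eq_of_cinner:
  fixes t :: "'p \<Rightarrow> 'a::chilbert" and g :: "'p \<Rightarrow> 'b::chilbert"
  assumes "\<And>p q. cinner (g p) (g q) = cinner (t p) (t q)"
  shows "norm (\<Sum>p\<in>F. r p *\<^sub>R g p) = norm (\<Sum>p\<in>F. r p *\<^sub>R t p)"
proof -
  have "inner (g p) (g q) = inner (t p) (t q)" for p q
    using assms[of p q] by (metis Re_cinner)
  then have "(norm (\<Sum>p\<in>F. r p *\<^sub>R g p))\<^sup>2 = (norm (\<Sum>p\<in>F. r p *\<^sub>R t p))\<^sup>2"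
    by (simp add: power2_norm_eq_inner inner_sum_left inner_sum_right)
  then show ?thesis by (simp add: power2_eq_iff_nonneg)
qed

lemma ex_isometry_extension:
  fixes t :: "'p \<Rightarrow> 'a::chilbert" and g :: "'p \<Rightarrow> 'b::chilbert"
  assumes "closure (span (range t)) = UNIV" "\<And>p q. cinner (g p) (g q) = cinner (t p) (t q)"
  shows "\<exists>R::'a \<Rightarrow>\<^sub>L 'b. (\<forall>p. blinfun_apply R (t p) = g p) \<and> (\<forall>x. norm (blinfun_apply R x) = norm x)"
proof -
  have "\<exists>R::'a \<Rightarrow>\<^sub>L 'b. (\<forall>p. blinfun_apply R (t p) = g p) \<and> norm R \<le> 1"
    by (rule ex_blinfun_extension[OF assms(1)]) (simp_all add: norm_sum_eq_of_cinner[OF assms(2)])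
  then obtain R :: "'a \<Rightarrow>\<^sub>L 'b" where R: "\<And>p. blinfun_apply R (t p) = g p" by blast
  have "norm (R x) = norm x" if "x \<in> span (range t)" for x
  proof -
    from span_range_explicit[OF that] obtain F r where "x = (\<Sum>p\<in>F. r p *\<^sub>R t p)" by blast
    then show ?thesis
      using norm_sum_eq_of_cinner[of g t, OF assms(2)]
      by (simp add: blinfun.sum_right blinfun.scaleR_right R)
  qed
  moreover have "closed {x. norm (R x) = norm x}" by (intro closed_Collect_eq continuous_intros)
  ultimately have "closure (span (range t)) \<subseteq> {x. norm (R x) = norm x}"
    by (intro closure_minimal) auto
  then show ?thesis using R assms(1) by auto
qed

text \<open>Equal Gram matrices give isometries both ways, inverse to each other on the total
  families. As the spans are real, complex linearity of U is supplied by \<open>scale\<close>: each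
  complex multiple of a pair (t p, g p) again belongs to the families.\<close>

lemma ex_unitary_extension:
  fixes t :: "'p \<Rightarrow> 'a::chilbert" and g :: "'p \<Rightarrow> 'b::chilbert"
  assumes t: "closure (span (range t)) = UNIV" and g: "closure (span (range g)) = UNIV"
    and cinner: "\<And>p q. cinner (g p) (g q) = cinner (t p) (t q)"
    and scale: "\<And>c p. \<exists>q. t q = c *\<^sub>C t p \<and> g q = c *\<^sub>C g p"
  shows "\<exists>U::'a \<Rightarrow>\<^sub>L 'b. (\<forall>p. blinfun_apply U (t p) = g p) \<and> unitary U"
proof -
  from ex_isometry_extension[OF t cinner] obtain U :: "'a \<Rightarrow>\<^sub>L 'b" where
    U: "\<And>p. blinfun_apply U (t p) = g p" "\<And>x. norm (U x) = norm x" by blast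
  from ex_isometry_extension[OF g cinner[symmetric]] obtain V :: "'b \<Rightarrow>\<^sub>L 'a" where
    V: "\<And>p. blinfun_apply V (g p) = t p" by blast
  have "closure (span (range g)) \<subseteq> {y. U (V y) = y}"
  proof (intro closure_minimal span_minimal)
    show "closed {y. U (V y) = y}" by (intro closed_Collect_eq continuous_intros)
    show "subspace {y. U (V y) = y}" by (auto simp: subspace_def blinfun.bilinear_simps)
  qed (auto simp: U V)
  then have UV: "U o\<^sub>L V = id_blinfun" using g by (intro blinfun_eqI) auto
  have "U (c *\<^sub>C x) = c *\<^sub>C U x" for c x
  proof -
    have "closure (span (range t)) \<subseteq> {x. U (c *\<^sub>C x) = c *\<^sub>C U x}"
    proof (intro closure_minimal span_minimal)
      show "closed {x. U (c *\<^sub>C x) = c *\<^sub>C U x}"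
        by (intro closed_Collect_eq bounded_linear.continuous_on[OF bounded_linear_scaleC]
            bounded_linear.continuous_on[OF blinfun.bounded_linear_right] continuous_intros)
      show "subspace {x. U (c *\<^sub>C x) = c *\<^sub>C U x}"
        by (auto simp: subspace_def blinfun.bilinear_simps scaleC_add_right scaleC_scaleR_commute)
      have "U (c *\<^sub>C t p) = c *\<^sub>C U (t p)" for p using scale[of c p] U(1) by metis
      then show "range t \<subseteq> {x. U (c *\<^sub>C x) = c *\<^sub>C U x}" by auto
    qed
    then show ?thesis using t by auto
  qed
  then have "U \<in> clinear_ops" by (simp add: clinear_ops_def)
  then have "unitary U" by (rule unitaryI(1)[OF _ U(2) UV])
  then show ?thesis using U(1) by blast
qed

section \<open>Norms of finite sums of elementary tensors, and existence of S \<otimes> T\<close>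

lemma has_sum_finite_sum:
  fixes f :: "'p \<Rightarrow> 'e \<Rightarrow> 'c::topological_comm_monoid_add"
  assumes "\<And>p. p \<in> F \<Longrightarrow> (f p has_sum s p) A"
  shows "((\<lambda>e. \<Sum>p\<in>F. f p e) has_sum (\<Sum>p\<in>F. s p)) A"
  using assms by (induction F rule: infinite_finite_induct) (auto intro: has_sum_add)

lemma has_sum_cinner_onb:
  "((\<lambda>e. cnj (cinner e x) * cinner e y) has_sum cinner x y) (onb :: 'a::chilbert set)"
proof -
  have "((\<lambda>e. cnj (ell2_apply (onb_coords x) e) * ell2_apply (onb_coords y) e) has_sum
      cinner (onb_coords x) (onb_coords y)) UNIV"
    unfolding cinner_ell2_def by (rule has_sum_infsum[OF ell2_mult_summable'])
  then show ?thesis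
    unfolding cinner_onb_coords
    by (subst (asm) has_sum_cong_neutral[where T = onb and g = "\<lambda>e. cnj (cinner e x) * cinner e y"])
       (auto simp: onb_coords.rep_eq)
qed

text \<open>
  The squared norm of a finite sum of elementary tensors is the sum of the squared norms of its
  slices along an orthonormal basis of the second factor; an operator on the first factor acts on
  each slice separately.
\<close>

lemma has_sum_norm_sum_tensor:
  fixes x :: "'p \<Rightarrow> 'a::chilbert" and y :: "'p \<Rightarrow> 'b::chilbert"
  shows "((\<lambda>e. (norm (\<Sum>p\<in>F. cinner e (y p) *\<^sub>C x p))\<^sup>2) has_sum
    (norm (\<Sum>p\<in>F. x p \<otimes>\<^sub>H y p))\<^sup>2) onb"
proof -
  have "((\<lambda>e. \<Sum>p\<in>F. \<Sum>q\<in>F. cinner (x p) (x q) * (cnj (cinner e (y p)) * cinner e (y q))) has_sum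
      (\<Sum>p\<in>F. \<Sum>q\<in>F. cinner (x p) (x q) * cinner (y p) (y q))) onb"
    by (intro has_sum_finite_sum has_sum_cmult_right has_sum_cinner_onb)
  moreover have "(\<Sum>p\<in>F. \<Sum>q\<in>F. cinner (x p) (x q) * (cnj (cinner e (y p)) * cinner e (y q)))
      = complex_of_real ((norm (\<Sum>p\<in>F. cinner e (y p) *\<^sub>C x p))\<^sup>2)" for e
    unfolding cinner_self [symmetric] cinner_sum_left cinner_sum_right
    by (subst sum.swap) (simp add: cinner_scaleC_left cinner_scaleC_right mult_ac)
  moreover have "(\<Sum>p\<in>F. \<Sum>q\<in>F. cinner (x p) (x q) * cinner (y p) (y q))
      = complex_of_real ((norm (\<Sum>p\<in>F. x p \<otimes>\<^sub>H y p))\<^sup>2)"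
    unfolding cinner_self [symmetric] cinner_sum_left cinner_sum_right
    by (subst sum.swap) (simp add: cinner_tensor)
  ultimately show ?thesis by (simp only: has_sum_of_real_iff)
qed

lemma norm_sum_op_tensor_left:
  assumes S: "S \<in> clinear_ops"
  shows "norm (\<Sum>p\<in>F. S (x p) \<otimes>\<^sub>H y p) \<le> norm S * norm (\<Sum>p\<in>F. x p \<otimes>\<^sub>H y p)"
proof -
  have "(norm (\<Sum>p\<in>F. S (x p) \<otimes>\<^sub>H y p))\<^sup>2 \<le> (norm S)\<^sup>2 * (norm (\<Sum>p\<in>F. x p \<otimes>\<^sub>H y p))\<^sup>2"
  proof (rule has_sum_mono[OF has_sum_norm_sum_tensor has_sum_cmult_right[OF has_sum_norm_sum_tensor]])
    fix e
    have "(\<Sum>p\<in>F. cinner e (y p) *\<^sub>C S (x p)) = S (\<Sum>p\<in>F. cinner e (y p) *\<^sub>C x p)"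
      by (simp add: blinfun.sum_right clinear_ops_scaleC[OF S])
    then show "(norm (\<Sum>p\<in>F. cinner e (y p) *\<^sub>C S (x p)))\<^sup>2
        \<le> (norm S)\<^sup>2 * (norm (\<Sum>p\<in>F. cinner e (y p) *\<^sub>C x p))\<^sup>2"
      by (simp only: power_mult_distrib [symmetric]) (intro power_mono norm_blinfun norm_ge_zero)
  qed
  then show ?thesis
    unfolding power_mult_distrib [symmetric] by (rule power2_le_imp_le) simp
qed

lemma ex_op_tensor_left:
  fixes S :: "'a::chilbert \<Rightarrow>\<^sub>L 'c::chilbert"
  assumes S: "S \<in> clinear_ops"
  shows "\<exists>R::('a, 'b::chilbert) htensor \<Rightarrow>\<^sub>L ('c, 'b) htensor.
    (\<forall>x y. blinfun_apply R (x \<otimes>\<^sub>H y) = S x \<otimes>\<^sub>H y) \<and> norm R \<le> norm S"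
proof -
  have "\<exists>R::('a, 'b) htensor \<Rightarrow>\<^sub>L ('c, 'b) htensor.
      (\<forall>p. blinfun_apply R (case p of (x, y) \<Rightarrow> x \<otimes>\<^sub>H y) = (case p of (x, y) \<Rightarrow> S x \<otimes>\<^sub>H y)) \<and> norm R \<le> norm S"
  proof (rule ex_blinfun_extension)
    show "closure (span (range (\<lambda>(x::'a, y::'b). x \<otimes>\<^sub>H y))) = UNIV" by (rule closure_span_tensor)
    fix F :: "('a \<times> 'b) set" and r :: "'a \<times> 'b \<Rightarrow> real"
    show "norm (\<Sum>p\<in>F. r p *\<^sub>R (case p of (x, y) \<Rightarrow> S x \<otimes>\<^sub>H y))
        \<le> norm S * norm (\<Sum>p\<in>F. r p *\<^sub>R (case p of (x, y) \<Rightarrow> x \<otimes>\<^sub>H y))"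
      using norm_sum_op_tensor_left[OF S, where F = F and x = "\<lambda>p. r p *\<^sub>R fst p" and y = snd]
      by (simp add: case_prod_unfold tensor_scaleR_left blinfun.scaleR_right)
  qed simp
  then show ?thesis by auto
qed

text \<open>Exchanging the factors reduces operators on the second factor to operators on the
  first.\<close>

lemma ex_flip:
  "\<exists>R::('a::chilbert, 'b::chilbert) htensor \<Rightarrow>\<^sub>L ('b, 'a) htensor.
    (\<forall>x y. blinfun_apply R (x \<otimes>\<^sub>H y) = y \<otimes>\<^sub>H x) \<and> norm R \<le> 1"
proof -
  have "\<exists>R::('a, 'b) htensor \<Rightarrow>\<^sub>L ('b, 'a) htensor.
      (\<forall>p. blinfun_apply R (case p of (x, y) \<Rightarrow> x \<otimes>\<^sub>H y) = (case p of (x, y) \<Rightarrow> y \<otimes>\<^sub>H x)) \<and> (\<forall>u. norm (blinfun_apply R u) = norm u)"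
    by (intro ex_isometry_extension closure_span_tensor) (auto simp: cinner_tensor)
  then obtain R :: "('a, 'b) htensor \<Rightarrow>\<^sub>L ('b, 'a) htensor" where
    "\<And>x y. blinfun_apply R (x \<otimes>\<^sub>H y) = y \<otimes>\<^sub>H x" "\<And>u. norm (R u) = norm u" by auto
  then show ?thesis by (intro exI[of _ R]) (auto intro: norm_blinfun_bound)
qed

text \<open>S \<otimes> T is S \<otimes> 1, then a flip, then T \<otimes> 1, then the flip back; the
  norm bounds multiply.\<close>

lemma ex_op_tensor:
  fixes S :: "'a::chilbert \<Rightarrow>\<^sub>L 'c::chilbert" and T :: "'b::chilbert \<Rightarrow>\<^sub>L 'd::chilbert"
  assumes "S \<in> clinear_ops" "T \<in> clinear_ops"
  shows "\<exists>R. (\<forall>x y. blinfun_apply R (x \<otimes>\<^sub>H y) = S x \<otimes>\<^sub>H T y) \<and> norm R \<le> norm S * norm T"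
proof -
  obtain A :: "('a, 'b) htensor \<Rightarrow>\<^sub>L ('c, 'b) htensor" where
    A: "\<And>x y. blinfun_apply A (x \<otimes>\<^sub>H y) = S x \<otimes>\<^sub>H y" "norm A \<le> norm S"
    using ex_op_tensor_left[OF assms(1)] by blast
  obtain B :: "('b, 'c) htensor \<Rightarrow>\<^sub>L ('d, 'c) htensor" where
    B: "\<And>x y. blinfun_apply B (x \<otimes>\<^sub>H y) = T x \<otimes>\<^sub>H y" "norm B \<le> norm T"
    using ex_op_tensor_left[OF assms(2)] by blast
  obtain P :: "('c, 'b) htensor \<Rightarrow>\<^sub>L ('b, 'c) htensor" where
    P: "\<And>x y. blinfun_apply P (x \<otimes>\<^sub>H y) = y \<otimes>\<^sub>H x" "norm P \<le> 1" using ex_flip by blast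
  obtain Q :: "('d, 'c) htensor \<Rightarrow>\<^sub>L ('c, 'd) htensor" where
    Q: "\<And>x y. blinfun_apply Q (x \<otimes>\<^sub>H y) = y \<otimes>\<^sub>H x" "norm Q \<le> 1" using ex_flip by blast
  have "norm (Q o\<^sub>L (B o\<^sub>L (P o\<^sub>L A))) \<le> 1 * (norm T * (1 * norm S))"
    by (intro order_trans[OF norm_blinfun_compose] mult_mono P Q A B) auto
  then show ?thesis
    by (intro exI[of _ "Q o\<^sub>L (B o\<^sub>L (P o\<^sub>L A))"]) (simp add: A B P Q mult.commute)
qed

section \<open>Algebra of tensor products of operators\<close>

lemma op_tensor_eqI:
  assumes "\<And>x y. blinfun_apply R (x \<otimes>\<^sub>H y) = blinfun_apply S x \<otimes>\<^sub>H blinfun_apply T y"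
  shows "op_tensor S T = R"
  unfolding op_tensor_def
proof (rule the_equality)
  show "\<forall>x y. blinfun_apply R (x \<otimes>\<^sub>H y) = blinfun_apply S x \<otimes>\<^sub>H blinfun_apply T y" using assms by blast
  fix R' assume "\<forall>x y. blinfun_apply R' (x \<otimes>\<^sub>H y) = blinfun_apply S x \<otimes>\<^sub>H blinfun_apply T y"
  then show "R' = R" using assms by (intro htensor_blinfun_eqI) simp
qed

lemma
  assumes "S \<in> clinear_ops" "T \<in> clinear_ops"
  shows op_tensor_apply: "op_tensor S T (x \<otimes>\<^sub>H y) = S x \<otimes>\<^sub>H T y"
    and norm_op_tensor_le: "norm (op_tensor S T) \<le> norm S * norm T"
proof -
  obtain R where R: "\<And>x y. blinfun_apply R (x \<otimes>\<^sub>H y) = S x \<otimes>\<^sub>H T y" "norm R \<le> norm S * norm T"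
    using ex_op_tensor[OF assms] by blast
  have "op_tensor S T = R" by (rule op_tensor_eqI) (rule R)
  then show "op_tensor S T (x \<otimes>\<^sub>H y) = S x \<otimes>\<^sub>H T y" "norm (op_tensor S T) \<le> norm S * norm T"
    using R by simp_all
qed

lemma op_tensor_clinear_ops:
  fixes S :: "'a::chilbert \<Rightarrow>\<^sub>L 'c::chilbert" and T :: "'b::chilbert \<Rightarrow>\<^sub>L 'd::chilbert"
  assumes "S \<in> clinear_ops" "T \<in> clinear_ops"
  shows "op_tensor S T \<in> clinear_ops"
proof -
  \<comment> \<open>As an equation of operators, complex homogeneity has to be checked on elementary
    tensors only.\<close>
  have "op_tensor S T o\<^sub>L op_scaleC c id_blinfun = op_scaleC c (op_tensor S T)" for c
    by (rule htensor_blinfun_eqI)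
       (simp add: op_tensor_apply assms clinear_ops_scaleC[OF assms(1)] flip: tensor_scaleC_left)
  then show ?thesis by (auto simp: clinear_ops_def blinfun_eq_iff)
qed

lemma op_tensor_compose:
  assumes "S \<in> clinear_ops" "T \<in> clinear_ops" "S' \<in> clinear_ops" "T' \<in> clinear_ops"
  shows "op_tensor S T o\<^sub>L op_tensor S' T' = op_tensor (S o\<^sub>L S') (T o\<^sub>L T')"
  by (rule op_tensor_eqI[symmetric]) (simp add: op_tensor_apply assms)

lemma op_tensor_id [simp]: "op_tensor id_blinfun id_blinfun = id_blinfun"
  by (rule op_tensor_eqI) simp

lemma op_tensor_scaleC_left:
  assumes "S \<in> clinear_ops" "T \<in> clinear_ops"
  shows "op_tensor (op_scaleC c S) T = op_scaleC c (op_tensor S T)"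
  by (rule op_tensor_eqI) (simp add: op_tensor_apply assms tensor_scaleC_left)

lemma adj_op_tensor:
  assumes "S \<in> clinear_ops" "T \<in> clinear_ops"
  shows "adj (op_tensor S T) = op_tensor (adj S) (adj T)"
proof (rule htensor_blinfun_eqI, rule htensor_vec_eqI)
  fix x y x' y'
  show "cinner (x' \<otimes>\<^sub>H y') (adj (op_tensor S T) (x \<otimes>\<^sub>H y))
      = cinner (x' \<otimes>\<^sub>H y') (op_tensor (adj S) (adj T) (x \<otimes>\<^sub>H y))"
    by (simp add: cinner_adj_right op_tensor_clinear_ops assms op_tensor_apply cinner_tensor
        adj_clinear_ops)
qed

lemma unitary_op_tensor: "unitary U \<Longrightarrow> unitary V \<Longrightarrow> unitary (op_tensor U V)"
  unfolding unitary_def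
  by (simp add: op_tensor_clinear_ops adj_op_tensor op_tensor_compose adj_clinear_ops)

section \<open>Tensor products of C*-algebras and of representations\<close>

lemma op_scaleC_conv_compose: "T \<in> clinear_ops \<Longrightarrow> op_scaleC c T = op_scaleC c id_blinfun o\<^sub>L T"
  by (rule blinfun_eqI) simp

lemma span_bilinear_closed:
  assumes "S \<in> span X" "T \<in> span X" "bounded_bilinear h" "\<And>x y. x \<in> X \<Longrightarrow> y \<in> X \<Longrightarrow> h x y \<in> span X"
  shows "h S T \<in> span X"
proof -
  interpret bounded_bilinear h by fact
  have left: "h x T \<in> span X" if "x \<in> X" for x
    using assms(2)
    by (induction rule: span_induct_alt)
       (auto simp: zero_right add_right scaleR_right intro: span_zero span_add span_scale assms(4) that)
  show ?thesis
    using assms(1)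
    by (induction rule: span_induct_alt)
       (auto simp: zero_left add_left scaleR_left intro: span_zero span_add span_scale left)
qed

text \<open>Stability of X under complex scalars makes its real span a complex one; continuity of
  the operations carries everything to the closure.\<close>

lemma cstar_algebra_closure_span:
  fixes X :: "('a::chilbert \<Rightarrow>\<^sub>L 'a) set"
  assumes X: "X \<subseteq> clinear_ops" "id_blinfun \<in> X"
    and comp: "\<And>S T. S \<in> X \<Longrightarrow> T \<in> X \<Longrightarrow> S o\<^sub>L T \<in> X"
    and scale: "\<And>c T. T \<in> X \<Longrightarrow> op_scaleC c T \<in> X" and adj: "\<And>T. T \<in> X \<Longrightarrow> adj T \<in> X"
  shows "cstar_algebra (closure (span X))"
proof -
  have "subspace (clinear_ops :: ('a \<Rightarrow>\<^sub>L 'a) set)"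
    by (auto simp: subspace_def add_clinear_ops scaleR_clinear_ops)
  then have sC: "span X \<subseteq> clinear_ops" using X(1) by (simp add: span_minimal)
  then have cC: "closure (span X) \<subseteq> clinear_ops" by (intro closure_minimal closed_clinear_ops)
  have span_comp: "S o\<^sub>L T \<in> span X" if "S \<in> span X" "T \<in> span X" for S T
    using that bounded_bilinear_blinfun_compose
    by (rule span_bilinear_closed) (auto intro: comp span_base)
  have span_scaleC: "op_scaleC c T \<in> span X" if "T \<in> span X" for c T
    using that
  proof (induction rule: span_induct_alt)
    case base
    have "op_scaleC c 0 = (0 :: 'a \<Rightarrow>\<^sub>L 'a)" by (rule blinfun_eqI) simp
    then show ?case by (simp add: span_zero)
  next
    case (step r x y)
    have "op_scaleC c (r *\<^sub>R x + y) = r *\<^sub>R op_scaleC c x + op_scaleC c y"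
      by (rule blinfun_eqI) (simp add: blinfun.bilinear_simps scaleC_add_right scaleC_scaleR_commute)
    then show ?case using step scale by (simp add: span_add span_scale span_base)
  qed
  have span_adj: "adj T \<in> span X" if "T \<in> span X" for T
  proof -
    \<comment> \<open>Membership of T is carried along because additivity of \<open>adj\<close> is
      available on \<open>clinear_ops\<close>, where y is known to lie as an element of the
      span.\<close>
    have "T \<in> span X \<and> adj T \<in> span X"
      using that
    proof (induction rule: span_induct_alt)
      case base
      then show ?case by (simp add: span_zero)
    next
      case (step r x y)
      then have C: "x \<in> clinear_ops" "y \<in> clinear_ops" using X(1) sC by auto
      have "adj (r *\<^sub>R x + y) = r *\<^sub>R adj x + adj y"
        by (simp add: adj_add adj_scaleR C scaleR_clinear_ops)
      then show ?case using step adj by (simp add: span_add span_scale span_base)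
    qed
    then show ?thesis ..
  qed
  have "S + T \<in> closure (span X)" if "S \<in> closure (span X)" "T \<in> closure (span X)" for S T
    using that by (rule subspace_add[OF subspace_closure_span])
  moreover have "S o\<^sub>L T \<in> closure (span X)" if ST: "S \<in> closure (span X)" "T \<in> closure (span X)" for S T
  proof -
    from ST obtain P Q where "\<And>n. P n \<in> span X" "P \<longlonglongrightarrow> S" "\<And>n. Q n \<in> span X" "Q \<longlonglongrightarrow> T"
      by (auto simp: closure_sequential)
    then show ?thesis
      unfolding closure_sequential
      by (intro exI[of _ "\<lambda>n. P n o\<^sub>L Q n"]) (auto intro: span_comp tendsto_blinfun_compose)
  qed
  moreover have "op_scaleC c T \<in> closure (span X)" if T: "T \<in> closure (span X)" for c T
  proof -
    from T obtain P where P: "\<And>n. P n \<in> span X" "P \<longlonglongrightarrow> T" by (auto simp: closure_sequential)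
    have TC: "T \<in> clinear_ops" and PC: "P n \<in> clinear_ops" for n using T P(1) sC cC by auto
    \<comment> \<open>A complex scalar is composition with a fixed operator, so continuity of
      composition applies.\<close>
    have "(\<lambda>n. op_scaleC c (P n)) \<longlonglongrightarrow> op_scaleC c T"
      unfolding op_scaleC_conv_compose[OF TC, of c] op_scaleC_conv_compose[OF PC, of c]
      by (intro tendsto_blinfun_compose tendsto_const P(2))
    then show ?thesis
      unfolding closure_sequential using P(1)
      by (intro exI[of _ "\<lambda>n. op_scaleC c (P n)"]) (simp add: span_scaleC)
  qed
  moreover have "adj T \<in> closure (span X)" if T: "T \<in> closure (span X)" for T
  proof -
    from T obtain P where P: "\<And>n. P n \<in> span X" "P \<longlonglongrightarrow> T" by (auto simp: closure_sequential)
    have TC: "T \<in> clinear_ops" and PC: "P n \<in> clinear_ops" for n using T P(1) sC cC by auto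
    have "(\<lambda>n. adj (P n)) \<longlonglongrightarrow> adj T" by (intro tendsto_adj P(2) PC TC)
    then show ?thesis
      unfolding closure_sequential using P(1)
      by (intro exI[of _ "\<lambda>n. adj (P n)"]) (simp add: span_adj)
  qed
  moreover have "id_blinfun \<in> closure (span X)"
    using X(2) by (intro subsetD[OF closure_subset] span_base)
  ultimately show ?thesis using cC by (simp add: cstar_algebra_def)
qed

section \<open>The spatial tensor product as a generated C*-algebra\<close>

lemma cstar_tensor_gens_clinear_ops:
  assumes "cstar_algebra A" "cstar_algebra B"
  shows "{op_tensor S T | S T. S \<in> A \<and> T \<in> B} \<subseteq> clinear_ops"
  using cstar_algebraD(8)[OF assms(1)] cstar_algebraD(8)[OF assms(2)]
  by (auto intro: op_tensor_clinear_ops)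

lemma cstar_algebra_tensor:
  assumes A: "cstar_algebra A" and B: "cstar_algebra B"
  shows "cstar_algebra (cstar_tensor A B)"
  unfolding cstar_tensor_def
proof (rule cstar_algebra_closure_span)
  let ?X = "{op_tensor S T | S T. S \<in> A \<and> T \<in> B}"
  note AD = cstar_algebraD[OF A] and BD = cstar_algebraD[OF B]
  show "?X \<subseteq> clinear_ops" by (rule cstar_tensor_gens_clinear_ops[OF A B])
  show "id_blinfun \<in> ?X" using AD(3) BD(3) op_tensor_id by (metis (mono_tags, lifting) mem_Collect_eq)
  show "u o\<^sub>L v \<in> ?X" if "u \<in> ?X" "v \<in> ?X" for u v
  proof -
    from that obtain S T S' T' where *: "u = op_tensor S T" "v = op_tensor S' T'" "S \<in> A" "T \<in> B"
      "S' \<in> A" "T' \<in> B" by blast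
    then have "u o\<^sub>L v = op_tensor (S o\<^sub>L S') (T o\<^sub>L T')" by (simp add: op_tensor_compose AD(8) BD(8))
    moreover have "S o\<^sub>L S' \<in> A" "T o\<^sub>L T' \<in> B" using * AD(5) BD(5) by blast+
    ultimately show ?thesis by blast
  qed
  show "op_scaleC c u \<in> ?X" if "u \<in> ?X" for c u
  proof -
    from that obtain S T where *: "u = op_tensor S T" "S \<in> A" "T \<in> B" by blast
    then have "op_scaleC c u = op_tensor (op_scaleC c S) T"
      by (simp add: op_tensor_scaleC_left AD(8) BD(8))
    moreover have "op_scaleC c S \<in> A" using * AD(6) by blast
    ultimately show ?thesis using * by blast
  qed
  show "adj u \<in> ?X" if "u \<in> ?X" for u
  proof -
    from that obtain S T where *: "u = op_tensor S T" "S \<in> A" "T \<in> B" by blast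
    then have "adj u = op_tensor (adj S) (adj T)" by (simp add: adj_op_tensor AD(8) BD(8))
    moreover have "adj S \<in> A" "adj T \<in> B" using * AD(7) BD(7) by blast+
    ultimately show ?thesis by blast
  qed
qed

lemma op_tensor_in_cstar_tensor: "S \<in> A \<Longrightarrow> T \<in> B \<Longrightarrow> op_tensor S T \<in> cstar_tensor A B"
  unfolding cstar_tensor_def by (intro subsetD[OF closure_subset] span_base) blast

lemma cstar_tensor_least:
  assumes "cstar_algebra D" "\<And>S T. S \<in> A \<Longrightarrow> T \<in> B \<Longrightarrow> op_tensor S T \<in> D"
  shows "cstar_tensor A B \<subseteq> D"
  unfolding cstar_tensor_def
proof (intro closure_minimal span_minimal)
  show "closed D" by (rule cstar_algebraD(2)[OF assms(1)])
  show "{op_tensor S T | S T. S \<in> A \<and> T \<in> B} \<subseteq> D" using assms(2) by blast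
  show "subspace D"
    unfolding subspace_def
    using cstar_algebraD(4)[OF assms(1)] cstar_algebra_scaleR[OF assms(1)]
      cstar_algebra_scaleR[OF assms(1) cstar_algebraD(3)[OF assms(1)], of 0]
    by auto
qed

text \<open>Brings the tensor product into the form in which homomorphisms are determined by
  generators.\<close>

lemma cstar_tensor_generated:
  assumes "cstar_algebra A" "cstar_algebra B"
  shows "cstar_tensor A B = cstar_generated {op_tensor S T | S T. S \<in> A \<and> T \<in> B}"
proof
  show "cstar_generated {op_tensor S T | S T. S \<in> A \<and> T \<in> B} \<subseteq> cstar_tensor A B"
    by (intro cstar_generated_subset cstar_algebra_tensor assms) (auto intro: op_tensor_in_cstar_tensor)
  show "cstar_tensor A B \<subseteq> cstar_generated {op_tensor S T | S T. S \<in> A \<and> T \<in> B}"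
    by (rule cstar_tensor_least[OF cstar_algebra_generated[OF cstar_tensor_gens_clinear_ops[OF assms]]])
       (intro subsetD[OF generators_subset], blast)
qed

lemma is_rep_cuntz_family:
  assumes "1 \<le> N" "is_rep N \<pi>"
  shows "cuntz_family N (\<lambda>i. \<pi> (cuntz_gen N i))"
proof -
  have hom: "unital_star_hom (cuntz_algebra N) clinear_ops \<pi>" using assms(2) by (simp add: is_rep_def)
  note hD = unital_star_homD[OF hom] and AD = cstar_algebraD[OF cstar_algebra_cuntz[of N]]
  note gen = cuntz_gen_in_algebra
  have fam: "cuntz_family N (cuntz_gen N)" by (rule cuntz_family_cuntz_gen[OF assms(1)])
  have zero: "\<pi> 0 = 0" using hD(7)[OF AD(3), of 0] by simp
  \<comment> \<open>Additivity of \<pi> is available only inside the algebra, so the partial sums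
    are shown to stay there along with the formula.\<close>
  have "\<pi> (\<Sum>i\<in>I. cuntz_gen N i o\<^sub>L adj (cuntz_gen N i))
      = (\<Sum>i\<in>I. \<pi> (cuntz_gen N i) o\<^sub>L adj (\<pi> (cuntz_gen N i))) \<and>
      (\<Sum>i\<in>I. cuntz_gen N i o\<^sub>L adj (cuntz_gen N i)) \<in> cuntz_algebra N"
    if "finite I" "I \<subseteq> {1..N}" for I
    using that
  proof (induction rule: finite_induct)
    case empty
    then show ?case using zero cstar_algebra_scaleR[OF cstar_algebra_cuntz AD(3), of 0] by simp
  next
    case (insert i I)
    then have g: "cuntz_gen N i \<in> cuntz_algebra N" by (intro gen) auto
    have "cuntz_gen N i o\<^sub>L adj (cuntz_gen N i) \<in> cuntz_algebra N" by (intro AD(5) AD(7) g)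
    then show ?case using insert g by (simp add: hD(3,4,6) AD(4,7))
  qed
  from this[of "{1..N}"] have "(\<Sum>i=1..N. \<pi> (cuntz_gen N i) o\<^sub>L adj (\<pi> (cuntz_gen N i))) = id_blinfun"
    using fam hD(2) by (simp add: cuntz_family_def)
  moreover have "adj (\<pi> (cuntz_gen N i)) o\<^sub>L \<pi> (cuntz_gen N j) = (if i = j then id_blinfun else 0)"
    if ij: "i \<in> {1..N}" "j \<in> {1..N}" for i j
  proof -
    have "adj (\<pi> (cuntz_gen N i)) o\<^sub>L \<pi> (cuntz_gen N j) = \<pi> (adj (cuntz_gen N i) o\<^sub>L cuntz_gen N j)"
      by (simp only: hD(4,6) AD(7) gen ij)
    also have "adj (cuntz_gen N i) o\<^sub>L cuntz_gen N j = (if i = j then id_blinfun else 0)"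
      using fam ij by (simp add: cuntz_family_def)
    finally show ?thesis using hD(2) zero by simp
  qed
  moreover have "\<pi> (cuntz_gen N i) \<in> clinear_ops" if "i \<in> {1..N}" for i by (rule hD(1)[OF gen[OF that]])
  ultimately show ?thesis by (simp only: cuntz_family_def) blast
qed

text \<open>The relation extends from the generators because the identity map of the algebra is
  itself a representation: seen through W, \<pi> is that representation.\<close>

lemma ex_rep_intertwiner:
  fixes \<pi> :: "cuntz_op \<Rightarrow> ('a::chilbert \<Rightarrow>\<^sub>L 'a)"
  assumes N: "2 \<le> N" and \<pi>: "is_rep N \<pi>" and F: "countable F"
  shows "\<exists>W. W \<in> clinear_ops \<and> norm W \<le> 1 \<and> (\<forall>x\<in>F. adj W (W x) = x) \<and>
    (\<forall>a\<in>cuntz_algebra N. W o\<^sub>L \<pi> a = a o\<^sub>L W)"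
proof -
  have N1: "1 \<le> N" using N by simp
  obtain W where W: "W \<in> clinear_ops" "norm W \<le> 1" "\<forall>x\<in>F. adj W (W x) = x"
    and gen: "\<And>i. i \<in> {1..N} \<Longrightarrow> intertwines {W} (cuntz_gen N i) (\<pi> (cuntz_gen N i))"
    using ex_cuntz_intertwiner[OF N is_rep_cuntz_family[OF N1 \<pi>] F] by blast
  have "W o\<^sub>L \<pi> a = a o\<^sub>L W" if "a \<in> cuntz_algebra N" for a
  proof (rule unital_star_hom_intertwined[OF cuntz_gens_clinear_ops cuntz_algebra_def])
    show "unital_star_hom (cuntz_algebra N) clinear_ops \<pi>" using \<pi> by (simp add: is_rep_def)
    show "unital_star_hom (cuntz_algebra N) clinear_ops (\<lambda>a. a)"
      by (rule unital_star_hom_id[OF cstar_algebraD(1)[OF cstar_algebra_cuntz]])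
  qed (use W(1) that gen in \<open>auto simp: intertwines_def\<close>)
  then show ?thesis using W by blast
qed

text \<open>V \<otimes> W is isometric at a finite sum v of elementary tensors as soon as V is
  isometrically invertible by its adjoint at every first factor, and W at every second factor.
  Contractivity carries this to nearby u.\<close>

lemma norming_op_tensor:
  fixes \<pi> :: "cuntz_op \<Rightarrow> ('a::chilbert \<Rightarrow>\<^sub>L 'a)" and \<rho> :: "cuntz_op \<Rightarrow> ('b::chilbert \<Rightarrow>\<^sub>L 'b)"
  assumes NM: "2 \<le> N" "2 \<le> M" and \<pi>: "is_rep N \<pi>" and \<rho>: "is_rep M \<rho>"
  shows "norming {op_tensor V W | V W. V \<in> clinear_ops \<and> W \<in> clinear_ops \<and>
    (\<forall>a\<in>cuntz_algebra N. V o\<^sub>L \<pi> a = a o\<^sub>L V) \<and> (\<forall>b\<in>cuntz_algebra M. W o\<^sub>L \<rho> b = b o\<^sub>L W)}"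
    (is "norming ?\<W>")
  unfolding norming_def
proof (intro conjI allI impI)
  show "?\<W> \<subseteq> clinear_ops" by (auto intro: op_tensor_clinear_ops)
  fix u :: "('a, 'b) htensor" and e :: real assume "e > 0"
  have "u \<in> closure (span (range (\<lambda>(x, y). x \<otimes>\<^sub>H y)))" by (simp add: closure_span_tensor)
  \<comment> \<open>e / 2 because the distance is paid twice: in passing from u to v, and from the
    image of v to the image of u.\<close>
  then obtain v where v: "v \<in> span (range (\<lambda>(x, y). x \<otimes>\<^sub>H y))" "dist v u < e / 2"
    using \<open>e > 0\<close> unfolding closure_approachable by (meson half_gt_zero)
  from span_range_explicit[OF v(1)] obtain F r where F: "finite F"
    and v_eq: "v = (\<Sum>p\<in>F. r p *\<^sub>R (case p of (x, y) \<Rightarrow> x \<otimes>\<^sub>H y))" by blast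
  obtain V where V: "V \<in> clinear_ops" "norm V \<le> 1" "\<forall>x\<in>fst ` F. adj V (V x) = x"
    "\<forall>a\<in>cuntz_algebra N. V o\<^sub>L \<pi> a = a o\<^sub>L V"
    using ex_rep_intertwiner[OF NM(1) \<pi>, of "fst ` F"] F by (auto simp: countable_finite)
  obtain W where W: "W \<in> clinear_ops" "norm W \<le> 1" "\<forall>y\<in>snd ` F. adj W (W y) = y"
    "\<forall>b\<in>cuntz_algebra M. W o\<^sub>L \<rho> b = b o\<^sub>L W"
    using ex_rep_intertwiner[OF NM(2) \<rho>, of "snd ` F"] F by (auto simp: countable_finite)
  let ?R = "op_tensor V W"
  have "?R \<in> ?\<W>" using V W by blast
  moreover have nR: "norm ?R \<le> 1"
    by (rule order_trans[OF norm_op_tensor_le[OF V(1) W(1)] mult_le_one[OF V(2) norm_ge_zero W(2)]])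
  moreover have "norm u \<le> norm (?R u) + e"
  proof -
    have VW: "adj V (V x) = x" "adj W (W y) = y" if "(x, y) \<in> F" for x y
      using V(3) W(3) that by force+
    have "adj ?R (?R v) = v"
      unfolding v_eq adj_op_tensor[OF V(1) W(1)] blinfun.sum_right blinfun.scaleR_right
      by (intro sum.cong refl) (auto simp: VW op_tensor_apply V(1) W(1) adj_clinear_ops)
    then have "norm v = norm (?R v)"
      by (simp add: norm_eq_of_adj_fixed op_tensor_clinear_ops V(1) W(1))
    also have "\<dots> \<le> norm (?R u) + norm (?R (v - u))"
      using norm_triangle_ineq[of "?R u" "?R (v - u)"] by (simp add: blinfun.diff_right)
    also have "norm (?R (v - u)) \<le> norm (v - u)"
      using norm_blinfun[of ?R "v - u"] mult_right_mono[OF nR norm_ge_zero[of "v - u"]] by simp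
    finally have "norm v \<le> norm (?R u) + norm (v - u)" by simp
    moreover have "norm u \<le> norm v + norm (v - u)"
      using norm_triangle_sub[of u v] by (simp add: norm_minus_commute)
    ultimately show ?thesis using v(2) by (simp add: dist_norm)
  qed
  ultimately show "\<exists>W\<in>?\<W>. norm W \<le> 1 \<and> norm u \<le> norm (blinfun_apply W u) + e" by blast
qed

text \<open>If V intertwines \<pi> and W intertwines \<rho>, then V \<otimes> W relates S \<otimes>
  T to \<pi> S \<otimes> \<rho> T; so all S \<otimes> T lie in the domain of the homomorphism
  defined by such V \<otimes> W.\<close>

lemma
  fixes \<pi> :: "cuntz_op \<Rightarrow> ('a::chilbert \<Rightarrow>\<^sub>L 'a)" and \<rho> :: "cuntz_op \<Rightarrow> ('b::chilbert \<Rightarrow>\<^sub>L 'b)"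
  assumes NM: "2 \<le> N" "2 \<le> M" and \<pi>: "is_rep N \<pi>" and \<rho>: "is_rep M \<rho>"
  defines "A \<equiv> cuntz_algebra N" and "B \<equiv> cuntz_algebra M"
  shows unital_star_hom_hom_tensor: "unital_star_hom (cstar_tensor A B) clinear_ops (hom_tensor A B \<pi> \<rho>)"
    and hom_tensor_op_tensor:
      "\<And>S T. S \<in> A \<Longrightarrow> T \<in> B \<Longrightarrow> hom_tensor A B \<pi> \<rho> (op_tensor S T) = op_tensor (\<pi> S) (\<rho> T)"
proof -
  have A: "cstar_algebra A" and B: "cstar_algebra B" by (simp_all add: A_def B_def cstar_algebra_cuntz)
  have AC: "S \<in> clinear_ops" if "S \<in> A" for S by (rule cstar_algebraD(8)[OF A that])
  have BC: "T \<in> clinear_ops" if "T \<in> B" for T by (rule cstar_algebraD(8)[OF B that])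
  have hom: "unital_star_hom A clinear_ops \<pi>" "unital_star_hom B clinear_ops \<rho>"
    using \<pi> \<rho> by (simp_all add: is_rep_def A_def B_def)
  define \<W> where "\<W> = {op_tensor V W | V W. V \<in> clinear_ops \<and> W \<in> clinear_ops \<and>
    (\<forall>a\<in>A. V o\<^sub>L \<pi> a = a o\<^sub>L V) \<and> (\<forall>b\<in>B. W o\<^sub>L \<rho> b = b o\<^sub>L W)}"
  have norming: "norming \<W>" unfolding \<W>_def A_def B_def by (rule norming_op_tensor[OF NM \<pi> \<rho>])
  define f where "f u = (THE R. intertwines \<W> u R)" for u
  \<comment> \<open>The default value outside the algebra is what makes the definite description
    unique.\<close>
  define g where "g = restrict f (cstar_tensor A B)"
  have gen: "intertwines \<W> (op_tensor S T) (op_tensor (\<pi> S) (\<rho> T))" if ST: "S \<in> A" "T \<in> B" for S T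
  proof -
    note C = AC[OF ST(1)] BC[OF ST(2)] unital_star_homD(1)[OF hom(1) ST(1)] unital_star_homD(1)[OF hom(2) ST(2)]
    have adjs: "adj S \<in> A" "adj T \<in> B" using cstar_algebraD(7)[OF A ST(1)] cstar_algebraD(7)[OF B ST(2)] .
    have "U o\<^sub>L op_tensor (\<pi> S) (\<rho> T) = op_tensor S T o\<^sub>L U \<and>
        U o\<^sub>L adj (op_tensor (\<pi> S) (\<rho> T)) = adj (op_tensor S T) o\<^sub>L U" if U: "U \<in> \<W>" for U
    proof -
      obtain V W where VW: "U = op_tensor V W" "V \<in> clinear_ops" "W \<in> clinear_ops"
        and V: "\<And>a. a \<in> A \<Longrightarrow> V o\<^sub>L \<pi> a = a o\<^sub>L V" and W: "\<And>b. b \<in> B \<Longrightarrow> W o\<^sub>L \<rho> b = b o\<^sub>L W"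
        using U unfolding \<W>_def by blast
      have "V o\<^sub>L adj (\<pi> S) = adj S o\<^sub>L V" "W o\<^sub>L adj (\<rho> T) = adj T o\<^sub>L W"
        using V[OF adjs(1)] W[OF adjs(2)] unital_star_homD(6)[OF hom(1) ST(1)]
          unital_star_homD(6)[OF hom(2) ST(2)] by simp_all
      then show ?thesis
        by (simp add: VW op_tensor_compose adj_op_tensor C adj_clinear_ops V[OF ST(1)] W[OF ST(2)])
    qed
    then show ?thesis by (simp add: intertwines_def op_tensor_clinear_ops C)
  qed
  have "cstar_tensor A B \<subseteq> {u. \<exists>R. intertwines \<W> u R}"
    using gen by (intro cstar_tensor_least intertwines_cstar_algebra norming) blast
  then have "unital_star_hom (cstar_tensor A B) clinear_ops f"
    unfolding f_def by (rule unital_star_hom_subset[OF _ intertwines_hom[OF norming]])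
  then have "unital_star_hom (cstar_tensor A B) clinear_ops g"
    unfolding g_def by (intro unital_star_hom_restrict cstar_algebra_tensor A B)
  moreover have "g (op_tensor S T) = op_tensor (\<pi> S) (\<rho> T)" if "S \<in> A" "T \<in> B" for S T
    using intertwines_the[OF norming gen[OF that]] op_tensor_in_cstar_tensor[OF that]
    by (simp add: g_def f_def)
  moreover have "g \<in> extensional (cstar_tensor A B)" by (simp add: g_def)
  ultimately have "\<exists>!f. f \<in> extensional (cstar_tensor A B) \<and>
      unital_star_hom (cstar_tensor A B) clinear_ops f \<and>
      (\<forall>S\<in>A. \<forall>T\<in>B. f (op_tensor S T) = op_tensor (\<pi> S) (\<rho> T))"
  proof (intro ex1I[of _ g] conjI ballI)
    fix h assume h: "h \<in> extensional (cstar_tensor A B) \<and>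
      unital_star_hom (cstar_tensor A B) clinear_ops h \<and>
      (\<forall>S\<in>A. \<forall>T\<in>B. h (op_tensor S T) = op_tensor (\<pi> S) (\<rho> T))"
    assume g: "unital_star_hom (cstar_tensor A B) clinear_ops g" "g \<in> extensional (cstar_tensor A B)"
      "\<And>S T. S \<in> A \<Longrightarrow> T \<in> B \<Longrightarrow> g (op_tensor S T) = op_tensor (\<pi> S) (\<rho> T)"
    show "h = g"
    proof (rule extensionalityI)
      show "h u = g u" if "u \<in> cstar_tensor A B" for u
        by (rule unital_star_hom_unique[OF cstar_tensor_gens_clinear_ops[OF A B]
              cstar_tensor_generated[OF A B] _ order_refl g(1) order_refl _ that])
           (use h g(3) in auto)
    qed (use h g in auto)
  qed auto
  from theI'[OF this] show "unital_star_hom (cstar_tensor A B) clinear_ops (hom_tensor A B \<pi> \<rho>)"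
    and "\<And>S T. S \<in> A \<Longrightarrow> T \<in> B \<Longrightarrow> hom_tensor A B \<pi> \<rho> (op_tensor S T) = op_tensor (\<pi> S) (\<rho> T)"
    unfolding hom_tensor_def by blast+
qed

section \<open>The embedding of the Cuntz algebras\<close>

text \<open>With indices starting at 1, k = M (i - 1) + j is division of k - 1 by M, with quotient i
  - 1 and remainder j - 1.\<close>

lemma cuntz_index:
  fixes i j k M N :: nat
  assumes "i \<in> {1..N}" "j \<in> {1..M}" "k = M * (i - 1) + j"
  shows "(k - 1) div M + 1 = i" "(k - 1) mod M + 1 = j" "k \<in> {1..N * M}"
proof -
  from assms obtain a b where ab: "i = Suc a" "j = Suc b" "a < N" "b < M" by (cases i; cases j) auto
  have "M * a + M \<le> M * N" using ab(3) mult_le_mono2[of "Suc a" N M] by simp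
  then show "(k - 1) div M + 1 = i" "(k - 1) mod M + 1 = j" "k \<in> {1..N * M}"
    using ab assms(3) by (auto simp: mult.commute)
qed

lemma cuntz_index_ex:
  fixes k M N :: nat
  assumes "k \<in> {1..N * M}"
  shows "\<exists>i\<in>{1..N}. \<exists>j\<in>{1..M}. k = M * (i - 1) + j"
proof -
  have "M > 0" using assms by (cases M) auto
  moreover have "(k - 1) div M < N" using assms by (intro less_mult_imp_div_less) auto
  moreover have "k = M * ((k - 1) div M) + ((k - 1) mod M + 1)" using assms by simp
  ultimately show ?thesis
    by (intro bexI[of _ "(k - 1) div M + 1"] bexI[of _ "(k - 1) mod M + 1"]) (auto simp: Suc_le_eq)
qed

lemma sum_cuntz_index:
  fixes f :: "nat \<Rightarrow> nat \<Rightarrow> 'a::comm_monoid_add"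
  shows
  "(\<Sum>k=1..N * M. f ((k - 1) div M + 1) ((k - 1) mod M + 1)) = (\<Sum>i=1..N. \<Sum>j=1..M. f i j)"
proof -
  have "(\<Sum>i=1..N. \<Sum>j=1..M. f i j) = (\<Sum>(i, j)\<in>{1..N} \<times> {1..M}. f i j)"
    by (rule sum.cartesian_product)
  also have "\<dots> = (\<Sum>k=1..N * M. f ((k - 1) div M + 1) ((k - 1) mod M + 1))"
  proof (rule sum.reindex_bij_witness[where j = "\<lambda>(i, j). M * (i - 1) + j"
        and i = "\<lambda>k. ((k - 1) div M + 1, (k - 1) mod M + 1)"])
    fix k assume k: "k \<in> {1..N * M}"
    from cuntz_index_ex[OF k] obtain i j where ij: "i \<in> {1..N}" "j \<in> {1..M}" "k = M * (i - 1) + j"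
      by blast
    note * = cuntz_index[OF ij]
    show "(case ((k - 1) div M + 1, (k - 1) mod M + 1) of (i, j) \<Rightarrow> M * (i - 1) + j) = k"
      unfolding * using ij(3) by simp
    show "((k - 1) div M + 1, (k - 1) mod M + 1) \<in> {1..N} \<times> {1..M}"
      unfolding * using ij(1,2) by simp
  next
    fix p assume "p \<in> {1..N} \<times> {1..M}"
    then obtain i j where p: "p = (i, j)" and ij: "i \<in> {1..N}" "j \<in> {1..M}" by blast
    note * = cuntz_index[OF ij refl]
    show "(((case p of (i, j) \<Rightarrow> M * (i - 1) + j) - 1) div M + 1,
        ((case p of (i, j) \<Rightarrow> M * (i - 1) + j) - 1) mod M + 1) = p"
      unfolding p prod.case * ..
    show "(case p of (i, j) \<Rightarrow> M * (i - 1) + j) \<in> {1..N * M}"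
      unfolding p prod.case by (rule *(3))
    show "f (((case p of (i, j) \<Rightarrow> M * (i - 1) + j) - 1) div M + 1)
        (((case p of (i, j) \<Rightarrow> M * (i - 1) + j) - 1) mod M + 1) = (case p of (i, j) \<Rightarrow> f i j)"
      unfolding p prod.case * ..
  qed
  finally show ?thesis ..
qed

text \<open>Ranges are orthogonal as soon as one factor differs, and the sum over k splits into the
  tensor product of the two complete sums.\<close>

lemma cuntz_family_tensor:
  fixes s :: "nat \<Rightarrow> ('a::chilbert \<Rightarrow>\<^sub>L 'a)" and t :: "nat \<Rightarrow> ('b::chilbert \<Rightarrow>\<^sub>L 'b)"
  assumes s: "cuntz_family N s" and t: "cuntz_family M t"
  shows "cuntz_family (N * M) (\<lambda>k. op_tensor (s ((k - 1) div M + 1)) (t ((k - 1) mod M + 1)))"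
    (is "cuntz_family _ ?w")
proof -
  have C: "s i \<in> clinear_ops" "t j \<in> clinear_ops" if "i \<in> {1..N}" "j \<in> {1..M}" for i j
    using that cuntz_family_clinear_ops[OF s] cuntz_family_clinear_ops[OF t] by auto
  have sum: "(\<Sum>k=1..N * M. ?w k o\<^sub>L adj (?w k)) = id_blinfun"
  proof (rule htensor_blinfun_eqI)
    fix x y
    have "(\<Sum>k=1..N * M. ?w k o\<^sub>L adj (?w k)) (x \<otimes>\<^sub>H y)
        = (\<Sum>i=1..N. \<Sum>j=1..M. (op_tensor (s i) (t j) o\<^sub>L adj (op_tensor (s i) (t j))) (x \<otimes>\<^sub>H y))"
      by (simp only: sum_cuntz_index[of "\<lambda>i j. op_tensor (s i) (t j) o\<^sub>L adj (op_tensor (s i) (t j))"]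
          blinfun.sum_left)
    also have "\<dots> = (\<Sum>i=1..N. \<Sum>j=1..M. s i (adj (s i) x) \<otimes>\<^sub>H t j (adj (t j) y))"
      by (intro sum.cong refl) (simp add: C adj_op_tensor op_tensor_apply adj_clinear_ops)
    also have "\<dots> = (\<Sum>i=1..N. s i (adj (s i) x)) \<otimes>\<^sub>H (\<Sum>j=1..M. t j (adj (t j) y))"
      by (simp only: tensor_sum_left) (simp only: tensor_sum_right)
    also have "\<dots> = x \<otimes>\<^sub>H y" by (simp only: cuntz_family_sum[OF s] cuntz_family_sum[OF t])
    finally show "(\<Sum>k=1..N * M. ?w k o\<^sub>L adj (?w k)) (x \<otimes>\<^sub>H y) = id_blinfun (x \<otimes>\<^sub>H y)" by simp
  qed
  have rel: "?w k \<in> clinear_ops \<and> adj (?w k) o\<^sub>L ?w l = (if k = l then id_blinfun else 0)"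
    if kl: "k \<in> {1..N * M}" "l \<in> {1..N * M}" for k l
  proof -
    from cuntz_index_ex[OF kl(1)] obtain i j where ij: "i \<in> {1..N}" "j \<in> {1..M}" "k = M * (i - 1) + j"
      by blast
    from cuntz_index_ex[OF kl(2)] obtain i' j' where
      ij': "i' \<in> {1..N}" "j' \<in> {1..M}" "l = M * (i' - 1) + j'" by blast
    note idx = cuntz_index(1,2)[OF ij] cuntz_index(1,2)[OF ij']
    have kl: "k = l \<longleftrightarrow> i = i' \<and> j = j'" using idx ij(3) ij'(3) by metis
    note C = C[OF ij(1,2)] C[OF ij'(1,2)]
    have "adj (op_tensor (s i) (t j)) o\<^sub>L op_tensor (s i') (t j') = (if k = l then id_blinfun else 0)"
      by (rule htensor_blinfun_eqI)
         (use ij(1,2) ij'(1,2) in \<open>simp add: kl adj_op_tensor op_tensor_apply C adj_clinear_ops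
           cuntz_family_apply[OF s] cuntz_family_apply[OF t]\<close>)
    then show ?thesis unfolding idx using C op_tensor_clinear_ops by blast
  qed
  show ?thesis unfolding cuntz_family_def using sum rel by blast
qed

text \<open>The operators t_i \<otimes> r_j, renumbered, form a Cuntz family on the tensor space.
  Universality yields the homomorphism, and \<open>unital_star_hom_range\<close> puts its values
  into the tensor algebra.\<close>

lemma
  assumes NM: "2 \<le> N" "2 \<le> M"
  shows unital_star_hom_cuntz_embed: "unital_star_hom (cuntz_algebra (N * M))
      (cstar_tensor (cuntz_algebra N) (cuntz_algebra M)) (cuntz_embed N M)"
    and cuntz_embed_gen: "\<And>i j. i \<in> {1..N} \<Longrightarrow> j \<in> {1..M} \<Longrightarrow>
      cuntz_embed N M (cuntz_gen (N * M) (M * (i - 1) + j)) = op_tensor (cuntz_gen N i) (cuntz_gen M j)"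
proof -
  let ?A = "cuntz_algebra (N * M)" and ?C = "cstar_tensor (cuntz_algebra N) (cuntz_algebra M)"
  define w where "w k = op_tensor (cuntz_gen N ((k - 1) div M + 1)) (cuntz_gen M ((k - 1) mod M + 1))" for k
  have w_idx: "w (M * (i - 1) + j) = op_tensor (cuntz_gen N i) (cuntz_gen M j)"
    if "i \<in> {1..N}" "j \<in> {1..M}" for i j
    unfolding w_def cuntz_index(1,2)[OF that refl] ..
  have C: "cstar_algebra ?C" by (intro cstar_algebra_tensor cstar_algebra_cuntz)
  have "cuntz_family (N * M) w"
    unfolding w_def using NM by (intro cuntz_family_tensor cuntz_family_cuntz_gen) auto
  moreover have "2 \<le> N * M" using NM mult_le_mono[of 2 N 1 M] by simp
  ultimately obtain \<pi> where "is_rep (N * M) \<pi>" and \<pi>: "\<And>k. k \<in> {1..N * M} \<Longrightarrow> \<pi> (cuntz_gen (N * M) k) = w k"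
    using cuntz_algebra_universal by blast
  then have hom: "unital_star_hom ?A clinear_ops \<pi>" by (simp add: is_rep_def)
  have \<pi>C: "unital_star_hom ?A ?C \<pi>"
  proof (rule unital_star_hom_range[OF cuntz_gens_clinear_ops cuntz_algebra_def hom order_refl C])
    fix a assume "a \<in> cuntz_gen (N * M) ` {1..N * M}"
    then obtain k where k: "k \<in> {1..N * M}" "a = cuntz_gen (N * M) k" by blast
    from cuntz_index_ex[OF k(1)] obtain i j where
      ij: "i \<in> {1..N}" "j \<in> {1..M}" "k = M * (i - 1) + j" by blast
    have "\<pi> a = op_tensor (cuntz_gen N i) (cuntz_gen M j)"
      using \<pi>[OF k(1)] k(2) ij(3) w_idx[OF ij(1,2)] by simp
    then show "\<pi> a \<in> ?C"
      using op_tensor_in_cstar_tensor[OF cuntz_gen_in_algebra[OF ij(1)] cuntz_gen_in_algebra[OF ij(2)]]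
      by simp
  qed
  define g where "g = restrict \<pi> ?A"
  have g1: "unital_star_hom ?A ?C g"
    unfolding g_def by (rule unital_star_hom_restrict[OF cstar_algebra_cuntz \<pi>C])
  have g2: "g (cuntz_gen (N * M) (M * (i - 1) + j)) = op_tensor (cuntz_gen N i) (cuntz_gen M j)"
    if "i \<in> {1..N}" "j \<in> {1..M}" for i j
    using cuntz_index(3)[OF that refl] \<pi> w_idx[OF that] by (simp add: g_def cuntz_gen_in_algebra)
  have g3: "g \<in> extensional ?A" by (simp add: g_def)
  have "\<exists>!f. f \<in> extensional ?A \<and> unital_star_hom ?A ?C f \<and> (\<forall>i\<in>{1..N}. \<forall>j\<in>{1..M}.
        f (cuntz_gen (N * M) (M * (i - 1) + j)) = op_tensor (cuntz_gen N i) (cuntz_gen M j))"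
  proof (intro ex1I[of _ g] conjI ballI g1 g2 g3; (elim conjE)?)
    fix h assume h: "h \<in> extensional ?A" "unital_star_hom ?A ?C h"
      and gen: "\<forall>i\<in>{1..N}. \<forall>j\<in>{1..M}.
        h (cuntz_gen (N * M) (M * (i - 1) + j)) = op_tensor (cuntz_gen N i) (cuntz_gen M j)"
    note CC = cstar_algebraD(1)[OF C]
    show "h = g"
    proof (rule extensionalityI[OF h(1) g3])
      show "h u = g u" if "u \<in> ?A" for u
      proof (rule unital_star_hom_unique[OF cuntz_gens_clinear_ops cuntz_algebra_def h(2) CC g1 CC _ that])
        fix a assume "a \<in> cuntz_gen (N * M) ` {1..N * M}"
        then obtain k where k: "k \<in> {1..N * M}" "a = cuntz_gen (N * M) k" by blast
        from cuntz_index_ex[OF k(1)] obtain i j where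
          ij: "i \<in> {1..N}" "j \<in> {1..M}" "k = M * (i - 1) + j" by blast
        then show "h a = g a" using gen g2[OF ij(1,2)] k(2) by simp
      qed
    qed
  qed
  from theI'[OF this] show "unital_star_hom ?A ?C (cuntz_embed N M)"
    and "\<And>i j. i \<in> {1..N} \<Longrightarrow> j \<in> {1..M} \<Longrightarrow>
      cuntz_embed N M (cuntz_gen (N * M) (M * (i - 1) + j)) = op_tensor (cuntz_gen N i) (cuntz_gen M j)"
    unfolding cuntz_embed_def by blast+
qed

section \<open>The tensor product of representations\<close>

lemma is_rep_phi_tensor:
  assumes "2 \<le> N" "2 \<le> M" "is_rep N \<pi>" "is_rep M \<rho>"
  shows "is_rep (N * M) (phi_tensor N M \<pi> \<rho>)"
  unfolding is_rep_def phi_tensor_def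
  by (rule unital_star_hom_comp[OF unital_star_hom_cuntz_embed unital_star_hom_hom_tensor])
     (use assms in simp_all)

text \<open>Together with \<open>is_rep_phi_tensor\<close>, this is all that the three claims use of
  the embedding and of \<open>hom_tensor\<close>.\<close>

lemma phi_tensor_gen:
  assumes "2 \<le> N" "2 \<le> M" "is_rep N \<pi>" "is_rep M \<rho>" "i \<in> {1..N}" "j \<in> {1..M}"
  shows "phi_tensor N M \<pi> \<rho> (cuntz_gen (N * M) (M * (i - 1) + j))
    = op_tensor (\<pi> (cuntz_gen N i)) (\<rho> (cuntz_gen M j))"
  unfolding phi_tensor_def o_apply cuntz_embed_gen[OF assms(1,2,5,6)]
  by (rule hom_tensor_op_tensor[OF assms(1-4)]) (use assms(5,6) in \<open>auto intro: cuntz_gen_in_algebra\<close>)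

lemma is_rep_gen_clinear_ops:
  assumes "is_rep N \<pi>" "i \<in> {1..N}"
  shows "\<pi> (cuntz_gen N i) \<in> clinear_ops"
  using assms(1) cuntz_gen_in_algebra[OF assms(2)] unfolding is_rep_def by (rule unital_star_homD(1))

text \<open>Taking adjoints and multiplying by U on both sides turns the relation for a generator
  into the one for its adjoint, so generators decide.\<close>

lemma rep_eq_viaI:
  assumes \<pi>: "is_rep N \<pi>" and \<pi>': "is_rep N \<pi>'" and U: "unitary U"
    and gen: "\<And>i. i \<in> {1..N} \<Longrightarrow> U o\<^sub>L \<pi> (cuntz_gen N i) = \<pi>' (cuntz_gen N i) o\<^sub>L U"
  shows "rep_eq_via N U \<pi> \<pi>'"
proof -
  note UD = unitaryD[OF U]
  have "U o\<^sub>L \<pi> a = \<pi>' a o\<^sub>L U" if a: "a \<in> cuntz_algebra N" for a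
  proof (rule unital_star_hom_intertwined[OF cuntz_gens_clinear_ops cuntz_algebra_def _ order_refl
        _ order_refl UD(1) _ _ a])
    show "unital_star_hom (cuntz_algebra N) clinear_ops \<pi>"
      "unital_star_hom (cuntz_algebra N) clinear_ops \<pi>'"
      using \<pi> \<pi>' by (simp_all add: is_rep_def)
    fix b assume "b \<in> cuntz_gen N ` {1..N}"
    then obtain i where i: "i \<in> {1..N}" "b = cuntz_gen N i" by blast
    then show 1: "U o\<^sub>L \<pi> b = \<pi>' b o\<^sub>L U" using gen by simp
    have C: "\<pi> b \<in> clinear_ops" "\<pi>' b \<in> clinear_ops"
      using is_rep_gen_clinear_ops[OF \<pi> i(1)] is_rep_gen_clinear_ops[OF \<pi>' i(1)] i(2) by simp_all
    have "adj (U o\<^sub>L \<pi> b) = adj (\<pi>' b o\<^sub>L U)" by (simp only: 1)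
    then have "adj (\<pi> b) o\<^sub>L adj U = adj U o\<^sub>L adj (\<pi>' b)" by (simp add: adj_compose C UD(1))
    then have "adj (\<pi> b) (adj U y) = adj U (adj (\<pi>' b) y)" for y by (simp add: blinfun_eq_iff)
    from this[of "U _"] show "U o\<^sub>L adj (\<pi> b) = adj (\<pi>' b) o\<^sub>L U"
      by (intro blinfun_eqI) (simp add: UD(4,5))
  qed
  then have "U o\<^sub>L \<pi> a o\<^sub>L adj U = \<pi>' a" if "a \<in> cuntz_algebra N" for a
    using that by (simp add: blinfun_eq_iff UD(5))
  then show ?thesis using \<pi> \<pi>' U by (simp add: rep_eq_via_def)
qed

lemma rep_eq_via_gen:
  assumes "rep_eq_via N U \<pi> \<pi>'" "i \<in> {1..N}"
  shows "U (\<pi> (cuntz_gen N i) x) = \<pi>' (cuntz_gen N i) (U x)"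
proof -
  have "unitary U" and "U o\<^sub>L \<pi> (cuntz_gen N i) o\<^sub>L adj U = \<pi>' (cuntz_gen N i)"
    using assms cuntz_gen_in_algebra[OF assms(2)] by (auto simp: rep_eq_via_def)
  then show ?thesis by (simp add: blinfun_eq_iff unitaryD(4) flip: blinfun_apply_blinfun_compose)
     (metis blinfun_apply_blinfun_compose unitaryD(4))
qed

section \<open>Direct sums of representations\<close>

lemma op_sum_apply: "op_sum S T x = (S (fst x), T (snd x))"
proof -
  have "bounded_linear (\<lambda>x. (S (fst x), T (snd x)))"
    by (intro bounded_linear_Pair bounded_linear_compose[OF blinfun.bounded_linear_right]
        bounded_linear_fst bounded_linear_snd)
  then show ?thesis by (simp add: op_sum_def bounded_linear_Blinfun_apply)
qed

lemma is_rep_rep_sum: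
  assumes "is_rep N \<pi>" "is_rep N \<rho>"
  shows "is_rep N (rep_sum \<pi> \<rho>)"
proof -
  have \<pi>: "unital_star_hom (cuntz_algebra N) clinear_ops \<pi>"
    and \<rho>: "unital_star_hom (cuntz_algebra N) clinear_ops \<rho>" using assms by (simp_all add: is_rep_def)
  note D = unital_star_homD[OF \<pi>] unital_star_homD[OF \<rho>]
  have C: "op_sum S T \<in> clinear_ops" if "S \<in> clinear_ops" "T \<in> clinear_ops" for S T
    using that by (simp add: clinear_ops_def op_sum_apply scaleC_prod_def)
  have adj: "adj (op_sum S T) = op_sum (adj S) (adj T)"
    if "S \<in> clinear_ops" "T \<in> clinear_ops" for S T
    by (rule adj_eqI) (simp add: op_sum_apply cinner_prod_def cinner_adj_left that)
  show ?thesis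
    unfolding is_rep_def unital_star_hom_def
    by (auto simp: rep_sum_def D C adj blinfun_eq_iff op_sum_apply blinfun.bilinear_simps scaleC_prod_def)
qed

section \<open>Total families in iterated tensor products and in direct sums, and the canonical
  unitaries\<close>

lemma closed_subspace_vimage:
  assumes "bounded_linear f" "closed C" "subspace C"
  shows "closed {x. f x \<in> C}" "subspace {x. f x \<in> C}"
proof -
  interpret bounded_linear f by fact
  have "continuous_on UNIV f" by (intro continuous_on continuous_on_id)
  from closed_vimage[OF assms(2) this] show "closed {x. f x \<in> C}" by (simp add: vimage_def)
  show "subspace {x. f x \<in> C}"
    using assms(3) by (auto simp: subspace_def zero add scaleR)
qed

text \<open>Two nested inductions: for fixed x, membership of x \<otimes> v in the closed span is a
  closed linear condition on v.\<close>

lemma dense_tensor_tensor_right: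
  "closure (span (range (\<lambda>(x, y, z). x \<otimes>\<^sub>H (y \<otimes>\<^sub>H z)))) =
    (UNIV :: ('a::chilbert, ('b::chilbert, 'c::chilbert) htensor) htensor set)"
proof -
  let ?C = "closure (span (range (\<lambda>(x, y, z). x \<otimes>\<^sub>H (y \<otimes>\<^sub>H z)))) ::
    ('a, ('b, 'c) htensor) htensor set"
  have C: "closed ?C" "subspace ?C" by (simp_all add: subspace_closure_span)
  have "u \<in> ?C" for u
  proof (rule htensor_closed_subspace[OF C])
    fix x :: 'a and v :: "('b, 'c) htensor"
    note V = closed_subspace_vimage[OF bounded_linear_tensor_right[of x] C]
    have "v \<in> {v. x \<otimes>\<^sub>H v \<in> ?C}"
    proof (rule htensor_closed_subspace[OF V])
      fix y :: 'b and z :: 'c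
      have "x \<otimes>\<^sub>H (y \<otimes>\<^sub>H z) \<in> range (\<lambda>(x, y, z). x \<otimes>\<^sub>H (y \<otimes>\<^sub>H z))"
        by (intro image_eqI[where x = "(x, y, z)"]) auto
      then show "y \<otimes>\<^sub>H z \<in> {v. x \<otimes>\<^sub>H v \<in> ?C}"
        by (auto intro!: subsetD[OF closure_subset] span_base)
    qed
    then show "x \<otimes>\<^sub>H v \<in> ?C" by simp
  qed
  then show ?thesis by blast
qed

lemma dense_tensor_tensor_left:
  "closure (span (range (\<lambda>(x, y, z). (x \<otimes>\<^sub>H y) \<otimes>\<^sub>H z))) =
    (UNIV :: (('a::chilbert, 'b::chilbert) htensor, 'c::chilbert) htensor set)"
proof -
  let ?C = "closure (span (range (\<lambda>(x, y, z). (x \<otimes>\<^sub>H y) \<otimes>\<^sub>H z))) ::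
    (('a, 'b) htensor, 'c) htensor set"
  have C: "closed ?C" "subspace ?C" by (simp_all add: subspace_closure_span)
  have "u \<in> ?C" for u
  proof (rule htensor_closed_subspace[OF C])
    fix v :: "('a, 'b) htensor" and z :: 'c
    note V = closed_subspace_vimage[OF bounded_linear_tensor_left[of z] C]
    have "v \<in> {v. v \<otimes>\<^sub>H z \<in> ?C}"
    proof (rule htensor_closed_subspace[OF V])
      fix x :: 'a and y :: 'b
      have "(x \<otimes>\<^sub>H y) \<otimes>\<^sub>H z \<in> range (\<lambda>(x, y, z). (x \<otimes>\<^sub>H y) \<otimes>\<^sub>H z)"
        by (intro image_eqI[where x = "(x, y, z)"]) auto
      then show "x \<otimes>\<^sub>H y \<in> {v. v \<otimes>\<^sub>H z \<in> ?C}"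
        by (auto intro!: subsetD[OF closure_subset] span_base)
    qed
    then show "v \<otimes>\<^sub>H z \<in> ?C" by simp
  qed
  then show ?thesis by blast
qed

lemma dense_tensor_Pair:
  "closure (span (range (\<lambda>(x, y, z). x \<otimes>\<^sub>H (y, z)))) =
    (UNIV :: ('a::chilbert, 'b::chilbert \<times> 'c::chilbert) htensor set)"
proof -
  have "range (\<lambda>(x, y, z). x \<otimes>\<^sub>H (y, z)) = (range (\<lambda>(x, p). x \<otimes>\<^sub>H p) :: ('a, 'b \<times> 'c) htensor set)"
    by (auto simp: image_def)
  then show ?thesis by (simp add: closure_span_tensor)
qed

text \<open>Setting z = 0 or y = 0 puts each summand into the closed span separately.\<close>

lemma dense_Pair_tensor:
  "closure (span (range (\<lambda>(x, y, z). (x \<otimes>\<^sub>H y, x \<otimes>\<^sub>H z)))) =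
    (UNIV :: (('a::chilbert, 'b::chilbert) htensor \<times> ('a, 'c::chilbert) htensor) set)"
proof -
  let ?C = "closure (span (range (\<lambda>(x, y, z). (x \<otimes>\<^sub>H y, x \<otimes>\<^sub>H z)))) ::
    (('a, 'b) htensor \<times> ('a, 'c) htensor) set"
  have C: "closed ?C" "subspace ?C" by (simp_all add: subspace_closure_span)
  have gen: "(x \<otimes>\<^sub>H y, x \<otimes>\<^sub>H z) \<in> ?C" for x y z
    by (intro subsetD[OF closure_subset] span_base image_eqI[where x = "(x, y, z)"]) auto
  have bl: "bounded_linear (\<lambda>u. (u, 0))" "bounded_linear (\<lambda>v. (0, v))"
    by (intro bounded_linear_Pair bounded_linear_ident bounded_linear_zero)+
  have "(u, 0) \<in> ?C" for u
    using htensor_closed_subspace[OF closed_subspace_vimage[OF bl(1) C], of u] gen[of _ _ 0] by simp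
  moreover have "(0, v) \<in> ?C" for v
    using htensor_closed_subspace[OF closed_subspace_vimage[OF bl(2) C], of v] gen[of _ 0] by simp
  ultimately have "(u, v) \<in> ?C" for u v
    using subspace_add[OF C(2), of "(u, 0)" "(0, v)"] by simp
  then show ?thesis by auto
qed

text \<open>Both families have the Gram matrix <x, x'> (<y, y'> + <z, z'>), and a complex scalar can
  be moved into x.\<close>

lemma ex_distributor:
  "\<exists>U::('a::chilbert, 'b::chilbert \<times> 'c::chilbert) htensor \<Rightarrow>\<^sub>L (('a, 'b) htensor \<times> ('a, 'c) htensor).
    (\<forall>x y z. blinfun_apply U (x \<otimes>\<^sub>H (y, z)) = (x \<otimes>\<^sub>H y, x \<otimes>\<^sub>H z)) \<and> unitary U"
proof -
  have "\<exists>U::('a, 'b \<times> 'c) htensor \<Rightarrow>\<^sub>L (('a, 'b) htensor \<times> ('a, 'c) htensor).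
    (\<forall>p. blinfun_apply U ((\<lambda>(x, y, z). x \<otimes>\<^sub>H (y, z)) p) = (\<lambda>(x, y, z). (x \<otimes>\<^sub>H y, x \<otimes>\<^sub>H z)) p) \<and> unitary U"
  proof (rule ex_unitary_extension[OF dense_tensor_Pair dense_Pair_tensor])
    show "\<exists>q. (\<lambda>(x, y, z). x \<otimes>\<^sub>H (y, z)) q = c *\<^sub>C ((\<lambda>(x, y, z). x \<otimes>\<^sub>H (y, z)) p) \<and>
        (\<lambda>(x, y, z). (x \<otimes>\<^sub>H y, x \<otimes>\<^sub>H z)) q = c *\<^sub>C ((\<lambda>(x, y, z). (x \<otimes>\<^sub>H y, x \<otimes>\<^sub>H z)) p)"
      for c and p :: "'a \<times> 'b \<times> 'c"
      by (cases p, rule exI[of _ "(c *\<^sub>C fst p, snd p)"])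
         (simp add: tensor_scaleC_left scaleC_prod_def)
  qed (auto simp: cinner_tensor cinner_prod_def algebra_simps)
  then show ?thesis by auto
qed

text \<open>Here the common Gram matrix is the product of the three inner products.\<close>

lemma ex_associator:
  "\<exists>U::('a::chilbert, ('b::chilbert, 'c::chilbert) htensor) htensor \<Rightarrow>\<^sub>L (('a, 'b) htensor, 'c) htensor.
    (\<forall>x y z. blinfun_apply U (x \<otimes>\<^sub>H (y \<otimes>\<^sub>H z)) = (x \<otimes>\<^sub>H y) \<otimes>\<^sub>H z) \<and> unitary U"
proof -
  have "\<exists>U::('a, ('b, 'c) htensor) htensor \<Rightarrow>\<^sub>L (('a, 'b) htensor, 'c) htensor.
    (\<forall>p. blinfun_apply U ((\<lambda>(x, y, z). x \<otimes>\<^sub>H (y \<otimes>\<^sub>H z)) p) = (\<lambda>(x, y, z). (x \<otimes>\<^sub>H y) \<otimes>\<^sub>H z) p) \<and> unitary U"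
  proof (rule ex_unitary_extension[OF dense_tensor_tensor_right dense_tensor_tensor_left])
    show "\<exists>q. (\<lambda>(x, y, z). x \<otimes>\<^sub>H (y \<otimes>\<^sub>H z)) q = c *\<^sub>C ((\<lambda>(x, y, z). x \<otimes>\<^sub>H (y \<otimes>\<^sub>H z)) p) \<and>
        (\<lambda>(x, y, z). (x \<otimes>\<^sub>H y) \<otimes>\<^sub>H z) q = c *\<^sub>C ((\<lambda>(x, y, z). (x \<otimes>\<^sub>H y) \<otimes>\<^sub>H z) p)"
      for c and p :: "'a \<times> 'b \<times> 'c"
      by (cases p, rule exI[of _ "(c *\<^sub>C fst p, snd p)"]) (simp add: tensor_scaleC_left)
  qed (auto simp: cinner_tensor)
  then show ?thesis by auto
qed

lemma tensor_tensor_blinfun_eqI: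
  fixes R R' :: "('a::chilbert, ('b::chilbert, 'c::chilbert) htensor) htensor \<Rightarrow>\<^sub>L 'd::real_normed_vector"
  assumes "\<And>x y z. R (x \<otimes>\<^sub>H (y \<otimes>\<^sub>H z)) = R' (x \<otimes>\<^sub>H (y \<otimes>\<^sub>H z))"
  shows "R = R'"
proof (rule blinfun_eqI)
  fix u
  have "closure (span (range (\<lambda>(x, y, z). x \<otimes>\<^sub>H (y \<otimes>\<^sub>H z)))) \<subseteq> {u. R u = R' u}"
  proof (intro closure_minimal span_minimal)
    show "closed {u. R u = R' u}" by (intro closed_Collect_eq continuous_intros)
    show "subspace {u. R u = R' u}" by (auto simp: subspace_def blinfun.bilinear_simps)
  qed (use assms in auto)
  then show "R u = R' u" unfolding dense_tensor_tensor_right by auto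
qed

section \<open>The three claims, checked on generators\<close>

lemma rep_eq_via_op_tensor:
  assumes NM: "2 \<le> N" "2 \<le> M" and eq: "rep_eq_via N U \<pi> \<pi>'" "rep_eq_via M V \<rho> \<rho>'"
  shows "rep_eq_via (N * M) (op_tensor U V) (phi_tensor N M \<pi> \<rho>) (phi_tensor N M \<pi>' \<rho>')"
proof (rule rep_eq_viaI)
  have reps: "is_rep N \<pi>" "is_rep N \<pi>'" "is_rep M \<rho>" "is_rep M \<rho>'" and U: "unitary U" "unitary V"
    using eq by (auto simp: rep_eq_via_def)
  show "is_rep (N * M) (phi_tensor N M \<pi> \<rho>)" "is_rep (N * M) (phi_tensor N M \<pi>' \<rho>')"
    by (intro is_rep_phi_tensor NM reps)+
  show "unitary (op_tensor U V)" by (rule unitary_op_tensor[OF U])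
  fix k assume "k \<in> {1..N * M}"
  from cuntz_index_ex[OF this] obtain i j where ij: "i \<in> {1..N}" "j \<in> {1..M}" and k: "k = M * (i - 1) + j"
    by blast
  note C = unitaryD(1)[OF U(1)] unitaryD(1)[OF U(2)] is_rep_gen_clinear_ops[OF reps(1) ij(1)]
    is_rep_gen_clinear_ops[OF reps(2) ij(1)] is_rep_gen_clinear_ops[OF reps(3) ij(2)]
    is_rep_gen_clinear_ops[OF reps(4) ij(2)]
  show "op_tensor U V o\<^sub>L phi_tensor N M \<pi> \<rho> (cuntz_gen (N * M) k)
      = phi_tensor N M \<pi>' \<rho>' (cuntz_gen (N * M) k) o\<^sub>L op_tensor U V"
    unfolding k phi_tensor_gen[OF NM reps(1,3) ij] phi_tensor_gen[OF NM reps(2,4) ij]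
    by (rule htensor_blinfun_eqI)
       (simp add: op_tensor_apply C rep_eq_via_gen[OF eq(1) ij(1)] rep_eq_via_gen[OF eq(2) ij(2)])
qed

lemma phi_tensor_rep_sum:
  fixes \<pi> :: "cuntz_op \<Rightarrow> ('a::chilbert \<Rightarrow>\<^sub>L 'a)" and \<rho> :: "cuntz_op \<Rightarrow> ('b::chilbert \<Rightarrow>\<^sub>L 'b)"
    and \<rho>' :: "cuntz_op \<Rightarrow> ('c::chilbert \<Rightarrow>\<^sub>L 'c)"
  assumes NM: "2 \<le> N" "2 \<le> M" and \<pi>: "is_rep N \<pi>" and \<rho>: "is_rep M \<rho>" "is_rep M \<rho>'"
    and U: "\<And>x y z. blinfun_apply U (x \<otimes>\<^sub>H (y, z)) = (x \<otimes>\<^sub>H y, x \<otimes>\<^sub>H z)" "unitary U"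
  shows "rep_eq_via (N * M) U (phi_tensor N M \<pi> (rep_sum \<rho> \<rho>'))
    (rep_sum (phi_tensor N M \<pi> \<rho>) (phi_tensor N M \<pi> \<rho>'))"
proof (rule rep_eq_viaI[OF _ _ U(2)])
  note sum = is_rep_rep_sum[OF \<rho>]
  show "is_rep (N * M) (phi_tensor N M \<pi> (rep_sum \<rho> \<rho>'))"
    by (rule is_rep_phi_tensor[OF NM \<pi> sum])
  show "is_rep (N * M) (rep_sum (phi_tensor N M \<pi> \<rho>) (phi_tensor N M \<pi> \<rho>'))"
    by (intro is_rep_rep_sum is_rep_phi_tensor NM \<pi> \<rho>)
  fix k assume "k \<in> {1..N * M}"
  from cuntz_index_ex[OF this] obtain i j where ij: "i \<in> {1..N}" "j \<in> {1..M}" and k: "k = M * (i - 1) + j"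
    by blast
  note C = is_rep_gen_clinear_ops[OF \<pi> ij(1)] is_rep_gen_clinear_ops[OF \<rho>(1) ij(2)]
    is_rep_gen_clinear_ops[OF \<rho>(2) ij(2)] is_rep_gen_clinear_ops[OF sum ij(2), unfolded rep_sum_def]
  show "U o\<^sub>L phi_tensor N M \<pi> (rep_sum \<rho> \<rho>') (cuntz_gen (N * M) k)
      = rep_sum (phi_tensor N M \<pi> \<rho>) (phi_tensor N M \<pi> \<rho>') (cuntz_gen (N * M) k) o\<^sub>L U"
    unfolding k rep_sum_def[of "phi_tensor N M \<pi> \<rho>"] phi_tensor_gen[OF NM \<pi> sum ij]
      phi_tensor_gen[OF NM \<pi> \<rho>(1) ij] phi_tensor_gen[OF NM \<pi> \<rho>(2) ij]
  proof (rule htensor_blinfun_eqI)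
    fix x :: 'a and p :: "'b \<times> 'c"
    obtain y z where p: "p = (y, z)" by (cases p)
    \<comment> \<open>With S, T, T' the images of the generators, both sides give (S x \<otimes> T
      y, S x \<otimes> T' z).\<close>
    show "(U o\<^sub>L op_tensor (\<pi> (cuntz_gen N i)) (rep_sum \<rho> \<rho>' (cuntz_gen M j))) (x \<otimes>\<^sub>H p)
        = (op_sum (op_tensor (\<pi> (cuntz_gen N i)) (\<rho> (cuntz_gen M j)))
            (op_tensor (\<pi> (cuntz_gen N i)) (\<rho>' (cuntz_gen M j))) o\<^sub>L U) (x \<otimes>\<^sub>H p)"
      by (simp add: p rep_sum_def op_tensor_apply C op_sum_apply U(1))
  qed
qed

text \<open>The two bracketings number the triples (i, j, l) in the same lexicographic order, so one
  and the same generator goes to S \<otimes> (T \<otimes> R) and to (S \<otimes> T) \<otimes> R.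
  With another numbering a permutation of the generators could intervene.\<close>

lemma phi_tensor_assoc:
  assumes NML: "2 \<le> N" "2 \<le> M" "2 \<le> L"
    and reps: "is_rep N \<pi>" "is_rep M \<rho>" "is_rep L \<sigma>"
    and U: "\<And>x y z. blinfun_apply U (x \<otimes>\<^sub>H (y \<otimes>\<^sub>H z)) = (x \<otimes>\<^sub>H y) \<otimes>\<^sub>H z" "unitary U"
  shows "rep_eq_via (N * M * L) U (phi_tensor N (M * L) \<pi> (phi_tensor M L \<rho> \<sigma>))
    (phi_tensor (N * M) L (phi_tensor N M \<pi> \<rho>) \<sigma>)"
proof (rule rep_eq_viaI[OF _ _ U(2)])
  have two_left: "2 \<le> N * M" and two_right: "2 \<le> M * L"
    using mult_le_mono[of 2 N 1 M] mult_le_mono[of 2 M 1 L] NML by simp_all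
  have rep_right: "is_rep (M * L) (phi_tensor M L \<rho> \<sigma>)" by (rule is_rep_phi_tensor[OF NML(2,3) reps(2,3)])
  have rep_left: "is_rep (N * M) (phi_tensor N M \<pi> \<rho>)" by (rule is_rep_phi_tensor[OF NML(1,2) reps(1,2)])
  show "is_rep (N * M * L) (phi_tensor N (M * L) \<pi> (phi_tensor M L \<rho> \<sigma>))"
    unfolding mult.assoc by (rule is_rep_phi_tensor[OF NML(1) two_right reps(1) rep_right])
  show "is_rep (N * M * L) (phi_tensor (N * M) L (phi_tensor N M \<pi> \<rho>) \<sigma>)"
    by (rule is_rep_phi_tensor[OF two_left NML(3) rep_left reps(3)])
  fix k assume "k \<in> {1..N * M * L}"
  from cuntz_index_ex[OF this] obtain m l where m: "m \<in> {1..N * M}" and l: "l \<in> {1..L}"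
    and k1: "k = L * (m - 1) + l" by blast
  from cuntz_index_ex[OF m] obtain i j where ij: "i \<in> {1..N}" "j \<in> {1..M}" and m_eq: "m = M * (i - 1) + j"
    by blast
  define n where "n = L * (j - 1) + l"
  have n: "n \<in> {1..M * L}" by (rule cuntz_index(3)[OF ij(2) l n_def])
  \<comment> \<open>The case distinction resolves the natural subtraction: for j \<ge> 1 both sides
    are M L (i - 1) + L (j - 1) + l.\<close>
  have k2: "k = (M * L) * (i - 1) + n"
    using ij(2) unfolding k1 m_eq n_def by (cases j) (simp_all add: algebra_simps)
  let ?S = "\<pi> (cuntz_gen N i)" and ?T = "\<rho> (cuntz_gen M j)" and ?R = "\<sigma> (cuntz_gen L l)"
  note C = is_rep_gen_clinear_ops[OF reps(1) ij(1)] is_rep_gen_clinear_ops[OF reps(2) ij(2)]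
    is_rep_gen_clinear_ops[OF reps(3) l]
  have lhs: "phi_tensor N (M * L) \<pi> (phi_tensor M L \<rho> \<sigma>) (cuntz_gen (N * M * L) k)
      = op_tensor ?S (op_tensor ?T ?R)"
    unfolding k2 mult.assoc[of N] phi_tensor_gen[OF NML(1) two_right reps(1) rep_right ij(1) n]
    unfolding n_def phi_tensor_gen[OF NML(2,3) reps(2,3) ij(2) l] ..
  have rhs: "phi_tensor (N * M) L (phi_tensor N M \<pi> \<rho>) \<sigma> (cuntz_gen (N * M * L) k)
      = op_tensor (op_tensor ?S ?T) ?R"
    unfolding k1 phi_tensor_gen[OF two_left NML(3) rep_left reps(3) m l]
    unfolding m_eq phi_tensor_gen[OF NML(1,2) reps(1,2) ij] ..
  show "U o\<^sub>L phi_tensor N (M * L) \<pi> (phi_tensor M L \<rho> \<sigma>) (cuntz_gen (N * M * L) k)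
      = phi_tensor (N * M) L (phi_tensor N M \<pi> \<rho>) \<sigma> (cuntz_gen (N * M * L) k) o\<^sub>L U"
    unfolding lhs rhs
    by (rule tensor_tensor_blinfun_eqI) (simp add: op_tensor_apply op_tensor_clinear_ops C U(1))
qed

theorem lemma1p2:
  fixes N M L :: nat
    and \<pi>1 :: "cuntz_op \<Rightarrow> ('h1::chilbert \<Rightarrow>\<^sub>L 'h1)"
    and \<pi>1' :: "cuntz_op \<Rightarrow> ('k1::chilbert \<Rightarrow>\<^sub>L 'k1)"
    and \<pi>2 :: "cuntz_op \<Rightarrow> ('h2::chilbert \<Rightarrow>\<^sub>L 'h2)"
    and \<pi>2' :: "cuntz_op \<Rightarrow> ('k2::chilbert \<Rightarrow>\<^sub>L 'k2)"
    and \<pi>3 :: "cuntz_op \<Rightarrow> ('h3::chilbert \<Rightarrow>\<^sub>L 'h3)"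
  assumes "2 \<le> N" and "2 \<le> M" and "2 \<le> L"
    and "is_rep N \<pi>1" and "is_rep N \<pi>1'"
    and "is_rep M \<pi>2" and "is_rep M \<pi>2'"
    and "is_rep L \<pi>3"
  shows "(rep_equiv N \<pi>1 \<pi>1' \<and> rep_equiv M \<pi>2 \<pi>2' \<longrightarrow>
      rep_equiv (N * M) (phi_tensor N M \<pi>1 \<pi>2) (phi_tensor N M \<pi>1' \<pi>2'))
    \<and> (\<exists>U. (\<forall>x y z. blinfun_apply U (x \<otimes>\<^sub>H (y, z)) = (x \<otimes>\<^sub>H y, x \<otimes>\<^sub>H z)) \<and>
      rep_eq_via (N * M) U
        (phi_tensor N M \<pi>1 (rep_sum \<pi>2 \<pi>2'))
        (rep_sum (phi_tensor N M \<pi>1 \<pi>2) (phi_tensor N M \<pi>1 \<pi>2')))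
    \<and> (\<exists>U. (\<forall>x y z. blinfun_apply U (x \<otimes>\<^sub>H (y \<otimes>\<^sub>H z)) = (x \<otimes>\<^sub>H y) \<otimes>\<^sub>H z) \<and>
      rep_eq_via (N * M * L) U
        (phi_tensor N (M * L) \<pi>1 (phi_tensor M L \<pi>2 \<pi>3))
        (phi_tensor (N * M) L (phi_tensor N M \<pi>1 \<pi>2) \<pi>3))"
proof (intro conjI impI)
  show "rep_equiv (N * M) (phi_tensor N M \<pi>1 \<pi>2) (phi_tensor N M \<pi>1' \<pi>2')"
    if "rep_equiv N \<pi>1 \<pi>1' \<and> rep_equiv M \<pi>2 \<pi>2'"
    using that rep_eq_via_op_tensor[OF assms(1,2)] unfolding rep_equiv_def by blast
next
  \<comment> \<open>The identification depends on the Hilbert spaces alone; it is fixed before the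
    representations are compared.\<close>
  obtain U :: "('h1, 'h2 \<times> 'k2) htensor \<Rightarrow>\<^sub>L (('h1, 'h2) htensor \<times> ('h1, 'k2) htensor)" where
    U: "\<And>x y z. blinfun_apply U (x \<otimes>\<^sub>H (y, z)) = (x \<otimes>\<^sub>H y, x \<otimes>\<^sub>H z)" "unitary U"
    using ex_distributor by blast
  then show "\<exists>U. (\<forall>x y z. blinfun_apply U (x \<otimes>\<^sub>H (y, z)) = (x \<otimes>\<^sub>H y, x \<otimes>\<^sub>H z)) \<and>
      rep_eq_via (N * M) U (phi_tensor N M \<pi>1 (rep_sum \<pi>2 \<pi>2'))
        (rep_sum (phi_tensor N M \<pi>1 \<pi>2) (phi_tensor N M \<pi>1 \<pi>2'))"
    using phi_tensor_rep_sum[OF assms(1,2,4,6,7) U] by blast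
next
  obtain U :: "('h1, ('h2, 'h3) htensor) htensor \<Rightarrow>\<^sub>L (('h1, 'h2) htensor, 'h3) htensor" where
    U: "\<And>x y z. blinfun_apply U (x \<otimes>\<^sub>H (y \<otimes>\<^sub>H z)) = (x \<otimes>\<^sub>H y) \<otimes>\<^sub>H z" "unitary U"
    using ex_associator by blast
  then show "\<exists>U. (\<forall>x y z. blinfun_apply U (x \<otimes>\<^sub>H (y \<otimes>\<^sub>H z)) = (x \<otimes>\<^sub>H y) \<otimes>\<^sub>H z) \<and>
      rep_eq_via (N * M * L) U (phi_tensor N (M * L) \<pi>1 (phi_tensor M L \<pi>2 \<pi>3))
        (phi_tensor (N * M) L (phi_tensor N M \<pi>1 \<pi>2) \<pi>3)"
    using phi_tensor_assoc[OF assms(1-4,6,8) U] by blast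
qed

end
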